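(* For $\lambda\in\hat K$ let $\mathcal P(\lambda)=\mathcal P\cap \mathrm C_0(M)(\lambda)$. Then $$\mathcal P=\sum_{\lambda\in\hat K}\mathcal P(\lambda)\quad\text{(algebraic sum)},$$ and $\overline{\mathcal P(\lambda)}=\mathrm C_0(M)(\lambda)$ for every $\lambda\in\hat K$, the closure being taken in $\mathrm C_0(M)$.
   Context: $G\subset \mathrm{GL}(n,\mathbb R)$ is a real linear algebraic group (a closed subgroup of $\mathrm{GL}(n,\mathbb R)$), stable under transpose (hence real reductive); $K$ is a maximal compact subgroup of $G$. $M\subset\mathbb R^n$ is a smooth real affine algebraic variety on which $G$ acts regularly; the action on $M\subset\mathbb R^n$ is by matrices. $\mathrm C_0(M)$ is the Banach space of continuous complex valued functions on $M$ vanishing at infinity, with the supremum norm, and $(\pi(g)\varphi)(m)=\varphi(g^{-1}m)$ for $g\in G$. $\mathbb C[M]$ is the ring of all functions on $M$ obtained by restricting complex polynomials on $\mathbb R^n$ to $M$, $r^2(m)=m_1^2+\dots+m_n^2$, where coordinates are chosen so that $r^2$ is invariant under $K$, and $\mathcal P=\mathbb C[M]\cdot e^{-r^2}\subset \mathrm C_0(M)$. $\hat K$ is the set of equivalence classes of finite dimensional irreducible representations of $K$. For $\lambda\in\hat K$ with character $\xi_\lambda$ and degree $d(\lambda)$, put $P(\lambda)=d(\lambda)\int_K\overline{\xi_\lambda(k)}\,\pi(k)\,dk$ ($dk$ the normalized Haar measure on $K$), a continuous projection, and $\mathrm C_0(M)(\lambda)=P(\lambda)\mathrm C_0(M)$,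 the isotypic $K$-submodule of type $\lambda$. *)

theory Defs
  imports
    "HOL-Probability.Probability"
    "HOL-Algebra.Coset"
    "Jordan_Normal_Form.Matrix"
begin

no_notation vec_index (infixl \<open>$\<close> 100)
hide_const (open) Matrix.mat Matrix.vec

section \<open>Real linear algebraic groups\<close>

definition GL :: "(real^'n^'n) monoid" where
  "GL = \<lparr>carrier = {A. invertible A}, monoid.mult = (**), one = Finite_Cartesian_Product.mat 1\<rparr>"

text \<open>Polynomials in the coordinates are the functions satisfying
  \<^const>\<open>real_polynomial_function\<close>; a linear algebraic group is a Zariski closed subgroup of GL.\<close>

definition linear_algebraic_group :: "(real^'n^'n) set \<Rightarrow> bool" where
  "linear_algebraic_group G \<longleftrightarrow> subgroup G GL \<and>
     (\<exists>S. (\<forall>p\<in>S. real_polynomial_function p) \<and> G = {g. invertible g \<and> (\<forall>p\<in>S. p g = 0)})"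

definition maximal_compact_subgroup :: "(real^'n^'n) set \<Rightarrow> (real^'n^'n) set \<Rightarrow> bool" where
  "maximal_compact_subgroup K G \<longleftrightarrow> subgroup K GL \<and> compact K \<and> K \<subseteq> G \<and>
     (\<forall>L. subgroup L GL \<and> compact L \<and> K \<subseteq> L \<and> L \<subseteq> G \<longrightarrow> L = K)"

text \<open>A homomorphism from \<open>G\<close> to GL whose matrix entries are regular functions on \<open>G\<close>, i.e.
  restrictions to \<open>G\<close> of elements of the coordinate ring of GL (polynomials in the entries and
  the inverse of the determinant).\<close>

definition regular_rep :: "(real^'n^'n) set \<Rightarrow> (real^'n^'n \<Rightarrow> real^'n^'n) \<Rightarrow> bool" where
  "regular_rep G \<rho> \<longleftrightarrow> \<rho> \<in> hom (GL\<lparr>carrier := G\<rparr>) GL \<and>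
     (\<forall>i j. \<exists>p N. real_polynomial_function p \<and> (\<forall>g\<in>G. \<rho> g $ i $ j = p g / det g ^ N))"


section \<open>Smooth real affine varieties\<close>

definition algebraic_set :: "(real^'n) set \<Rightarrow> bool" where
  "algebraic_set M \<longleftrightarrow>
     (\<exists>S. (\<forall>p\<in>S. real_polynomial_function p) \<and> M = {x. \<forall>p\<in>S. p x = 0})"

definition vanishing_ideal :: "(real^'n) set \<Rightarrow> (real^'n \<Rightarrow> real) set" where
  "vanishing_ideal M = {p. real_polynomial_function p \<and> (\<forall>x\<in>M. p x = 0)}"

definition gradient :: "(real^'n \<Rightarrow> real) \<Rightarrow> real^'n \<Rightarrow> real^'n" where
  "gradient p x = (\<chi> i. frechet_derivative p (at x) (axis i 1))"

text \<open>Jacobian criterion for nonsingularity at \<open>x\<close>: near \<open>x\<close> the set is cut out by finitely many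
  elements of its vanishing ideal whose gradients at \<open>x\<close> are linearly independent. The local
  dimension (the dimension of the ambient space minus \<open>card F\<close>) may vary with the component.\<close>

definition smooth_at :: "(real^'n) set \<Rightarrow> real^'n \<Rightarrow> bool" where
  "smooth_at M x \<longleftrightarrow>
     (\<exists>F U. finite F \<and> F \<subseteq> vanishing_ideal M \<and> open U \<and> x \<in> U \<and>
        M \<inter> U = {y \<in> U. \<forall>p\<in>F. p y = 0} \<and>
        inj_on (\<lambda>p. gradient p x) F \<and> independent ((\<lambda>p. gradient p x) ` F))"

definition smooth_affine_variety :: "(real^'n) set \<Rightarrow> bool" where
  "smooth_affine_variety M \<longleftrightarrow> algebraic_set M \<and> (\<forall>x\<in>M. smooth_at M x)"


section \<open>The Banach space of functions vanishing at infinity\<close>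

text \<open>Functions on \<open>M\<close> are represented by their extension by zero to the ambient space.\<close>

definition C0 :: "(real^'n) set \<Rightarrow> (real^'n \<Rightarrow> complex) set" where
  "C0 M = {\<phi>. continuous_on M \<phi> \<and> (\<forall>x. x \<notin> M \<longrightarrow> \<phi> x = 0) \<and>
     (\<forall>\<epsilon>>0. \<exists>C. compact C \<and> C \<subseteq> M \<and> (\<forall>m\<in>M - C. cmod (\<phi> m) < \<epsilon>))}"

text \<open>The supremum may be taken over the whole ambient space, as the functions are zero off \<open>M\<close>.\<close>

definition C0_dist :: "(real^'n) set \<Rightarrow> (real^'n \<Rightarrow> complex) \<Rightarrow> (real^'n \<Rightarrow> complex) \<Rightarrow> real" where
  "C0_dist M \<phi> \<psi> =
     (if \<phi> \<in> C0 M \<and> \<psi> \<in> C0 M then (SUP m. cmod (\<phi> m - \<psi> m)) else 0)"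

definition C0_topology :: "(real^'n) set \<Rightarrow> (real^'n \<Rightarrow> complex) topology" where
  "C0_topology M = Metric_space.mtopology (C0 M) (C0_dist M)"

lemma C0_bounded:
  assumes "\<phi> \<in> C0 M"
  shows "\<exists>B. \<forall>x. cmod (\<phi> x) \<le> B"
proof -
  obtain C where C: "compact C" "C \<subseteq> M" "\<forall>m\<in>M - C. cmod (\<phi> m) < 1"
    using assms unfolding C0_def by (auto dest: spec[of _ 1])
  have "continuous_on C \<phi>"
    using assms C(2) continuous_on_subset unfolding C0_def by blast
  then have "bounded (\<phi> ` C)"
    using C(1) compact_continuous_image compact_imp_bounded by blast
  then obtain B where B: "\<forall>x\<in>C. cmod (\<phi> x) \<le> B"
    unfolding bounded_iff by auto
  have "cmod (\<phi> x) \<le> max B 1" for x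
  proof -
    consider "x \<in> C" | "x \<in> M - C" | "x \<notin> M" by blast
    then show ?thesis
    proof cases
      case 1
      then show ?thesis using B by fastforce
    next
      case 2
      then show ?thesis using C(3) by (force simp: le_max_iff_disj)
    next
      case 3
      then have "\<phi> x = 0" using assms unfolding C0_def by blast
      then show ?thesis by simp
    qed
  qed
  then show ?thesis by blast
qed

lemma C0_dist_bdd_above:
  assumes "\<phi> \<in> C0 M" "\<psi> \<in> C0 M"
  shows "bdd_above (range (\<lambda>m. cmod (\<phi> m - \<psi> m)))"
proof -
  obtain A B where "\<forall>x. cmod (\<phi> x) \<le> A" "\<forall>x. cmod (\<psi> x) \<le> B"
    using assms C0_bounded by meson
  then have "cmod (\<phi> x - \<psi> x) \<le> A + B" for x
    by (meson add_mono norm_triangle_ineq4 order_trans)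
  then show ?thesis by (auto simp: bdd_above_def)
qed

lemma Metric_space_C0: "Metric_space (C0 M) (C0_dist M)"
proof
  have upper: "cmod (\<phi> x - \<psi> x) \<le> C0_dist M \<phi> \<psi>" if "\<phi> \<in> C0 M" "\<psi> \<in> C0 M" for \<phi> \<psi> x
    using cSUP_upper[OF _ C0_dist_bdd_above[OF that], of x] that by (simp add: C0_dist_def)
  show "0 \<le> C0_dist M \<phi> \<psi>" for \<phi> \<psi>
    using upper[of \<phi> \<psi> 0] by (cases "\<phi> \<in> C0 M \<and> \<psi> \<in> C0 M")
      (auto simp: C0_dist_def intro: order_trans[OF norm_ge_zero])
  show "C0_dist M \<phi> \<psi> = C0_dist M \<psi> \<phi>" for \<phi> \<psi>
    by (auto simp: C0_dist_def norm_minus_commute)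
  show "C0_dist M \<phi> \<psi> = 0 \<longleftrightarrow> \<phi> = \<psi>" if "\<phi> \<in> C0 M" "\<psi> \<in> C0 M" for \<phi> \<psi>
  proof
    assume "C0_dist M \<phi> \<psi> = 0"
    then have "cmod (\<phi> x - \<psi> x) \<le> 0" for x using upper[OF that] by metis
    then show "\<phi> = \<psi>" by auto
  qed (simp add: C0_dist_def)
  show "C0_dist M \<phi> \<theta> \<le> C0_dist M \<phi> \<psi> + C0_dist M \<psi> \<theta>"
    if "\<phi> \<in> C0 M" "\<psi> \<in> C0 M" "\<theta> \<in> C0 M" for \<phi> \<psi> \<theta>
  proof -
    have "cmod (\<phi> x - \<theta> x) \<le> C0_dist M \<phi> \<psi> + C0_dist M \<psi> \<theta>" for x
      using upper[OF that(1,2), of x] upper[OF that(2,3), of x]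
        norm_triangle_ineq[of "\<phi> x - \<psi> x" "\<psi> x - \<theta> x"] by simp
    then have "(SUP x. cmod (\<phi> x - \<theta> x)) \<le> C0_dist M \<phi> \<psi> + C0_dist M \<psi> \<theta>"
      by (intro cSUP_least) auto
    then show ?thesis
      using that by (simp add: C0_dist_def)
  qed
qed

text \<open>The ring of restrictions to \<open>M\<close> of complex polynomials, again extended by zero.\<close>

definition coord_ring :: "(real^'n) set \<Rightarrow> (real^'n \<Rightarrow> complex) set" where
  "coord_ring M = {(\<lambda>m. if m \<in> M then p m else 0) | p. polynomial_function p}"

definition r2 :: "real^'n \<Rightarrow> real" where
  "r2 m = (\<Sum>i\<in>UNIV. (m $ i)\<^sup>2)"

definition poly_gauss :: "(real^'n) set \<Rightarrow> (real^'n \<Rightarrow> complex) set" where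
  "poly_gauss M = {(\<lambda>m. f m * of_real (exp (- r2 m))) | f. f \<in> coord_ring M}"


section \<open>Irreducible representations of a compact group\<close>

text \<open>A pair \<open>(d, R)\<close> is a continuous representation of \<open>K\<close> on the space of complex column
  vectors of length \<open>d\<close>; only the values of \<open>R\<close> on \<open>K\<close> matter.\<close>

type_synonym 'n rep = "nat \<times> (real^'n^'n \<Rightarrow> complex mat)"

definition is_rep :: "(real^'n^'n) set \<Rightarrow> 'n rep \<Rightarrow> bool" where
  "is_rep K = (\<lambda>(d, R).
     (\<forall>k\<in>K. R k \<in> carrier_mat d d) \<and>
     R (Finite_Cartesian_Product.mat 1) = 1\<^sub>m d \<and>
     (\<forall>k\<in>K. \<forall>l\<in>K. R (k ** l) = R k * R l) \<and>
     (\<forall>i<d. \<forall>j<d. continuous_on K (\<lambda>k. R k $$ (i, j))))"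

definition invariant_subspace :: "(real^'n^'n) set \<Rightarrow> 'n rep \<Rightarrow> complex Matrix.vec set \<Rightarrow> bool" where
  "invariant_subspace K = (\<lambda>(d, R) W.
     W \<subseteq> carrier_vec d \<and> 0\<^sub>v d \<in> W \<and>
     (\<forall>v\<in>W. \<forall>w\<in>W. v + w \<in> W) \<and> (\<forall>c. \<forall>w\<in>W. c \<cdot>\<^sub>v w \<in> W) \<and>
     (\<forall>k\<in>K. \<forall>w\<in>W. R k *\<^sub>v w \<in> W))"

definition irreps :: "(real^'n^'n) set \<Rightarrow> 'n rep set" where
  "irreps K = {(d, R). is_rep K (d, R) \<and> d > 0 \<and>
     (\<forall>W. invariant_subspace K (d, R) W \<longrightarrow> W = {0\<^sub>v d} \<or> W = carrier_vec d)}"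

definition equivalent_irreps :: "(real^'n^'n) set \<Rightarrow> ('n rep \<times> 'n rep) set" where
  "equivalent_irreps K = {((d, R), (e, S)). (d, R) \<in> irreps K \<and> (e, S) \<in> irreps K \<and> d = e \<and>
     (\<exists>T\<in>carrier_mat d d. invertible_mat T \<and> (\<forall>k\<in>K. T * R k = S k * T))}"

definition dual :: "(real^'n^'n) set \<Rightarrow> 'n rep set set" where
  "dual K = irreps K // equivalent_irreps K"

text \<open>Degree and character of a class are those of an arbitrary representative.\<close>

definition rep_degree :: "'n rep set \<Rightarrow> nat" where
  "rep_degree \<Lambda> = fst (SOME \<sigma>. \<sigma> \<in> \<Lambda>)"

definition rep_character :: "'n rep set \<Rightarrow> real^'n^'n \<Rightarrow> complex" where
  "rep_character \<Lambda> k = (let (d, R) = (SOME \<sigma>. \<sigma> \<in> \<Lambda>) in \<Sum>i<d. R k $$ (i, i))"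


section \<open>Isotypic components\<close>

definition normalized_haar :: "(real^'n^'n) set \<Rightarrow> (real^'n^'n) measure \<Rightarrow> bool" where
  "normalized_haar K \<mu> \<longleftrightarrow> sets \<mu> = sets (restrict_space borel K) \<and> prob_space \<mu> \<and>
     (\<forall>k\<in>K. distr \<mu> \<mu> (\<lambda>l. k ** l) = \<mu>)"

definition left_translate ::
  "(real^'n^'n \<Rightarrow> real^'n^'n) \<Rightarrow> real^'n^'n \<Rightarrow> (real^'n \<Rightarrow> complex) \<Rightarrow> real^'n \<Rightarrow> complex" where
  "left_translate \<rho> g \<phi> = (\<lambda>m. \<phi> (\<rho> (inv\<^bsub>GL\<^esub> g) *v m))"

text \<open>The operator-valued integral over \<open>K\<close> is evaluated pointwise; this agrees with the
  vector-valued integral, as evaluation at a point is a continuous linear functional.\<close>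

definition isotypic_proj ::
  "(real^'n^'n) measure \<Rightarrow> (real^'n^'n \<Rightarrow> real^'n^'n) \<Rightarrow> 'n rep set \<Rightarrow>
     (real^'n \<Rightarrow> complex) \<Rightarrow> real^'n \<Rightarrow> complex" where
  "isotypic_proj \<mu> \<rho> \<Lambda> \<phi> = (\<lambda>m. of_nat (rep_degree \<Lambda>) *
     (\<integral>k. cnj (rep_character \<Lambda> k) * left_translate \<rho> k \<phi> m \<partial>\<mu>))"

definition C0_isotypic ::
  "(real^'n) set \<Rightarrow> (real^'n^'n) measure \<Rightarrow> (real^'n^'n \<Rightarrow> real^'n^'n) \<Rightarrow> 'n rep set \<Rightarrow>
     (real^'n \<Rightarrow> complex) set" where
  "C0_isotypic M \<mu> \<rho> \<Lambda> = isotypic_proj \<mu> \<rho> \<Lambda> ` C0 M"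

definition poly_gauss_isotypic ::
  "(real^'n) set \<Rightarrow> (real^'n^'n) measure \<Rightarrow> (real^'n^'n \<Rightarrow> real^'n^'n) \<Rightarrow> 'n rep set \<Rightarrow>
     (real^'n \<Rightarrow> complex) set" where
  "poly_gauss_isotypic M \<mu> \<rho> \<Lambda> = poly_gauss M \<inter> C0_isotypic M \<mu> \<rho> \<Lambda>"

definition algebraic_sum ::
  "'i set \<Rightarrow> ('i \<Rightarrow> ('a \<Rightarrow> complex) set) \<Rightarrow> ('a \<Rightarrow> complex) set" where
  "algebraic_sum I V = {(\<lambda>x. \<Sum>i\<in>F. f i x) | F f. finite F \<and> F \<subseteq> I \<and> (\<forall>i\<in>F. f i \<in> V i)}"

end

theory Submission
  imports Defs "HOL-Library.Function_Algebras" "Jordan_Normal_Form.Char_Poly"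
begin

text \<open>Polynomials on the ambient space form a union of finite-dimensional \<open>K\<close>-invariant spaces \<open>V\<close>. If \<open>U\<close> is a
  maximal proper invariant subspace of \<open>V\<close> then \<open>V / U\<close> is irreducible, of type \<open>\<Lambda>\<close> say, and by Schur
  orthogonality \<open>P(\<Lambda>)\<close> is the identity on it; hence \<open>f = P(\<Lambda>) f + u\<close> with \<open>u\<close> in \<open>U\<close>, and induction on the
  dimension decomposes every polynomial. The weight \<open>exp (- r2)\<close> is invariant on \<open>M\<close>, so this descends to \<open>M\<close>.
  For the closures, polynomials times the Gaussian are dense in \<open>C0 M\<close> (Stone-Weierstrass on the one-point
  compactification), and \<open>P(\<Lambda>)\<close> is a bounded idempotent preserving them.\<close>

text \<open>Representations are not assumed unitary, so Schur orthogonality first comes out in terms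
  of \<open>R (ginv k)\<close>. The conjugate character in the definition of the projection is
  matched to it by an averaged Hermitian form, which makes the conjugate of a trace the trace at the
  inverse. Projections are integrals taken point by point; coordinates in a finite-dimensional space
  of functions are therefore read off by functionals built from finitely many point evaluations,
  which makes matrix coefficients continuous in \<open>k\<close> without a topology on the
  functions. In the density argument the obstacle is the fixed weight: Stone-Weierstrass produces
  polynomials times \<open>exp (- j * (norm x)\<^sup>2)\<close> with various j at least 1, while
  only j = 1 is allowed. Larger exponents are brought down to 1 in steps of 1/4, each step trading a
  factor \<open>exp (- (norm x)\<^sup>2 / 4)\<close> for a Taylor polynomial. A quarter is small
  enough for the remaining weight to control both the growth of the polynomial factor and the
  remainder.\<close>

no_notation vec_index (infixl \<open>$\<close> 100)

section \<open>Integration over a compact matrix group\<close>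

abbreviation ginv :: "real^'n^'n \<Rightarrow> real^'n^'n" where
  "ginv k \<equiv> inv\<^bsub>GL\<^esub> k"

lemma GL_simps [simp]:
  "carrier GL = {A :: real^'n^'n. invertible A}"
  "x \<otimes>\<^bsub>GL\<^esub> y = (x ** y :: real^'n^'n)"
  "\<one>\<^bsub>GL\<^esub> = (Finite_Cartesian_Product.mat 1 :: real^'n^'n)"
  by (simp_all add: GL_def)

lemma group_GL: "group (GL :: (real^'n^'n) monoid)"
proof (rule groupI)
  show "\<exists>y\<in>carrier GL. y \<otimes>\<^bsub>GL\<^esub> x = \<one>\<^bsub>GL\<^esub>" if "x \<in> carrier GL" for x :: "real^'n^'n"
  proof -
    have "invertible x" using that by simp
    then obtain y where "x ** y = Finite_Cartesian_Product.mat 1" "y ** x = Finite_Cartesian_Product.mat 1"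
      unfolding invertible_def by blast
    then show ?thesis by (intro bexI[of _ y]) (auto simp: invertible_def)
  qed
next
  show "\<one>\<^bsub>GL\<^esub> \<in> carrier (GL :: (real^'n^'n) monoid)"
    by (auto simp: invertible_def intro: exI[of _ "Finite_Cartesian_Product.mat 1"])
qed (auto simp: invertible_mult matrix_mul_assoc)

lemma continuous_on_matrix_mult [continuous_intros]:
  fixes f :: "'a::topological_space \<Rightarrow> real^'n^'m" and g :: "'a \<Rightarrow> real^'k^'n"
  assumes "continuous_on S f" "continuous_on S g"
  shows "continuous_on S (\<lambda>x. f x ** g x)"
  unfolding matrix_matrix_mult_def by (intro continuous_intros assms)

locale compact_matrix_group =
  fixes K :: "(real^'n^'n) set" and \<mu> :: "(real^'n^'n) measure"
  assumes subgroup_K: "subgroup K GL"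
    and compact_K: "compact K"
    and haar: "normalized_haar K \<mu>"
begin

sublocale prob_space \<mu>
  using haar by (simp add: normalized_haar_def)

lemma sets_haar [measurable_cong]: "sets \<mu> = sets (restrict_space borel K)"
  using haar by (simp add: normalized_haar_def)

lemma space_haar [simp]: "space \<mu> = K"
  using sets_eq_imp_space_eq[OF sets_haar] by (simp add: space_restrict_space)

lemma prob_K [simp]: "prob K = 1"
  using prob_space by simp

lemma invertible_K: "k \<in> K \<Longrightarrow> invertible k"
  using subgroup.subset[OF subgroup_K] by auto

lemma one_K [simp]: "Finite_Cartesian_Product.mat 1 \<in> K"
  using subgroup.one_closed[OF subgroup_K] by simp

lemma mult_K [simp]: "k \<in> K \<Longrightarrow> l \<in> K \<Longrightarrow> k ** l \<in> K"
  using subgroup.m_closed[OF subgroup_K] by simp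

lemma ginv_K [simp]: "k \<in> K \<Longrightarrow> ginv k \<in> K"
  using subgroup.m_inv_closed[OF subgroup_K] by simp

lemma ginv_left [simp]: "k \<in> K \<Longrightarrow> ginv k ** k = Finite_Cartesian_Product.mat 1"
  using group.l_inv[OF group_GL, of k] invertible_K by simp

lemma ginv_right [simp]: "k \<in> K \<Longrightarrow> k ** ginv k = Finite_Cartesian_Product.mat 1"
  using group.r_inv[OF group_GL, of k] invertible_K by simp

lemma ginv_mult: "k \<in> K \<Longrightarrow> l \<in> K \<Longrightarrow> ginv (k ** l) = ginv l ** ginv k"
  using group.inv_mult_group[OF group_GL, of k l] invertible_K by simp

lemma ginv_ginv [simp]: "k \<in> K \<Longrightarrow> ginv (ginv k) = k"
  using group.inv_inv[OF group_GL, of k] invertible_K by simp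

lemma ginv_one [simp]: "ginv (Finite_Cartesian_Product.mat 1) = (Finite_Cartesian_Product.mat 1 :: real^'n^'n)"
  using monoid.inv_one[OF group.is_monoid, OF group_GL[where 'n='n]] by simp

lemma ginv_mult_ginv: "k \<in> K \<Longrightarrow> l \<in> K \<Longrightarrow> ginv (l ** k) ** l = ginv k"
  by (simp add: ginv_mult flip: matrix_mul_assoc)

text \<open>The graph of inversion in \<open>K \<times> K\<close> is the closed set where the
  product is the identity, and a map into a compact set with closed graph is continuous.\<close>

lemma continuous_on_ginv: "continuous_on K ginv"
proof (rule continuous_from_closed_graph[OF compact_K])
  show "ginv \<in> K \<rightarrow> K" by auto
  have "(\<lambda>x. (x, ginv x)) ` K = {z \<in> K \<times> K. fst z ** snd z \<in> {Finite_Cartesian_Product.mat 1}}"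
  proof (intro equalityI subsetI)
    fix z assume "z \<in> {z \<in> K \<times> K. fst z ** snd z \<in> {Finite_Cartesian_Product.mat 1}}"
    then obtain x y where z: "z = (x, y)" "x \<in> K" "y \<in> K" "x ** y = Finite_Cartesian_Product.mat 1" by auto
    have "ginv x = ginv x ** (x ** y)" using z by simp
    also have "\<dots> = (ginv x ** x) ** y" by (simp only: matrix_mul_assoc)
    also have "\<dots> = y" using z by simp
    finally have "y = ginv x" by simp
    then show "z \<in> (\<lambda>x. (x, ginv x)) ` K" using z by auto
  qed auto
  also have "\<dots> = K \<times> K \<inter> (\<lambda>z. fst z ** snd z) -` {Finite_Cartesian_Product.mat 1}"
    by blast
  finally show "closed ((\<lambda>x. (x, ginv x)) ` K)"
    by (simp only:) (intro continuous_closed_preimage continuous_on_matrix_mult continuous_on_fst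
        continuous_on_snd continuous_on_id closed_singleton closed_Times compact_imp_closed compact_K)
qed

lemma continuous_on_compose_ginv:
  "continuous_on K f \<Longrightarrow> continuous_on K (\<lambda>k. f (ginv k))"
  by (rule continuous_on_compose2[OF _ continuous_on_ginv]) auto

lemma measurable_continuous:
  fixes f :: "real^'n^'n \<Rightarrow> 'b::topological_space"
  assumes "continuous_on K f"
  shows "f \<in> borel_measurable \<mu>"
  using borel_measurable_continuous_on_restrict[OF assms]
  by (simp cong: measurable_cong_sets add: sets_haar)

lemma bounded_continuous:
  fixes f :: "real^'n^'n \<Rightarrow> 'b::real_normed_vector"
  assumes "continuous_on K f"
  obtains B where "B > 0" "\<And>k. k \<in> K \<Longrightarrow> norm (f k) \<le> B"
proof -
  have "bounded (f ` K)"
    using compact_continuous_image[OF assms compact_K] compact_imp_bounded by blast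
  then show ?thesis using that by (auto simp: bounded_pos)
qed

lemma integrable_continuous:
  fixes f :: "real^'n^'n \<Rightarrow> 'b::{banach,second_countable_topology}"
  assumes "continuous_on K f"
  shows "integrable \<mu> f"
proof -
  obtain B where "\<And>k. k \<in> K \<Longrightarrow> norm (f k) \<le> B" using bounded_continuous[OF assms] by blast
  then show ?thesis
    by (intro integrable_const_bound[where B=B] measurable_continuous assms AE_I2) auto
qed

lemma integral_left_mult:
  fixes f :: "real^'n^'n \<Rightarrow> 'b::{banach,second_countable_topology}"
  assumes "l \<in> K" "continuous_on K f"
  shows "(\<integral>k. f (l ** k) \<partial>\<mu>) = (\<integral>k. f k \<partial>\<mu>)"
proof -
  have "(\<lambda>k. l ** k) \<in> measurable (restrict_space borel K) (restrict_space borel K)"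
    using assms(1) borel_measurable_continuous_on_restrict
        [OF continuous_on_matrix_mult[OF continuous_on_const[of K l] continuous_on_id]]
    by (auto intro!: measurable_restrict_space2 simp: space_restrict_space)
  then have "(\<lambda>k. l ** k) \<in> measurable \<mu> \<mu>"
    by (simp cong: measurable_cong_sets add: sets_haar)
  then have "(\<integral>k. f (l ** k) \<partial>\<mu>) = (\<integral>k. f k \<partial>distr \<mu> \<mu> (\<lambda>k. l ** k))"
    by (simp add: integral_distr measurable_continuous assms)
  then show ?thesis using haar assms(1) by (simp add: normalized_haar_def)
qed

end

section \<open>Schur orthogonality\<close>

text \<open>The character of one fixed representation, as opposed to \<open>rep_character\<close>,
  which goes through a chosen member of a class.\<close>

definition rep_trace :: "nat \<Rightarrow> (real^'n^'n \<Rightarrow> complex mat) \<Rightarrow> real^'n^'n \<Rightarrow> complex" where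
  "rep_trace d R k = (\<Sum>i<d. R k $$ (i, i))"

lemma times_mat_entry:
  assumes "A \<in> carrier_mat n m" "B \<in> carrier_mat m p" "i < n" "j < p"
  shows "(A * B) $$ (i, j) = (\<Sum>c<m. A $$ (i, c) * B $$ (c, j))"
  using assms by (simp add: scalar_prod_def lessThan_atLeast0)

lemma trace_times_commute:
  assumes "A \<in> carrier_mat n m" "B \<in> carrier_mat m n"
  shows "(\<Sum>i<n. (A * B) $$ (i, i)) = (\<Sum>i<m. (B * A) $$ (i, i) :: 'a::comm_semiring_1)"
proof -
  have "(\<Sum>i<n. (A * B) $$ (i, i)) = (\<Sum>i<n. \<Sum>c<m. A $$ (i, c) * B $$ (c, i))"
    by (intro sum.cong refl times_mat_entry[OF assms]) auto
  also have "\<dots> = (\<Sum>c<m. \<Sum>i<n. B $$ (c, i) * A $$ (i, c))"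
    by (subst sum.swap) (simp add: mult.commute)
  also have "\<dots> = (\<Sum>i<m. (B * A) $$ (i, i))"
    by (intro sum.cong refl times_mat_entry[OF assms(2,1), symmetric]) auto
  finally show ?thesis .
qed

lemma trace_similar:
  assumes T: "T \<in> carrier_mat d d" "invertible_mat T"
    and A: "A \<in> carrier_mat d d" "B \<in> carrier_mat d d" and eq: "T * A = B * T"
  shows "(\<Sum>i<d. A $$ (i, i)) = (\<Sum>i<d. B $$ (i, i) :: 'a::comm_ring_1)"
proof -
  obtain U where U: "T * U = 1\<^sub>m d" "U * T = 1\<^sub>m (dim_row U)"
    using T unfolding invertible_mat_def inverts_mat_def by auto
  \<comment> \<open>\<open>invertible_mat\<close> does not record the shape of the inverse, so its
    dimensions are read off from the two product equations.\<close>
  have "dim_row (U * T) = dim_row U" "dim_col (U * T) = d" using T by auto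
  with U have "dim_row U = d" by (metis index_one_mat(3))
  moreover have "dim_col U = d" using U(1) by (metis index_mult_mat(3) index_one_mat(3))
  ultimately have Uc: "U \<in> carrier_mat d d" by auto
  have "A = U * T * A" using U(2) \<open>dim_row U = d\<close> A by simp
  also have "\<dots> = U * (B * T)" using assoc_mult_mat[OF Uc T(1) A(1)] eq by simp
  finally have "(\<Sum>i<d. A $$ (i, i)) = (\<Sum>i<d. (B * T * U) $$ (i, i))"
    using trace_times_commute[OF Uc, of "B * T"] A T by simp
  also have "B * T * U = B"
    using assoc_mult_mat[OF A(2) T(1) Uc] U(1) A by simp
  finally show ?thesis .
qed

context compact_matrix_group
begin

lemma is_repD:
  assumes "is_rep K (d, R)"
  shows "k \<in> K \<Longrightarrow> R k \<in> carrier_mat d d"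
    and "R (Finite_Cartesian_Product.mat 1) = 1\<^sub>m d"
    and "k \<in> K \<Longrightarrow> l \<in> K \<Longrightarrow> R (k ** l) = R k * R l"
    and "i < d \<Longrightarrow> j < d \<Longrightarrow> continuous_on K (\<lambda>k. R k $$ (i, j))"
  using assms by (auto simp: is_rep_def)

lemma irrepsD:
  assumes "(d, R) \<in> irreps K"
  shows "is_rep K (d, R)" "d > 0"
    "invariant_subspace K (d, R) W \<Longrightarrow> W = {0\<^sub>v d} \<or> W = carrier_vec d"
  using assms by (auto simp: irreps_def)

lemma rep_mult_entry:
  assumes "is_rep K (d, R)" "k \<in> K" "l \<in> K" "i < d" "j < d"
  shows "R (k ** l) $$ (i, j) = (\<Sum>c<d. R k $$ (i, c) * R l $$ (c, j))"
  using times_mat_entry[OF is_repD(1)[OF assms(1,2)] is_repD(1)[OF assms(1,3)] assms(4,5)]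
  by (simp add: is_repD(3)[OF assms(1-3)])

lemma continuous_rep_ginv:
  assumes "is_rep K (d, R)" "i < d" "j < d"
  shows "continuous_on K (\<lambda>k. R (ginv k) $$ (i, j))"
  using continuous_on_compose_ginv[OF is_repD(4)[OF assms]] .

lemma continuous_rep_trace:
  assumes "is_rep K (d, R)"
  shows "continuous_on K (rep_trace d R)"
  unfolding rep_trace_def[abs_def] by (intro continuous_on_sum is_repD(4)[OF assms]) auto

text \<open>Over the complex numbers \<open>T\<close> has an eigenvalue, and commutation makes its
  eigenspace \<open>W\<close> invariant. A nonzero invariant subspace of an irreducible
  representation is everything.\<close>

lemma schur_scalar:
  assumes R: "(d, R) \<in> irreps K" and T: "T \<in> carrier_mat d d"
    and comm: "\<And>k. k \<in> K \<Longrightarrow> T * R k = R k * T"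
  obtains c where "T = c \<cdot>\<^sub>m 1\<^sub>m d"
proof -
  note d = irrepsD(2)[OF R] and carr = is_repD(1)[OF irrepsD(1)[OF R]]
  have "degree (char_poly T) = d" using degree_monic_char_poly[OF T] by simp
  then have "\<not> constant (poly (char_poly T))" using d by (simp add: constant_degree)
  then obtain c where "poly (char_poly T) c = 0"
    using fundamental_theorem_of_algebra by blast
  then obtain v where v: "v \<in> carrier_vec d" "v \<noteq> 0\<^sub>v d" "T *\<^sub>v v = c \<cdot>\<^sub>v v"
    using eigenvalue_root_char_poly[OF T, of c] T
    by (auto simp: eigenvalue_def eigenvector_def)
  define W where "W = {w \<in> carrier_vec d. T *\<^sub>v w = c \<cdot>\<^sub>v w}"
  have "invariant_subspace K (d, R) W"
    unfolding invariant_subspace_def prod.case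
  proof (intro conjI ballI allI)
    show "0\<^sub>v d \<in> W" using T by (auto simp: W_def)
  next
    fix v w assume "v \<in> W" "w \<in> W"
    then show "v + w \<in> W"
      using T by (auto simp: W_def mult_add_distrib_mat_vec[OF T] smult_add_distrib_vec[of _ d])
  next
    fix a w assume "w \<in> W"
    then show "a \<cdot>\<^sub>v w \<in> W"
      using T by (auto simp: W_def mult_mat_vec[OF T] smult_smult_assoc mult.commute)
  next
    fix k w assume k: "k \<in> K" and "w \<in> W"
    then have w: "w \<in> carrier_vec d" "T *\<^sub>v w = c \<cdot>\<^sub>v w" by (auto simp: W_def)
    have "T *\<^sub>v (R k *\<^sub>v w) = (R k * T) *\<^sub>v w"
      using w comm[OF k] assoc_mult_mat_vec[OF T carr[OF k]] by simp
    also have "\<dots> = c \<cdot>\<^sub>v (R k *\<^sub>v w)"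
      using w assoc_mult_mat_vec[OF carr[OF k] T] mult_mat_vec[OF carr[OF k]] by simp
    finally show "R k *\<^sub>v w \<in> W" using carr[OF k] w by (auto simp: W_def)
  qed (auto simp: W_def)
  then have W: "W = carrier_vec d" using irrepsD(3)[OF R] v by (auto simp: W_def)
  have "T = c \<cdot>\<^sub>m 1\<^sub>m d"
  proof (rule eq_matI)
    fix i j assume "i < dim_row (c \<cdot>\<^sub>m 1\<^sub>m d)" "j < dim_col (c \<cdot>\<^sub>m 1\<^sub>m d)"
    then have ij: "i < d" "j < d" by auto
    have "unit_vec d j \<in> W" using W by simp
    then have "vec_index (T *\<^sub>v unit_vec d j) i = vec_index (c \<cdot>\<^sub>v unit_vec d j) i" by (simp add: W_def)
    then show "T $$ (i, j) = (c \<cdot>\<^sub>m 1\<^sub>m d) $$ (i, j)"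
      using ij T by (simp add: scalar_prod_right_unit)
  qed (use T in auto)
  then show ?thesis by (rule that)
qed

text \<open>For fixed \<open>i\<close> and \<open>j\<close> the integrals are the entries of the
  average of \<open>R k * X * R (ginv k)\<close>, where X is the matrix unit with entry 1 at
  \<open>(i, j)\<close>. The substitution of \<open>l ** k\<close> for \<open>k\<close> shows that
  this average commutes with every \<open>R l\<close>, so it is a scalar matrix, and its trace
  determines the scalar.\<close>

lemma schur_orthogonality:
  assumes R: "(d, R) \<in> irreps K" and lt: "a < d" "b < d" "i < d" "j < d"
  shows "(\<integral>k. R k $$ (a, i) * R (ginv k) $$ (j, b) \<partial>\<mu>) = (if a = b \<and> i = j then 1 / of_nat d else 0)"
proof -
  note rep = irrepsD(1)[OF R] and d = irrepsD(2)[OF R]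
  note cont = is_repD(4)[OF rep] and cont' = continuous_rep_ginv[OF rep]
  note me = rep_mult_entry[OF rep] and carr = is_repD(1)[OF rep]
  define E where "E a b = (\<integral>k. R k $$ (a, i) * R (ginv k) $$ (j, b) \<partial>\<mu>)" for a b
  define T where "T = Matrix.mat d d (\<lambda>(a, b). E a b)"
  have T: "T \<in> carrier_mat d d" by (simp add: T_def)
  have int: "integrable \<mu> (\<lambda>k. R k $$ (a, i) * R (ginv k) $$ (j, b))" if "a < d" "b < d" for a b
    using that lt by (intro integrable_continuous continuous_intros cont cont')
  have comm: "T * R l = R l * T" if l: "l \<in> K" for l
  proof (rule eq_matI)
    fix a b assume "a < dim_row (R l * T)" "b < dim_col (R l * T)"
    then have ab: "a < d" "b < d" using T carr[OF l] by auto
    have "(T * R l) $$ (a, b) = (\<Sum>c<d. E a c * R l $$ (c, b))"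
      using times_mat_entry[OF T carr[OF l] ab] ab by (simp add: T_def)
    also have "\<dots> = (\<integral>k. (\<Sum>c<d. R k $$ (a, i) * R (ginv k) $$ (j, c) * R l $$ (c, b)) \<partial>\<mu>)"
      unfolding E_def
      by (subst Bochner_Integration.integral_sum) (auto intro!: integrable_mult_left int ab)
    also have "\<dots> = (\<integral>k. R k $$ (a, i) * R (ginv k ** l) $$ (j, b) \<partial>\<mu>)"
      by (rule Bochner_Integration.integral_cong) (auto simp: me l lt ab sum_distrib_left mult.assoc)
    also have "\<dots> = (\<integral>k. R (l ** k) $$ (a, i) * R (ginv (l ** k) ** l) $$ (j, b) \<partial>\<mu>)"
    proof (rule integral_left_mult[OF l, symmetric])
      have "continuous_on K (\<lambda>k. R k $$ (a, i) * (\<Sum>c<d. R (ginv k) $$ (j, c) * R l $$ (c, b)))"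
        using ab lt by (intro continuous_intros cont cont') auto
      then show "continuous_on K (\<lambda>k. R k $$ (a, i) * R (ginv k ** l) $$ (j, b))"
        by (rule continuous_on_cong[THEN iffD1, rotated -1]) (auto simp: me l lt ab)
    qed
    also have "\<dots> = (\<integral>k. (\<Sum>c<d. R l $$ (a, c) * (R k $$ (c, i) * R (ginv k) $$ (j, b))) \<partial>\<mu>)"
      by (rule Bochner_Integration.integral_cong)
        (auto simp: me l lt ab ginv_mult_ginv sum_distrib_right mult.assoc)
    also have "\<dots> = (\<Sum>c<d. R l $$ (a, c) * E c b)"
      unfolding E_def
      by (subst Bochner_Integration.integral_sum) (auto intro!: integrable_mult_right int ab)
    also have "\<dots> = (R l * T) $$ (a, b)"
      using times_mat_entry[OF carr[OF l] T ab] ab by (simp add: T_def)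
    finally show "(T * R l) $$ (a, b) = (R l * T) $$ (a, b)" .
  qed (use T carr[OF l] in auto)
  obtain c where c: "T = c \<cdot>\<^sub>m 1\<^sub>m d" using schur_scalar[OF R T comm] by blast
  have E: "E a b = (if a = b then c else 0)" if "a < d" "b < d" for a b
  proof -
    have "T $$ (a, b) = (if a = b then c else 0)" unfolding c using that by simp
    then show ?thesis using that by (simp add: T_def)
  qed
  \<comment> \<open>The trace puts \<open>R (ginv k)\<close> next to \<open>R k\<close>, so the
    integrand collapses to an entry of the identity matrix.\<close>
  have "of_nat d * c = (\<Sum>a<d. E a a)" by (simp add: E)
  also have "\<dots> = (\<integral>k. (\<Sum>a<d. R k $$ (a, i) * R (ginv k) $$ (j, a)) \<partial>\<mu>)"
    unfolding E_def by (subst Bochner_Integration.integral_sum) (auto intro!: int)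
  also have "\<dots> = (\<integral>k. R (ginv k ** k) $$ (j, i) \<partial>\<mu>)"
    by (rule Bochner_Integration.integral_cong) (auto simp: me lt mult.commute simp del: ginv_left)
  also have "\<dots> = (\<integral>k. (if i = j then 1 else 0) \<partial>\<mu>)"
    by (rule Bochner_Integration.integral_cong) (auto simp: is_repD(2)[OF rep] lt)
  also have "\<dots> = (if i = j then 1 else 0)" by (simp add: prob_space)
  finally have "of_nat d * c = (if i = j then 1 else 0)" .
  then have "c = (if i = j then 1 / of_nat d else 0)"
    using d by (auto simp: field_simps)
  then show ?thesis using E[of a b] lt by (simp add: E_def)
qed

text \<open>This version, with the inverse in the matrix entry, is the one that makes the
  projections idempotent; \<open>character_orthogonality\<close> below serves to identify a
  projection on an irreducible quotient.\<close>

lemma character_orthogonality_ginv: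
  assumes R: "(d, R) \<in> irreps K" and lt: "i < d" "j < d"
  shows "of_nat d * (\<integral>k. rep_trace d R k * R (ginv k) $$ (i, j) \<partial>\<mu>) = (if i = j then 1 else 0)"
proof -
  note rep = irrepsD(1)[OF R] and d = irrepsD(2)[OF R]
  have "(\<integral>k. rep_trace d R k * R (ginv k) $$ (i, j) \<partial>\<mu>)
    = (\<integral>k. (\<Sum>a<d. R k $$ (a, a) * R (ginv k) $$ (i, j)) \<partial>\<mu>)"
    by (simp add: rep_trace_def sum_distrib_right)
  also have "\<dots> = (\<Sum>a<d. \<integral>k. R k $$ (a, a) * R (ginv k) $$ (i, j) \<partial>\<mu>)"
    using lt by (intro Bochner_Integration.integral_sum integrable_continuous continuous_intros
        is_repD(4)[OF rep] continuous_rep_ginv[OF rep]) auto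
  also have "\<dots> = (\<Sum>a<d. if a = j then (if i = j then 1 / of_nat d else 0) else 0)"
    by (intro sum.cong refl) (use lt in \<open>auto simp: schur_orthogonality[OF R]\<close>)
  finally show ?thesis using lt d by simp
qed

text \<open>Averaging the standard Hermitian form over the group gives an invariant positive definite
  form \<open>H\<close>; it conjugates \<open>R k\<close> adjoint to \<open>R (ginv k)\<close>.\<close>

lemma cnj_character:
  assumes rep: "is_rep K (d, R)" and l: "l \<in> K"
  shows "cnj (rep_trace d R l) = rep_trace d R (ginv l)"
proof -
  note cont' = continuous_rep_ginv[OF rep]
  note me = rep_mult_entry[OF rep] and carr = is_repD(1)[OF rep]
  \<comment> \<open>Entry \<open>(a, b)\<close> of the standard Hermitian form pulled back by
    \<open>R (ginv k)\<close>. With the inverse, replacing \<open>k\<close> by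
    \<open>ginv l ** k\<close> multiplies this matrix by \<open>R l\<close> on the right, so left
    invariance of \<open>\<mu>\<close> applies.\<close>
  define h where "h a b k = (\<Sum>c<d. cnj (R (ginv k) $$ (c, a)) * R (ginv k) $$ (c, b))" for a b k
  have conth: "continuous_on K (h a b)" if "a < d" "b < d" for a b
    unfolding h_def[abs_def] using that by (intro continuous_intros cont') auto
  have inth: "integrable \<mu> (h a b)" if "a < d" "b < d" for a b
    using integrable_continuous[OF conth[OF that]] .
  define H where "H = Matrix.mat d d (\<lambda>(a, b). \<integral>k. h a b k \<partial>\<mu>)"
  have H: "H \<in> carrier_mat d d" by (simp add: H_def)
  define A where "A = Matrix.mat d d (\<lambda>(a, b). cnj (R l $$ (b, a)))"
  have A: "A \<in> carrier_mat d d" by (simp add: A_def)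
  have hl: "h a b (ginv l ** k) = (\<Sum>p<d. \<Sum>q<d. cnj (R l $$ (p, a)) * h p q k * R l $$ (q, b))"
    if "k \<in> K" "a < d" "b < d" for a b k
  proof -
    have "ginv (ginv l ** k) = ginv k ** l"
      using that l by (simp add: ginv_mult)
    then have "h a b (ginv l ** k)
      = (\<Sum>c<d. (\<Sum>p<d. cnj (R (ginv k) $$ (c, p)) * cnj (R l $$ (p, a))) *
                (\<Sum>q<d. R (ginv k) $$ (c, q) * R l $$ (q, b)))"
      unfolding h_def using that l by (simp add: me)
    also have "\<dots> = (\<Sum>c<d. \<Sum>p<d. \<Sum>q<d.
        cnj (R l $$ (p, a)) * (cnj (R (ginv k) $$ (c, p)) * R (ginv k) $$ (c, q)) * R l $$ (q, b))"
      by (simp only: sum_product) (simp add: mult_ac)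
    also have "\<dots> = (\<Sum>p<d. \<Sum>q<d. \<Sum>c<d.
        cnj (R l $$ (p, a)) * (cnj (R (ginv k) $$ (c, p)) * R (ginv k) $$ (c, q)) * R l $$ (q, b))"
      by (subst sum.swap) (rule sum.cong[OF refl], subst sum.swap, rule refl)
    finally show ?thesis by (simp add: h_def sum_distrib_left sum_distrib_right)
  qed
  have "A * H * R l = H"
  proof (rule eq_matI)
    fix a b assume "a < dim_row H" "b < dim_col H"
    then have ab: "a < d" "b < d" using H by auto
    have AH: "A * H \<in> carrier_mat d d" using A H by simp
    have "(A * H * R l) $$ (a, b) = (\<Sum>q<d. (\<Sum>p<d. cnj (R l $$ (p, a)) * (\<integral>k. h p q k \<partial>\<mu>)) * R l $$ (q, b))"
      using times_mat_entry[OF AH carr[OF l] ab] times_mat_entry[OF A H ab(1)] ab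
      by (simp add: A_def H_def)
    also have "\<dots> = (\<Sum>p<d. \<Sum>q<d. cnj (R l $$ (p, a)) * (\<integral>k. h p q k \<partial>\<mu>) * R l $$ (q, b))"
      by (subst sum.swap) (simp add: sum_distrib_right)
    also have "\<dots> = (\<integral>k. (\<Sum>p<d. \<Sum>q<d. cnj (R l $$ (p, a)) * h p q k * R l $$ (q, b)) \<partial>\<mu>)"
      by (subst Bochner_Integration.integral_sum)+ (auto simp: inth)
    also have "\<dots> = (\<integral>k. h a b (ginv l ** k) \<partial>\<mu>)"
      by (rule Bochner_Integration.integral_cong) (simp_all add: hl ab)
    also have "\<dots> = H $$ (a, b)"
      using integral_left_mult[OF ginv_K[OF l] conth[OF ab]] ab by (simp add: H_def)
    finally show "(A * H * R l) $$ (a, b) = H $$ (a, b)" .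
  qed (use A H carr[OF l] in auto)
  then have "A * H * R l * R (ginv l) = H * R (ginv l)" by simp
  moreover have "R l * R (ginv l) = 1\<^sub>m d"
    using is_repD(2,3)[OF rep] l by (metis ginv_K ginv_right)
  then have "A * H * R l * R (ginv l) = A * H"
    using assoc_mult_mat[OF mult_carrier_mat[OF A H] carr[OF l] carr[OF ginv_K[OF l]]] A H by simp
  ultimately have eq: "H * R (ginv l) = A * H" by simp
  \<comment> \<open>A null vector \<open>v\<close> of \<open>H\<close> would make the average of the
    nonnegative squared lengths \<open>N k\<close> of \<open>R (ginv k) *\<^sub>v v\<close> zero,
    while each \<open>R (ginv k)\<close> is invertible.\<close>
  have "Determinant.det H \<noteq> 0"
  proof
    assume "Determinant.det H = 0"
    then obtain v where v: "v \<in> carrier_vec d" "v \<noteq> 0\<^sub>v d" "H *\<^sub>v v = 0\<^sub>v d"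
      using det_0_iff_vec_prod_zero_field[OF H] by auto
    define y where "y k c = (\<Sum>b<d. R (ginv k) $$ (c, b) * vec_index v b)" for k c
    define N where "N k = (\<Sum>c<d. (cmod (y k c))\<^sup>2)" for k
    have Nh: "of_real (N k) = (\<Sum>a<d. \<Sum>b<d. cnj (vec_index v a) * h a b k * vec_index v b)" for k
    proof -
      have "of_real (N k) = (\<Sum>c<d. cnj (y k c) * y k c)"
        unfolding N_def of_real_sum by (simp add: complex_norm_square mult.commute del: of_real_power)
      also have "\<dots> = (\<Sum>c<d. \<Sum>a<d. \<Sum>b<d. cnj (vec_index v a) * (cnj (R (ginv k) $$ (c, a)) * R (ginv k) $$ (c, b)) * vec_index v b)"
        unfolding y_def by (simp only: sum_product cnj_sum) (simp add: mult_ac)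
      also have "\<dots> = (\<Sum>a<d. \<Sum>b<d. \<Sum>c<d. cnj (vec_index v a) * (cnj (R (ginv k) $$ (c, a)) * R (ginv k) $$ (c, b)) * vec_index v b)"
        by (subst sum.swap) (rule sum.cong[OF refl], subst sum.swap, rule refl)
      finally show ?thesis by (simp add: h_def sum_distrib_left sum_distrib_right)
    qed
    have contN: "continuous_on K N"
      unfolding N_def[abs_def] y_def by (intro continuous_intros cont') auto
    have "complex_of_real (\<integral>k. N k \<partial>\<mu>) = (\<integral>k. (\<Sum>a<d. \<Sum>b<d. cnj (vec_index v a) * h a b k * vec_index v b) \<partial>\<mu>)"
      using Nh by (simp flip: integral_complex_of_real)
    also have "\<dots> = (\<Sum>a<d. \<Sum>b<d. cnj (vec_index v a) * (\<integral>k. h a b k \<partial>\<mu>) * vec_index v b)"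
      by (subst Bochner_Integration.integral_sum)+ (auto simp: inth)
    also have "\<dots> = (\<Sum>a<d. cnj (vec_index v a) * vec_index (H *\<^sub>v v) a)"
      using v(1) by (intro sum.cong refl)
        (simp add: H_def scalar_prod_def lessThan_atLeast0 sum_distrib_left mult.assoc)
    also have "\<dots> = 0" using v by simp
    finally have "(\<integral>k. N k \<partial>\<mu>) = 0" by simp
    moreover have "N k \<ge> 0" for k by (simp add: N_def sum_nonneg)
    ultimately have "AE k in \<mu>. N k = 0"
      using integral_nonneg_eq_0_iff_AE[OF integrable_continuous[OF contN]] by simp
    \<comment> \<open>A single zero of \<open>N\<close> suffices, and vanishing almost everywhere
      for a probability measure provides one.\<close>
    have "\<exists>k\<in>K. N k = 0"
    proof (rule ccontr)
      assume "\<not> (\<exists>k\<in>K. N k = 0)"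
      then have "AE k in \<mu>. N k = 0 \<longrightarrow> False" by (intro AE_I2) auto
      with \<open>AE k in \<mu>. N k = 0\<close> have "AE k in \<mu>. False" by (rule AE_mp)
      then show False by (simp only: AE_False)
    qed
    then obtain k where k: "k \<in> K" "N k = 0" by blast
    have y: "y k c = 0" if "c < d" for c
      using k(2) that by (simp add: N_def sum_nonneg_eq_0_iff)
    have "R (ginv k) *\<^sub>v v = 0\<^sub>v d"
      using carr[OF ginv_K[OF k(1)]] y v(1)
      by (intro eq_vecI) (auto simp: y_def scalar_prod_def lessThan_atLeast0)
    then have "(R k * R (ginv k)) *\<^sub>v v = 0\<^sub>v d"
      using assoc_mult_mat_vec[OF carr[OF k(1)] carr[OF ginv_K[OF k(1)]] v(1)] carr[OF k(1)] by auto
    moreover have "R k * R (ginv k) = 1\<^sub>m d"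
      using is_repD(2,3)[OF rep] k(1) by (metis ginv_K ginv_right)
    ultimately show False using v by simp
  qed
  then have "invertible_mat H"
    using det_non_zero_imp_unit[OF H, of "()"] H
    by (auto simp: Units_def ring_mat_def invertible_mat_def inverts_mat_def)
  then have "(\<Sum>i<d. R (ginv l) $$ (i, i)) = (\<Sum>i<d. A $$ (i, i))"
    by (rule trace_similar[OF H _ carr[OF ginv_K[OF l]] A eq])
  then show ?thesis by (simp add: rep_trace_def A_def)
qed

text \<open>By \<open>cnj_character\<close> the conjugate trace is the sum of the diagonal entries
  of \<open>R (ginv k)\<close>, to which \<open>schur_orthogonality\<close> applies term by term. In
  matrix form: the average of \<open>R k\<close> against the conjugate character, times
  \<open>d\<close>, is the identity.\<close>

lemma character_orthogonality:
  assumes R: "(d, R) \<in> irreps K" and lt: "i < d" "j < d"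
  shows "of_nat d * (\<integral>k. cnj (rep_trace d R k) * R k $$ (i, j) \<partial>\<mu>) = (if i = j then 1 else 0)"
proof -
  note rep = irrepsD(1)[OF R] and d = irrepsD(2)[OF R]
  have "(\<integral>k. cnj (rep_trace d R k) * R k $$ (i, j) \<partial>\<mu>)
    = (\<integral>k. (\<Sum>a<d. R k $$ (i, j) * R (ginv k) $$ (a, a)) \<partial>\<mu>)"
    by (rule Bochner_Integration.integral_cong)
      (simp_all add: cnj_character[OF rep], simp add: rep_trace_def sum_distrib_left mult.commute)
  also have "\<dots> = (\<Sum>a<d. \<integral>k. R k $$ (i, j) * R (ginv k) $$ (a, a) \<partial>\<mu>)"
    using lt by (intro Bochner_Integration.integral_sum integrable_continuous continuous_intros
        is_repD(4)[OF rep] continuous_rep_ginv[OF rep]) auto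
  also have "\<dots> = (\<Sum>a<d. if a = j then (if i = j then 1 / of_nat d else 0) else 0)"
    by (intro sum.cong refl) (use lt in \<open>auto simp: schur_orthogonality[OF R]\<close>)
  finally show ?thesis using lt d by simp
qed

end

section \<open>Isotypic projections\<close>

lemma integral_double_sum:
  fixes f :: "'i \<Rightarrow> 'j \<Rightarrow> 'a \<Rightarrow> 'b::{banach,second_countable_topology}"
  assumes "\<And>i j. i \<in> A \<Longrightarrow> j \<in> B \<Longrightarrow> integrable M (f i j)"
  shows "(\<integral>x. (\<Sum>i\<in>A. \<Sum>j\<in>B. f i j x) \<partial>M) = (\<Sum>i\<in>A. \<Sum>j\<in>B. \<integral>x. f i j x \<partial>M)"
  using assms by (simp add: Bochner_Integration.integral_sum Bochner_Integration.integrable_sum)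

section \<open>Degree and character of a class in the dual\<close>

context compact_matrix_group
begin

lemma rep_trace_equivalent:
  assumes "((d, R), (e, S)) \<in> equivalent_irreps K" "k \<in> K"
  shows "d = e" "rep_trace d R k = rep_trace e S k"
proof -
  from assms obtain T where T: "(d, R) \<in> irreps K" "(e, S) \<in> irreps K" "d = e"
      "T \<in> carrier_mat d d" "invertible_mat T" "T * R k = S k * T"
    by (auto simp: equivalent_irreps_def)
  show "d = e" by (rule T(3))
  show "rep_trace d R k = rep_trace e S k"
    unfolding rep_trace_def
    using trace_similar[OF T(4,5) is_repD(1)[OF irrepsD(1)[OF T(1)] assms(2)] _ T(6)]
      is_repD(1)[OF irrepsD(1)[OF T(2)] assms(2)] T(3) by simp
qed

lemma irreps_self_class:
  assumes "(d, R) \<in> irreps K"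
  shows "(d, R) \<in> equivalent_irreps K `` {(d, R)}"
proof -
  note carr = is_repD(1)[OF irrepsD(1)[OF assms]]
  have "\<exists>T\<in>carrier_mat d d. invertible_mat T \<and> (\<forall>k\<in>K. T * R k = R k * T)"
    by (rule bexI[of _ "1\<^sub>m d"])
      (auto simp: invertible_mat_def inverts_mat_def left_mult_one_mat[OF carr] right_mult_one_mat[OF carr]
        intro!: exI[of _ "1\<^sub>m d"])
  with assms show ?thesis by (auto simp: equivalent_irreps_def)
qed

text \<open>The class contains \<open>(d, R)\<close> because the identity matrix intertwines
  \<open>R\<close> with itself. Hence the unspecified choice made by \<open>SOME\<close> is a
  genuine member and again irreducible.\<close>

lemma class_representative:
  fixes \<Lambda> :: "'n rep set"
  assumes "(d, R) \<in> irreps K" and \<Lambda>: "\<Lambda> = equivalent_irreps K `` {(d, R)}"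
  obtains e S where "(e, S) \<in> irreps K" "((d, R), (e, S)) \<in> equivalent_irreps K"
    "rep_degree \<Lambda> = e" "rep_character \<Lambda> = rep_trace e S"
proof -
  obtain e S where eS: "(SOME \<sigma>. \<sigma> \<in> \<Lambda>) = (e, S)" by (cases "SOME \<sigma>. \<sigma> \<in> \<Lambda>")
  have "(SOME \<sigma>. \<sigma> \<in> \<Lambda>) \<in> \<Lambda>"
    using irreps_self_class[OF assms(1)] \<Lambda> by (intro someI[of "\<lambda>\<sigma>. \<sigma> \<in> \<Lambda>"]) simp
  then have "((d, R), (e, S)) \<in> equivalent_irreps K" using eS \<Lambda> by simp
  moreover from this have "(e, S) \<in> irreps K" by (auto simp: equivalent_irreps_def)
  moreover have "rep_degree \<Lambda> = e" by (simp add: rep_degree_def eS)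
  moreover have "rep_character \<Lambda> = rep_trace e S"
    by (rule ext) (simp add: rep_character_def eS rep_trace_def)
  ultimately show ?thesis using that by blast
qed

lemma dual_representative:
  assumes "\<Lambda> \<in> dual K"
  obtains d R where "(d, R) \<in> irreps K" "rep_degree \<Lambda> = d" "rep_character \<Lambda> = rep_trace d R"
proof -
  from assms obtain x where x: "x \<in> irreps K" "\<Lambda> = equivalent_irreps K `` {x}"
    by (auto simp: dual_def elim: quotientE)
  obtain d R where dR: "x = (d, R)" by (cases x)
  show ?thesis using class_representative[OF x[unfolded dR]] that by metis
qed

text \<open>The characters are compared on \<open>K\<close> alone, since an intertwiner relates two
  representations only there; integrals against \<open>\<mu>\<close> see no other points.\<close>

lemma irrep_class:
  assumes "(d, R) \<in> irreps K"
  obtains \<Lambda> where "\<Lambda> \<in> dual K" "rep_degree \<Lambda> = d"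
    "\<And>k. k \<in> K \<Longrightarrow> rep_character \<Lambda> k = rep_trace d R k"
proof -
  obtain e S where eS: "((d, R), (e, S)) \<in> equivalent_irreps K"
      "rep_degree (equivalent_irreps K `` {(d, R)}) = e"
      "rep_character (equivalent_irreps K `` {(d, R)}) = rep_trace e S"
    using class_representative[OF assms refl] by metis
  show ?thesis
  proof (rule that)
    show "equivalent_irreps K `` {(d, R)} \<in> dual K" using assms by (simp add: dual_def quotientI)
    show "rep_degree (equivalent_irreps K `` {(d, R)}) = d"
      using eS(2) rep_trace_equivalent(1)[OF eS(1) one_K] by metis
    show "rep_character (equivalent_irreps K `` {(d, R)}) k = rep_trace d R k" if "k \<in> K" for k
      using eS(3) rep_trace_equivalent(2)[OF eS(1) that] by metis
  qed
qed

lemma continuous_rep_character: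
  assumes "\<Lambda> \<in> dual K"
  shows "continuous_on K (rep_character \<Lambda>)"
  using dual_representative[OF assms] continuous_rep_trace irrepsD(1) by metis

end

section \<open>Averaging functions along a linear action\<close>

locale compact_group_action = compact_matrix_group K \<mu>
  for K :: "(real^'n^'n) set" and \<mu> +
  fixes \<rho> :: "real^'n^'n \<Rightarrow> real^'n^'n"
  assumes rho_one: "\<rho> (Finite_Cartesian_Product.mat 1) = Finite_Cartesian_Product.mat 1"
    and rho_mult: "\<And>k l. k \<in> K \<Longrightarrow> l \<in> K \<Longrightarrow> \<rho> (k ** l) = \<rho> k ** \<rho> l"
    and continuous_rho: "continuous_on K \<rho>"
begin

lemma left_translate_mult:
  "k \<in> K \<Longrightarrow> l \<in> K \<Longrightarrow> left_translate \<rho> (k ** l) f = left_translate \<rho> k (left_translate \<rho> l f)"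
  by (simp add: left_translate_def ginv_mult rho_mult matrix_vector_mul_assoc)

lemma left_translate_one [simp]: "left_translate \<rho> (Finite_Cartesian_Product.mat 1) f = f"
  by (simp add: left_translate_def rho_one)

lemma continuous_orbit: "continuous_on K (\<lambda>k. \<rho> (ginv k) *v m)"
  unfolding matrix_vector_mult_def
  by (intro continuous_intros continuous_on_compose_ginv[OF continuous_rho])

text \<open>Continuity along orbits is what the pointwise integrals require. It covers polynomials
  and also functions in \<open>C0 M\<close>, whose extension by zero may jump at points of
  \<open>M\<close>.\<close>

definition orbit_continuous :: "(real^'n \<Rightarrow> complex) \<Rightarrow> bool" where
  "orbit_continuous f \<longleftrightarrow> (\<forall>m. continuous_on K (\<lambda>k. left_translate \<rho> k f m))"

lemma orbit_continuousD: "orbit_continuous f \<Longrightarrow> continuous_on K (\<lambda>k. left_translate \<rho> k f m)"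
  by (simp add: orbit_continuous_def)

lemma orbit_continuous_UNIV:
  assumes "continuous_on UNIV f"
  shows "orbit_continuous f"
  unfolding orbit_continuous_def left_translate_def
  using continuous_on_compose2[OF assms continuous_orbit] by auto

lemma integrable_isotypic:
  assumes "\<Lambda> \<in> dual K" "orbit_continuous f"
  shows "integrable \<mu> (\<lambda>k. cnj (rep_character \<Lambda> k) * left_translate \<rho> k f m)"
  by (intro integrable_continuous continuous_intros continuous_rep_character orbit_continuousD assms)

lemma isotypic_proj_add:
  assumes "\<Lambda> \<in> dual K" "orbit_continuous f" "orbit_continuous g"
  shows "isotypic_proj \<mu> \<rho> \<Lambda> (\<lambda>x. f x + g x) =
    (\<lambda>x. isotypic_proj \<mu> \<rho> \<Lambda> f x + isotypic_proj \<mu> \<rho> \<Lambda> g x)"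
proof
  fix m
  have "(\<integral>k. cnj (rep_character \<Lambda> k) * left_translate \<rho> k (\<lambda>x. f x + g x) m \<partial>\<mu>) =
    (\<integral>k. cnj (rep_character \<Lambda> k) * left_translate \<rho> k f m +
      cnj (rep_character \<Lambda> k) * left_translate \<rho> k g m \<partial>\<mu>)"
    by (simp add: left_translate_def ring_distribs)
  also have "\<dots> = (\<integral>k. cnj (rep_character \<Lambda> k) * left_translate \<rho> k f m \<partial>\<mu>) +
      (\<integral>k. cnj (rep_character \<Lambda> k) * left_translate \<rho> k g m \<partial>\<mu>)"
    by (intro Bochner_Integration.integral_add integrable_isotypic assms)
  finally show "isotypic_proj \<mu> \<rho> \<Lambda> (\<lambda>x. f x + g x) m =
      isotypic_proj \<mu> \<rho> \<Lambda> f m + isotypic_proj \<mu> \<rho> \<Lambda> g m"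
    by (simp add: isotypic_proj_def ring_distribs)
qed

lemma isotypic_proj_diff:
  assumes "\<Lambda> \<in> dual K" "orbit_continuous f" "orbit_continuous g"
  shows "isotypic_proj \<mu> \<rho> \<Lambda> (\<lambda>x. f x - g x) =
    (\<lambda>x. isotypic_proj \<mu> \<rho> \<Lambda> f x - isotypic_proj \<mu> \<rho> \<Lambda> g x)"
proof -
  have "orbit_continuous (\<lambda>x. f x - g x)"
    using assms(2,3) by (auto simp: orbit_continuous_def left_translate_def intro: continuous_on_diff)
  from isotypic_proj_add[OF assms(1) this assms(3)] show ?thesis
    by (auto simp: fun_eq_iff eq_diff_eq)
qed

text \<open>The value at \<open>m\<close> is an average over the orbit of \<open>m\<close>, so a
  bound \<open>B\<close> on that orbit is enough. This local form yields uniform boundedness, decay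
  at infinity and, with \<open>B = 0\<close>, vanishing outside \<open>M\<close>.\<close>

lemma isotypic_proj_bound:
  assumes "\<Lambda> \<in> dual K"
  obtains C where "C > 0" "\<And>f B m. orbit_continuous f \<Longrightarrow>
    (\<And>k. k \<in> K \<Longrightarrow> cmod (left_translate \<rho> k f m) \<le> B) \<Longrightarrow> cmod (isotypic_proj \<mu> \<rho> \<Lambda> f m) \<le> C * B"
proof -
  obtain D where D: "D > 0" "\<And>k. k \<in> K \<Longrightarrow> cmod (rep_character \<Lambda> k) \<le> D"
    using bounded_continuous[OF continuous_rep_character[OF assms]] by blast
  \<comment> \<open>The summand 1 makes the constant visibly positive, whatever the degree.\<close>
  have "cmod (isotypic_proj \<mu> \<rho> \<Lambda> f m) \<le> ((of_nat (rep_degree \<Lambda>) + 1) * D) * B"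
    if f: "orbit_continuous f" "\<And>k. k \<in> K \<Longrightarrow> cmod (left_translate \<rho> k f m) \<le> B" for f B m
  proof -
    have B: "B \<ge> 0" using f(2)[OF one_K] order_trans[OF norm_ge_zero] by blast
    have "cmod (\<integral>k. cnj (rep_character \<Lambda> k) * left_translate \<rho> k f m \<partial>\<mu>)
      \<le> (\<integral>k. cmod (cnj (rep_character \<Lambda> k) * left_translate \<rho> k f m) \<partial>\<mu>)"
      by (rule integral_norm_bound)
    also have "\<dots> \<le> (\<integral>k. D * B \<partial>\<mu>)"
      using D f B by (intro integral_mono integrable_norm integrable_isotypic assms)
        (auto simp: norm_mult intro!: mult_mono)
    also have "\<dots> = D * B" by simp
    finally have "cmod (isotypic_proj \<mu> \<rho> \<Lambda> f m) \<le> of_nat (rep_degree \<Lambda>) * (D * B)"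
      by (simp add: isotypic_proj_def norm_mult mult_left_mono)
    also have "\<dots> \<le> (of_nat (rep_degree \<Lambda>) + 1) * (D * B)"
      using D B by (intro mult_right_mono) auto
    finally show ?thesis by (simp add: mult.assoc)
  qed
  then show ?thesis using that[of "(of_nat (rep_degree \<Lambda>) + 1) * D"] D(1) by fastforce
qed

text \<open>Expanding the character at \<open>ginv k ** h\<close> into products of matrix entries separates the two
  integration variables, so that no exchange of integrals is needed.\<close>

lemma isotypic_proj_idem:
  assumes \<Lambda>: "\<Lambda> \<in> dual K" and f: "orbit_continuous f"
  shows "isotypic_proj \<mu> \<rho> \<Lambda> (isotypic_proj \<mu> \<rho> \<Lambda> f) = isotypic_proj \<mu> \<rho> \<Lambda> f"
proof
  fix m
  obtain d R where R: "(d, R) \<in> irreps K" "rep_degree \<Lambda> = d" "rep_character \<Lambda> = rep_trace d R"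
    using dual_representative[OF \<Lambda>] by blast
  note rep = irrepsD(1)[OF R(1)]
  note cont = is_repD(4)[OF rep] and cont' = continuous_rep_ginv[OF rep] and contt = continuous_rep_trace[OF rep]
  define \<Phi> where "\<Phi> k = left_translate \<rho> k f m" for k
  have cont\<Phi>: "continuous_on K \<Phi>" using orbit_continuousD[OF f] by (simp add: \<Phi>_def[abs_def])
  define J where "J i j = (\<integral>h. cnj (R h $$ (i, j)) * \<Phi> h \<partial>\<mu>)" for i j
  have intJ: "integrable \<mu> (\<lambda>h. cnj (R h $$ (i, j)) * \<Phi> h)" if "i < d" "j < d" for i j
    using that by (intro integrable_continuous continuous_intros cont cont\<Phi>)
  have inner: "left_translate \<rho> k (isotypic_proj \<mu> \<rho> \<Lambda> f) m =
      of_nat d * (\<Sum>i<d. \<Sum>j<d. cnj (R (ginv k) $$ (i, j)) * J j i)" if k: "k \<in> K" for k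
  proof -
    have tr: "rep_trace d R (ginv k ** h) = (\<Sum>i<d. \<Sum>j<d. R (ginv k) $$ (i, j) * R h $$ (j, i))"
      if "h \<in> K" for h
      using that k by (simp add: rep_trace_def rep_mult_entry[OF rep])
    have "left_translate \<rho> k (isotypic_proj \<mu> \<rho> \<Lambda> f) m =
      of_nat d * (\<integral>l. cnj (rep_trace d R l) * left_translate \<rho> l f (\<rho> (ginv k) *v m) \<partial>\<mu>)"
      by (simp add: left_translate_def isotypic_proj_def R)
    \<comment> \<open>Writing \<open>l\<close> as \<open>ginv k ** (k ** l)\<close> turns the
      integrand into a function of \<open>k ** l\<close>; left invariance then leaves
      \<open>k\<close> in the character only.\<close>
    also have "(\<integral>l. cnj (rep_trace d R l) * left_translate \<rho> l f (\<rho> (ginv k) *v m) \<partial>\<mu>) =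
      (\<integral>l. cnj (rep_trace d R (ginv k ** (k ** l))) * \<Phi> (k ** l) \<partial>\<mu>)"
      using k by (intro Bochner_Integration.integral_cong refl)
        (simp add: \<Phi>_def left_translate_mult matrix_mul_assoc, simp add: left_translate_def)
    also have "\<dots> = (\<integral>h. cnj (rep_trace d R (ginv k ** h)) * \<Phi> h \<partial>\<mu>)"
    proof (rule integral_left_mult[OF k])
      have "continuous_on K (\<lambda>h. cnj (\<Sum>i<d. \<Sum>j<d. R (ginv k) $$ (i, j) * R h $$ (j, i)) * \<Phi> h)"
        by (intro continuous_intros cont cont\<Phi>) auto
      then show "continuous_on K (\<lambda>h. cnj (rep_trace d R (ginv k ** h)) * \<Phi> h)"
        by (rule continuous_on_cong[THEN iffD1, rotated -1]) (auto simp: tr)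
    qed
    also have "\<dots> = (\<integral>h. (\<Sum>i<d. \<Sum>j<d. cnj (R (ginv k) $$ (i, j)) * (cnj (R h $$ (j, i)) * \<Phi> h)) \<partial>\<mu>)"
      by (rule Bochner_Integration.integral_cong) (simp_all add: tr sum_distrib_right mult.assoc)
    also have "\<dots> = (\<Sum>i<d. \<Sum>j<d. cnj (R (ginv k) $$ (i, j)) * J j i)"
      unfolding J_def by (subst Bochner_Integration.integral_sum)+ (auto simp: intJ)
    finally show ?thesis .
  qed
  have ortho: "of_nat d * (\<integral>k. cnj (rep_trace d R k) * cnj (R (ginv k) $$ (i, j)) \<partial>\<mu>) = (if i = j then 1 else 0)"
    if "i < d" "j < d" for i j
    using arg_cong[OF character_orthogonality_ginv[OF R(1) that], of cnj]
    by (simp flip: Bochner_Integration.integral_cnj split: if_splits)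
  have "isotypic_proj \<mu> \<rho> \<Lambda> (isotypic_proj \<mu> \<rho> \<Lambda> f) m
    = of_nat d * (\<integral>k. cnj (rep_trace d R k) *
        (of_nat d * (\<Sum>i<d. \<Sum>j<d. cnj (R (ginv k) $$ (i, j)) * J j i)) \<partial>\<mu>)"
    unfolding isotypic_proj_def[of _ _ _ "isotypic_proj \<mu> \<rho> \<Lambda> f"] R(2,3)
    by (intro arg_cong[where f="\<lambda>x. _ * x"] Bochner_Integration.integral_cong refl) (simp add: inner)
  also have "\<dots> = of_nat d * (\<integral>k. (\<Sum>i<d. \<Sum>j<d.
        of_nat d * (cnj (rep_trace d R k) * cnj (R (ginv k) $$ (i, j))) * J j i) \<partial>\<mu>)"
    by (simp add: sum_distrib_left mult_ac)
  also have "\<dots> = of_nat d * (\<Sum>i<d. \<Sum>j<d.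
        of_nat d * (\<integral>k. cnj (rep_trace d R k) * cnj (R (ginv k) $$ (i, j)) \<partial>\<mu>) * J j i)"
    by (subst integral_double_sum)
      (auto intro!: integrable_mult_left integrable_mult_right integrable_continuous continuous_intros contt cont')
  \<comment> \<open>Orthogonality keeps the diagonal integrals \<open>J i i\<close>, whose sum is
    again the integral of \<open>\<Phi>\<close> against the conjugate character.\<close>
  also have "\<dots> = of_nat d * (\<Sum>i<d. \<Sum>j<d. (if j = i then J i i else 0))"
    by (intro arg_cong[where f="\<lambda>x. _ * x"] sum.cong refl) (simp add: ortho)
  also have "\<dots> = of_nat d * (\<Sum>i<d. J i i)" by simp
  also have "(\<Sum>i<d. J i i) = (\<integral>h. (\<Sum>i<d. cnj (R h $$ (i, i)) * \<Phi> h) \<partial>\<mu>)"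
    unfolding J_def by (subst Bochner_Integration.integral_sum) (auto simp: intJ)
  also have "of_nat d * \<dots> = isotypic_proj \<mu> \<rho> \<Lambda> f m"
    by (simp add: isotypic_proj_def R rep_trace_def \<Phi>_def sum_distrib_right)
  finally show "isotypic_proj \<mu> \<rho> \<Lambda> (isotypic_proj \<mu> \<rho> \<Lambda> f) m = isotypic_proj \<mu> \<rho> \<Lambda> f m" .
qed

end

section \<open>Finite-dimensional invariant spaces of functions\<close>

interpretation fn: vector_space "\<lambda>(c::complex) (f::'a \<Rightarrow> complex) x. c * f x"
  by unfold_locales (simp_all add: fun_eq_iff ring_distribs mult.assoc)

lemma sum_fun_apply: "(\<Sum>i\<in>A. f i) x = (\<Sum>i\<in>A. f i x :: complex)"
  by (induction A rule: infinite_finite_induct) auto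

lemma fn_span_finite:
  assumes "finite S"
  shows "fn.span S = range (\<lambda>u x. \<Sum>s\<in>S. u s * s x)"
  unfolding fn.span_finite[OF assms] by (simp add: fun_eq_iff sum_fun_apply image_def)

lemma fn_span_sumI:
  assumes "\<And>i. i \<in> A \<Longrightarrow> f i \<in> fn.span S"
  shows "(\<lambda>x. \<Sum>i\<in>A. u i * f i x) \<in> fn.span S"
proof -
  have "(\<Sum>i\<in>A. (\<lambda>x. u i * f i x)) \<in> fn.span S"
    by (intro fn.span_sum fn.span_scale assms)
  moreover have "(\<Sum>i\<in>A. (\<lambda>x. u i * f i x)) = (\<lambda>x. \<Sum>i\<in>A. u i * f i x)"
    by (simp add: fun_eq_iff sum_fun_apply)
  ultimately show ?thesis by simp
qed

text \<open>The last clause turns continuity in \<open>k\<close> at every point \<open>x\<close>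
  into continuity of the coordinate. It is the property of finite combinations of point evaluations
  that stands in for a topology on the space of functions.\<close>

definition pointwise_functional :: "'k::topological_space set \<Rightarrow> (('a \<Rightarrow> complex) \<Rightarrow> complex) \<Rightarrow> bool" where
  "pointwise_functional K L \<longleftrightarrow> (\<forall>f g. L (\<lambda>x. f x + g x) = L f + L g) \<and> (\<forall>c f. L (\<lambda>x. c * f x) = c * L f) \<and>
     (\<forall>F. (\<forall>x. continuous_on K (\<lambda>k. F k x)) \<longrightarrow> continuous_on K (\<lambda>k. L (F k)))"

lemma pointwise_functionalD:
  assumes "pointwise_functional K L"
  shows "L (\<lambda>x. f x + g x) = L f + L g" "L (\<lambda>x. c * f x) = c * L f"
    "(\<And>x. continuous_on K (\<lambda>k. F k x)) \<Longrightarrow> continuous_on K (\<lambda>k. L (F k))"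
  using assms by (auto simp: pointwise_functional_def)

lemma pointwise_functional_sum:
  assumes "pointwise_functional K L" "finite A"
  shows "L (\<lambda>x. \<Sum>i\<in>A. u i * f i x) = (\<Sum>i\<in>A. u i * L (f i))"
  using assms(2)
proof (induction A rule: finite_induct)
  case empty
  show ?case using pointwise_functionalD(2)[OF assms(1), of 0 "\<lambda>_. 0"] by simp
next
  case (insert a A)
  then show ?case by (simp add: pointwise_functionalD(1,2)[OF assms(1)])
qed

text \<open>A new element \<open>s0\<close> outside the span differs from its formal expansion in
  \<open>S\<close>, hence differs from it at some point \<open>y\<close>. Evaluation of this
  difference at \<open>y\<close> gives the new functional, so the whole dual basis consists of
  combinations of point evaluations.\<close>

lemma dual_functionals_exist:
  fixes S :: "('a \<Rightarrow> complex) set" and K :: "'k::topological_space set"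
  assumes "finite S" "fn.independent S"
  shows "\<exists>e. \<forall>s\<in>S. pointwise_functional K (e s) \<and> (\<forall>t\<in>S. e s t = (if s = t then 1 else 0))"
  using assms
proof (induction S rule: finite_induct)
  case empty
  then show ?case by simp
next
  case (insert s0 S)
  then have ind: "fn.independent S" "s0 \<notin> fn.span S"
    by (auto simp: fn.independent_insert split: if_splits)
  then obtain e where e: "\<And>s. s \<in> S \<Longrightarrow> pointwise_functional K (e s)"
      "\<And>s t. s \<in> S \<Longrightarrow> t \<in> S \<Longrightarrow> e s t = (if s = t then 1 else 0)"
    using insert.IH by blast
  have "(\<lambda>x. \<Sum>s\<in>S. e s s0 * s x) \<in> fn.span S" by (intro fn_span_sumI fn.span_base)
  then have "s0 \<noteq> (\<lambda>x. \<Sum>s\<in>S. e s s0 * s x)" using ind(2) by metis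
  then obtain y where y: "s0 y - (\<Sum>s\<in>S. e s s0 * s y) \<noteq> 0" by (auto simp: fun_eq_iff)
  define n where "n = s0 y - (\<Sum>s\<in>S. e s s0 * s y)"
  \<comment> \<open>The deviation of \<open>f\<close> from its expansion in \<open>S\<close>,
    measured at \<open>y\<close>. It is zero on \<open>S\<close>, and division by \<open>n\<close>
    makes it 1 at \<open>s0\<close>.\<close>
  define e1 where "e1 f = (f y - (\<Sum>s\<in>S. e s f * s y)) / n" for f
  have e1: "pointwise_functional K e1"
    unfolding pointwise_functional_def
  proof (intro conjI allI impI)
    show "e1 (\<lambda>x. f x + g x) = e1 f + e1 g" for f g
      by (simp add: e1_def pointwise_functionalD(1)[OF e(1)] ring_distribs sum.distrib
          flip: add_divide_distrib)
    show "e1 (\<lambda>x. c * f x) = c * e1 f" for c f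
      by (simp add: e1_def pointwise_functionalD(2)[OF e(1)] right_diff_distrib sum_distrib_left mult.assoc)
    show "continuous_on K (\<lambda>k. e1 (F k))" if "\<forall>x. continuous_on K (\<lambda>k. F k x)" for F
      using that y unfolding e1_def
      by (intro continuous_intros pointwise_functionalD(3)[OF e(1)]) (auto simp: n_def)
  qed
  have e1_S: "e1 t = 0" if "t \<in> S" for t
  proof -
    have "(\<Sum>s\<in>S. e s t * s y) = (\<Sum>s\<in>S. if s = t then t y else 0)"
      by (intro sum.cong refl) (use that in \<open>auto simp: e(2)\<close>)
    then show ?thesis using that insert(1) by (simp add: e1_def)
  qed
  have e1_s0: "e1 s0 = 1" using y by (simp add: e1_def n_def)
  \<comment> \<open>The old functionals are corrected by a multiple of \<open>e1\<close> so that
    they vanish at \<open>s0\<close>; on \<open>S\<close> they are unchanged because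
    \<open>e1\<close> is zero there.\<close>
  define e' where "e' s f = (if s = s0 then e1 f else e s f - e s s0 * e1 f)" for s f
  have "pointwise_functional K (e' s)" if "s \<in> insert s0 S" for s
    unfolding pointwise_functional_def
  proof (intro conjI allI impI)
    have es: "s \<noteq> s0 \<Longrightarrow> pointwise_functional K (e s)" using that e(1) by auto
    show "e' s (\<lambda>x. f x + g x) = e' s f + e' s g" for f g
      using es by (auto simp: e'_def pointwise_functionalD(1)[OF e1] pointwise_functionalD(1) algebra_simps)
    show "e' s (\<lambda>x. c * f x) = c * e' s f" for c f
      using es by (auto simp: e'_def pointwise_functionalD(2)[OF e1] pointwise_functionalD(2) algebra_simps)
    show "continuous_on K (\<lambda>k. e' s (F k))" if "\<forall>x. continuous_on K (\<lambda>k. F k x)" for F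
      using that unfolding e'_def
      by (cases "s = s0")
        (auto intro!: continuous_intros pointwise_functionalD(3)[OF e1] pointwise_functionalD(3)[OF es])
  qed
  moreover have "e' s t = (if s = t then 1 else 0)" if "s \<in> insert s0 S" "t \<in> insert s0 S" for s t
    using that insert(2) by (auto simp: e'_def e1_S e1_s0 e(2))
  ultimately show ?case by blast
qed

lemma dual_functionals_expand:
  assumes "finite S" "\<And>s. s \<in> S \<Longrightarrow> pointwise_functional K (e s)"
    "\<And>s t. s \<in> S \<Longrightarrow> t \<in> S \<Longrightarrow> e s t = (if s = t then 1 else 0)"
    and f: "f \<in> fn.span S"
  shows "f = (\<lambda>x. \<Sum>s\<in>S. e s f * s x)"
proof -
  obtain u where u: "f = (\<lambda>x. \<Sum>s\<in>S. u s * s x)"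
    using f by (auto simp: fn_span_finite[OF assms(1)])
  have "e s f = u s" if "s \<in> S" for s
  proof -
    have "e s f = (\<Sum>t\<in>S. u t * e s t)"
      unfolding u by (rule pointwise_functional_sum[OF assms(2)[OF that] assms(1)])
    also have "\<dots> = (\<Sum>t\<in>S. if t = s then u s else 0)"
      using that by (intro sum.cong refl) (auto simp: assms(3))
    finally show ?thesis using that assms(1) by simp
  qed
  then show ?thesis by (subst u) (simp add: fun_eq_iff)
qed

section \<open>Algebraic sums of families of function spaces\<close>

lemma algebraic_sum_mono:
  assumes "\<And>i. i \<in> I \<Longrightarrow> V i \<subseteq> W i"
  shows "algebraic_sum I V \<subseteq> algebraic_sum I W"
  using assms unfolding algebraic_sum_def by blast

lemma algebraic_sumE:
  assumes "f \<in> algebraic_sum I V"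
  obtains F u where "finite F" "F \<subseteq> I" "\<forall>i\<in>F. u i \<in> V i" "f = (\<lambda>x. \<Sum>i\<in>F. u i x)"
  using assms by (auto simp: algebraic_sum_def)

text \<open>Both index sets are padded by zero summands to their union, and summands with the same
  index are merged.\<close>

lemma algebraic_sum_add:
  assumes zero: "\<And>i. i \<in> I \<Longrightarrow> (\<lambda>_. 0) \<in> V i"
    and add: "\<And>i f g. i \<in> I \<Longrightarrow> f \<in> V i \<Longrightarrow> g \<in> V i \<Longrightarrow> (\<lambda>x. f x + g x) \<in> V i"
    and "f \<in> algebraic_sum I V" "g \<in> algebraic_sum I V"
  shows "(\<lambda>x. f x + g x) \<in> algebraic_sum I V"
proof -
  from assms(3) obtain F u where F: "finite F" "F \<subseteq> I" "\<forall>i\<in>F. u i \<in> V i" "f = (\<lambda>x. \<Sum>i\<in>F. u i x)"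
    by (rule algebraic_sumE)
  from assms(4) obtain G v where G: "finite G" "G \<subseteq> I" "\<forall>i\<in>G. v i \<in> V i" "g = (\<lambda>x. \<Sum>i\<in>G. v i x)"
    by (rule algebraic_sumE)
  define u' where "u' i = (if i \<in> F then u i else (\<lambda>_. 0))" for i
  define v' where "v' i = (if i \<in> G then v i else (\<lambda>_. 0))" for i
  have "f = (\<lambda>x. \<Sum>i\<in>F \<union> G. u' i x)" "g = (\<lambda>x. \<Sum>i\<in>F \<union> G. v' i x)"
    unfolding F(4) G(4) u'_def v'_def using F(1) G(1)
    by (auto simp: fun_eq_iff intro!: sum.mono_neutral_cong_left)
  then have "(\<lambda>x. f x + g x) = (\<lambda>x. \<Sum>i\<in>F \<union> G. (\<lambda>y. u' i y + v' i y) x)"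
    by (simp add: sum.distrib)
  moreover have "(\<lambda>y. u' i y + v' i y) \<in> V i" if "i \<in> F \<union> G" for i
    using that F G zero add by (auto simp: u'_def v'_def)
  ultimately show ?thesis
    unfolding algebraic_sum_def using F(1,2) G(1,2)
    by (intro CollectI exI[of _ "F \<union> G"] exI[of _ "\<lambda>i y. u' i y + v' i y"]) simp
qed

lemma algebraic_sum_single:
  assumes "i \<in> I" "f \<in> V i"
  shows "f \<in> algebraic_sum I V"
  unfolding algebraic_sum_def using assms
  by (intro CollectI exI[of _ "{i}"] exI[of _ "\<lambda>_. f"]) simp

section \<open>Projections on finite-dimensional invariant spans\<close>

context compact_group_action
begin

definition translation_invariant :: "(real^'n \<Rightarrow> complex) set \<Rightarrow> bool" where
  "translation_invariant V \<longleftrightarrow> (\<forall>k\<in>K. \<forall>f\<in>V. left_translate \<rho> k f \<in> V)"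

lemma left_translate_sum:
  "left_translate \<rho> k (\<lambda>x. \<Sum>i\<in>A. u i * f i x) = (\<lambda>x. \<Sum>i\<in>A. u i * left_translate \<rho> k (f i) x)"
  by (simp add: left_translate_def)

lemma translation_invariant_span:
  assumes "finite S" "\<And>k s. k \<in> K \<Longrightarrow> s \<in> S \<Longrightarrow> left_translate \<rho> k s \<in> fn.span S"
  shows "translation_invariant (fn.span S)"
  unfolding translation_invariant_def
proof (intro ballI)
  fix k f assume "k \<in> K" "f \<in> fn.span S"
  then obtain u where "f = (\<lambda>x. \<Sum>s\<in>S. u s * s x)" by (auto simp: fn_span_finite[OF assms(1)])
  with \<open>k \<in> K\<close> show "left_translate \<rho> k f \<in> fn.span S"
    by (simp add: left_translate_sum fn_span_sumI assms(2))
qed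

lemma orbit_continuous_span:
  assumes "finite S" "\<forall>s\<in>S. orbit_continuous s" "f \<in> fn.span S"
  shows "orbit_continuous f"
  using assms by (auto simp: fn_span_finite orbit_continuous_def left_translate_sum
      intro!: continuous_on_sum continuous_on_mult continuous_on_const)

text \<open>All translates of \<open>f\<close> stay in the span, so their values at a point are
  finite sums whose coefficients are continuous in \<open>k\<close>. Integration acts on these
  coefficients only, hence the projection stays in the span as well.\<close>

lemma isotypic_proj_expand:
  assumes S: "finite S" "\<forall>s\<in>S. orbit_continuous s" "translation_invariant (fn.span S)"
    and e: "\<And>s. s \<in> S \<Longrightarrow> pointwise_functional K (e s)"
      "\<And>s t. s \<in> S \<Longrightarrow> t \<in> S \<Longrightarrow> e s t = (if s = t then 1 else 0)"
    and \<Lambda>: "\<Lambda> \<in> dual K" and f: "f \<in> fn.span S"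
  shows "isotypic_proj \<mu> \<rho> \<Lambda> f = (\<lambda>x. \<Sum>s\<in>S. (of_nat (rep_degree \<Lambda>) *
    (\<integral>k. cnj (rep_character \<Lambda> k) * e s (left_translate \<rho> k f) \<partial>\<mu>)) * s x)"
proof
  fix m
  have cont: "continuous_on K (\<lambda>k. e s (left_translate \<rho> k f))" if "s \<in> S" for s
    by (rule pointwise_functionalD(3)[OF e(1)[OF that]])
      (rule orbit_continuousD[OF orbit_continuous_span[OF S(1,2) f]])
  have "(\<integral>k. cnj (rep_character \<Lambda> k) * left_translate \<rho> k f m \<partial>\<mu>) =
    (\<integral>k. (\<Sum>s\<in>S. cnj (rep_character \<Lambda> k) * e s (left_translate \<rho> k f) * s m) \<partial>\<mu>)"
  proof (rule Bochner_Integration.integral_cong[OF refl])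
    fix k assume "k \<in> space \<mu>"
    then have "left_translate \<rho> k f \<in> fn.span S"
      using S(3) f by (auto simp: translation_invariant_def)
    then have "left_translate \<rho> k f = (\<lambda>x. \<Sum>s\<in>S. e s (left_translate \<rho> k f) * s x)"
      by (intro dual_functionals_expand[OF S(1), of K e]) (auto simp: e)
    then have "left_translate \<rho> k f m = (\<Sum>s\<in>S. e s (left_translate \<rho> k f) * s m)"
      by (rule fun_cong)
    then show "cnj (rep_character \<Lambda> k) * left_translate \<rho> k f m =
        (\<Sum>s\<in>S. cnj (rep_character \<Lambda> k) * e s (left_translate \<rho> k f) * s m)"
      by (simp add: sum_distrib_left mult.assoc)
  qed
  also have "\<dots> = (\<Sum>s\<in>S. (\<integral>k. cnj (rep_character \<Lambda> k) * e s (left_translate \<rho> k f) \<partial>\<mu>) * s m)"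
    by (subst Bochner_Integration.integral_sum)
      (auto intro!: integrable_continuous continuous_intros continuous_rep_character \<Lambda> cont)
  finally show "isotypic_proj \<mu> \<rho> \<Lambda> f m = (\<Sum>s\<in>S. (of_nat (rep_degree \<Lambda>) *
    (\<integral>k. cnj (rep_character \<Lambda> k) * e s (left_translate \<rho> k f) \<partial>\<mu>)) * s m)"
    by (simp add: isotypic_proj_def sum_distrib_left mult.assoc)
qed

lemma isotypic_proj_in_span:
  assumes S: "finite S" "fn.independent S" "\<forall>s\<in>S. orbit_continuous s" "translation_invariant (fn.span S)"
    and "\<Lambda> \<in> dual K" "f \<in> fn.span S"
  shows "isotypic_proj \<mu> \<rho> \<Lambda> f \<in> fn.span S"
proof -
  obtain e where "\<And>s. s \<in> S \<Longrightarrow> pointwise_functional K (e s)"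
      "\<And>s t. s \<in> S \<Longrightarrow> t \<in> S \<Longrightarrow> e s t = (if s = t then 1 else 0)"
    using dual_functionals_exist[OF S(1,2), of K] by metis
  from isotypic_proj_expand[OF S(1,3,4) this assms(5,6)] show ?thesis
    by (simp add: fn_span_sumI fn.span_base)
qed

text \<open>\<open>T\<close> spans a maximal proper invariant subspace, so the quotient is irreducible and the
  projection onto its type acts on the quotient as the identity. Working with quotients avoids
  complete reducibility.\<close>

lemma isotypic_decomposition_step:
  assumes S: "finite S" "fn.independent S" "S \<noteq> {}" "\<forall>s\<in>S. orbit_continuous s"
    "translation_invariant (fn.span S)"
  obtains T \<Lambda> where "finite T" "fn.independent T" "T \<subseteq> fn.span S" "card T < card S"
    "translation_invariant (fn.span T)" "\<Lambda> \<in> dual K"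
    "\<And>f. f \<in> fn.span S \<Longrightarrow> f - isotypic_proj \<mu> \<rho> \<Lambda> f \<in> fn.span T"
proof -
  \<comment> \<open>Proper invariant subspaces, each represented by a basis, so that maximality can
    be measured by \<open>card\<close>.\<close>
  define P where "P T \<longleftrightarrow> fn.independent T \<and> T \<subseteq> fn.span S \<and> translation_invariant (fn.span T) \<and>
    fn.span T \<noteq> fn.span S" for T
  have card_less: "finite T \<and> card T < card S" if "P T" for T
  proof -
    have "T \<subseteq> fn.span S" "fn.independent T" using that by (auto simp: P_def)
    then obtain B where B: "T \<subseteq> B" "B \<subseteq> fn.span S" "fn.independent B" "fn.span S \<subseteq> fn.span B"
      using fn.maximal_independent_subset_extend by blast
    have "fn.span B = fn.span S" using B by (simp add: fn.span_minimal subset_antisym)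
    then have "T \<noteq> B" using that by (auto simp: P_def)
    then have "T \<subset> B" using B(1) by blast
    moreover have "finite B" "card B \<le> card S" using fn.independent_span_bound[OF S(1) B(3,2)] by auto
    ultimately show ?thesis using psubset_card_mono[of B T] finite_subset[of T B] by auto
  qed
  have "P {}"
  proof -
    obtain s where "s \<in> S" using S(3) by blast
    then have "s \<in> fn.span S" "s \<noteq> 0" using fn.span_base S(2) fn.dependent_zero by auto
    then have "fn.span S \<noteq> {0}" by blast
    then show ?thesis
      by (auto simp: P_def translation_invariant_def left_translate_def fn.independent_empty zero_fun_def)
  qed
  then obtain T where T: "P T" "\<And>T'. P T' \<Longrightarrow> card T' \<le> card T"
    using ex_has_greatest_nat[of P "{}" card "card S"] card_less by (metis less_imp_le)
  have T': "fn.independent T" "T \<subseteq> fn.span S" "translation_invariant (fn.span T)"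
      "fn.span T \<noteq> fn.span S" "finite T" "card T < card S"
    using T(1) card_less by (auto simp: P_def)
  obtain B where B: "T \<subseteq> B" "B \<subseteq> fn.span S" "fn.independent B" "fn.span S \<subseteq> fn.span B"
    using fn.maximal_independent_subset_extend[OF T'(2,1)] by blast
  have finB: "finite B" using fn.independent_span_bound[OF S(1) B(3,2)] by auto
  have spanB: "fn.span B = fn.span S" using B by (simp add: fn.span_minimal subset_antisym)
  have orbB: "orbit_continuous s" if "s \<in> fn.span S" for s
    using orbit_continuous_span[OF S(1,4) that] .
  have invB: "translation_invariant (fn.span B)" using spanB S(5) by simp
  have inv: "left_translate \<rho> k f \<in> fn.span S" if "k \<in> K" "f \<in> fn.span S" for k f
    using S(5) that by (auto simp: translation_invariant_def)
  \<comment> \<open>The elements of \<open>D\<close> represent a basis of the quotient by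
    \<open>fn.span T\<close>; the functionals \<open>e (b i)\<close> vanish on
    \<open>fn.span T\<close> and are the coordinates of the quotient.\<close>
  define D where "D = B - T"
  define d where "d = card D"
  have finD: "finite D" using finB by (simp add: D_def)
  obtain b where b: "bij_betw b {..<d} D"
    using ex_bij_betw_nat_finite[OF finD] by (auto simp: d_def lessThan_atLeast0)
  have bD: "b i \<in> D" if "i < d" for i using b that by (auto simp: bij_betw_def)
  have bB: "b i \<in> B" if "i < d" for i using bD[OF that] by (simp add: D_def)
  have bS: "b i \<in> fn.span S" if "i < d" for i using bB[OF that] B(2) by blast
  have binj: "b i = b j \<longleftrightarrow> i = j" if "i < d" "j < d" for i j
    using b that by (auto simp: bij_betw_def inj_on_eq_iff)
  obtain e where e: "\<And>s. s \<in> B \<Longrightarrow> pointwise_functional K (e s)"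
      "\<And>s t. s \<in> B \<Longrightarrow> t \<in> B \<Longrightarrow> e s t = (if s = t then 1 else 0)"
    using dual_functionals_exist[OF finB B(3), of K] by metis
  have expand: "f = (\<lambda>x. \<Sum>s\<in>B. e s f * s x)" if "f \<in> fn.span S" for f
    using that by (intro dual_functionals_expand[OF finB, of K e]) (auto simp: e spanB)
  have eT: "e (b i) f = 0" if "f \<in> fn.span T" "i < d" for f i
  proof -
    obtain u where "f = (\<lambda>x. \<Sum>t\<in>T. u t * t x)" using \<open>f \<in> fn.span T\<close> T'(5) by (auto simp: fn_span_finite)
    then have "e (b i) f = (\<Sum>t\<in>T. u t * e (b i) t)"
      using pointwise_functional_sum[OF e(1)[OF bB[OF that(2)]] T'(5)] by simp
    also have "\<dots> = 0"
    proof (intro sum.neutral ballI)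
      fix t assume "t \<in> T"
      then have "t \<in> B" "b i \<noteq> t" using B(1) bD[OF that(2)] by (auto simp: D_def)
      then show "u t * e (b i) t = 0" using e(2) bB[OF that(2)] by simp
    qed
    finally show ?thesis .
  qed
  have split: "(\<Sum>s\<in>B. g s) = (\<Sum>s\<in>T. g s) + (\<Sum>i<d. g (b i))" for g :: "_ \<Rightarrow> complex"
  proof -
    have "(\<Sum>s\<in>B. g s) = (\<Sum>s\<in>T. g s) + (\<Sum>s\<in>D. g s)"
      using sum.subset_diff[OF B(1) finB] by (simp add: D_def add.commute)
    then show ?thesis using sum.reindex_bij_betw[OF b, of g] by simp
  qed
  have in_T: "f \<in> fn.span T" if "f \<in> fn.span S" "\<And>i. i < d \<Longrightarrow> e (b i) f = 0" for f
  proof -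
    have "f = (\<lambda>x. \<Sum>s\<in>T. e s f * s x)"
      by (subst expand[OF that(1)]) (simp add: split that(2))
    then show ?thesis using fn_span_sumI[of T "\<lambda>s. s" T "\<lambda>s. e s f"] fn.span_base by metis
  qed
  \<comment> \<open>The action on the quotient: column \<open>j\<close> holds the coordinates of the
    translate of \<open>b j\<close> modulo \<open>fn.span T\<close>.\<close>
  define R where "R k = Matrix.mat d d (\<lambda>(i, j). e (b i) (left_translate \<rho> k (b j)))" for k
  have coord: "e (b i) (left_translate \<rho> k f) = (\<Sum>j<d. R k $$ (i, j) * e (b j) f)"
    if "k \<in> K" "f \<in> fn.span S" "i < d" for k f i
  proof -
    have "left_translate \<rho> k f = (\<lambda>x. \<Sum>s\<in>B. e s f * left_translate \<rho> k s x)"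
      by (subst expand[OF that(2)]) (rule left_translate_sum)
    then have "e (b i) (left_translate \<rho> k f) = (\<Sum>s\<in>B. e s f * e (b i) (left_translate \<rho> k s))"
      using pointwise_functional_sum[OF e(1)[OF bB[OF that(3)]] finB] by simp
    also have "\<dots> = (\<Sum>j<d. e (b j) f * e (b i) (left_translate \<rho> k (b j)))"
    proof -
      have "e (b i) (left_translate \<rho> k s) = 0" if "s \<in> T" for s
        using T'(3) \<open>k \<in> K\<close> fn.span_base[OF that] eT \<open>i < d\<close> by (auto simp: translation_invariant_def)
      then show ?thesis by (simp add: split)
    qed
    finally show ?thesis using that(3) by (simp add: R_def mult.commute)
  qed
  have rep: "is_rep K (d, R)"
    unfolding is_rep_def prod.case
  proof (intro conjI ballI allI impI)
    show "R (Finite_Cartesian_Product.mat 1) = 1\<^sub>m d"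
      by (rule eq_matI) (auto simp: R_def e(2) bB binj)
    show "R (k ** l) = R k * R l" if "k \<in> K" "l \<in> K" for k l
    proof (rule eq_matI)
      fix i j assume "i < dim_row (R k * R l)" "j < dim_col (R k * R l)"
      then have ij: "i < d" "j < d" by (auto simp: R_def)
      have "R (k ** l) $$ (i, j) = e (b i) (left_translate \<rho> k (left_translate \<rho> l (b j)))"
        using ij that by (simp add: R_def left_translate_mult)
      also have "\<dots> = (\<Sum>c<d. R k $$ (i, c) * R l $$ (c, j))"
        using coord[OF that(1) inv[OF that(2) bS[OF ij(2)]] ij(1)] ij by (simp add: R_def)
      also have "\<dots> = (R k * R l) $$ (i, j)"
        by (rule times_mat_entry[symmetric, OF _ _ ij, of _ d]) (auto simp: R_def)
      finally show "R (k ** l) $$ (i, j) = (R k * R l) $$ (i, j)" .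
    qed (auto simp: R_def)
    show "continuous_on K (\<lambda>k. R k $$ (i, j))" if "i < d" "j < d" for i j
      using that pointwise_functionalD(3)[OF e(1)[OF bB[OF that(1)]], of "\<lambda>k. left_translate \<rho> k (b j)"]
        orbit_continuousD[OF orbB[OF bS[OF that(2)]]]
      by (simp add: R_def)
  qed (simp add: R_def)
  have d: "d > 0"
  proof (rule ccontr)
    assume "\<not> d > 0"
    then have "B = T" using finD B(1) by (auto simp: d_def D_def)
    then show False using T'(4) spanB by simp
  qed
  define c where "c f = Matrix.vec d (\<lambda>i. e (b i) f)" for f
  have c_comb: "\<exists>f\<in>fn.span S. c f = w" if "w \<in> carrier_vec d" for w
  proof (rule bexI)
    show "(\<lambda>x. \<Sum>j<d. vec_index w j * b j x) \<in> fn.span S" by (intro fn_span_sumI bS) simp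
    show "c (\<lambda>x. \<Sum>j<d. vec_index w j * b j x) = w"
    proof (rule eq_vecI)
      fix i assume "i < dim_vec w"
      then have i: "i < d" using that by simp
      have "e (b i) (\<lambda>x. \<Sum>j<d. vec_index w j * b j x) = (\<Sum>j<d. vec_index w j * e (b i) (b j))"
        by (rule pointwise_functional_sum[OF e(1)[OF bB[OF i]]]) simp
      also have "\<dots> = (\<Sum>j<d. if j = i then vec_index w i else 0)"
        using i by (intro sum.cong refl) (auto simp: e(2) bB binj)
      finally show "vec_index (c (\<lambda>x. \<Sum>j<d. vec_index w j * b j x)) i = vec_index w i"
        using i by (simp add: c_def)
    qed (use that in \<open>simp add: c_def\<close>)
  qed
  have "(d, R) \<in> irreps K"
    unfolding irreps_def
  proof (intro CollectI case_prodI conjI allI impI)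
    fix W assume "invariant_subspace K (d, R) W"
    then have W: "W \<subseteq> carrier_vec d" "0\<^sub>v d \<in> W" "\<And>v w. v \<in> W \<Longrightarrow> w \<in> W \<Longrightarrow> v + w \<in> W"
        "\<And>a w. w \<in> W \<Longrightarrow> a \<cdot>\<^sub>v w \<in> W" "\<And>k w. k \<in> K \<Longrightarrow> w \<in> W \<Longrightarrow> R k *\<^sub>v w \<in> W"
      by (auto simp: invariant_subspace_def)
    \<comment> \<open>The preimage of \<open>W\<close> under the coordinate map is an invariant
      subspace between \<open>fn.span T\<close> and \<open>fn.span S\<close>; maximality of
      \<open>T\<close> leaves only the two ends.\<close>
    define U where "U = {f \<in> fn.span S. c f \<in> W}"
    have c_T: "c f = 0\<^sub>v d" if "f \<in> fn.span T" for f
      using that by (intro eq_vecI) (auto simp: c_def eT)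
    have c_add: "c (f + g) = c f + c g" for f g
      by (intro eq_vecI) (auto simp: c_def plus_fun_def pointwise_functionalD(1)[OF e(1)[OF bB]])
    have c_scale: "c (\<lambda>x. a * f x) = a \<cdot>\<^sub>v c f" for a f
      by (intro eq_vecI) (auto simp: c_def pointwise_functionalD(2)[OF e(1)[OF bB]])
    have c_left: "c (left_translate \<rho> k f) = R k *\<^sub>v c f" if "k \<in> K" "f \<in> fn.span S" for k f
      by (intro eq_vecI) (auto simp: c_def R_def coord that scalar_prod_def lessThan_atLeast0)
    have "fn.subspace U"
    proof (rule fn.subspaceI)
      show "0 \<in> U" using c_T[OF fn.span_zero] fn.span_zero W(2) by (simp add: U_def)
    qed (auto simp: U_def c_add c_scale W fn.span_add fn.span_scale)
    have U_inv: "translation_invariant U"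
      unfolding translation_invariant_def U_def by (auto simp: inv c_left W(5))
    have "T \<subseteq> U" using T'(2) c_T[OF fn.span_base] W(2) by (auto simp: U_def)
    then obtain B' where B': "T \<subseteq> B'" "B' \<subseteq> U" "fn.independent B'" "U \<subseteq> fn.span B'"
      using fn.maximal_independent_subset_extend[OF _ T'(1)] by blast
    have spanB': "fn.span B' = U" using B' \<open>fn.subspace U\<close> by (simp add: fn.span_minimal subset_antisym)
    show "W = {0\<^sub>v d} \<or> W = carrier_vec d"
    proof (cases "U = fn.span S")
      case True
      then have "carrier_vec d \<subseteq> W" using c_comb by (fastforce simp: U_def)
      then show ?thesis using W(1) by auto
    next
      case False
      then have "P B'" unfolding P_def using B' spanB' U_inv by (auto simp: U_def)
      \<comment> \<open>\<open>B'\<close> contains \<open>T\<close> and, by the choice of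
        \<open>T\<close>, has no more elements.\<close>
      then have "B' = T" using T(2)[of B'] card_less[of B'] B'(1) by (metis card_seteq)
      then have U: "U = fn.span T" using spanB' by simp
      have "w = 0\<^sub>v d" if "w \<in> W" for w
      proof -
        obtain f where f: "f \<in> fn.span S" "c f = w" using c_comb W(1) \<open>w \<in> W\<close> by blast
        then have "f \<in> fn.span T" using that U by (auto simp: U_def)
        then show ?thesis using c_T f by simp
      qed
      then have "W = {0\<^sub>v d}" using W(2) by blast
      then show ?thesis ..
    qed
  qed (use rep d in auto)
  then obtain \<Lambda> where \<Lambda>: "\<Lambda> \<in> dual K" "rep_degree \<Lambda> = d"
      "\<And>k. k \<in> K \<Longrightarrow> rep_character \<Lambda> k = rep_trace d R k"
    using irrep_class by blast
  \<comment> \<open>It suffices to compare the coordinates along \<open>b\<close>. On these the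
    projection acts by the average of \<open>R k\<close> against the conjugate character, which is
    the identity by \<open>character_orthogonality\<close>.\<close>
  have "f - isotypic_proj \<mu> \<rho> \<Lambda> f \<in> fn.span T" if f: "f \<in> fn.span S" for f
  proof (rule in_T)
    let ?a = "\<lambda>s. of_nat d * (\<integral>k. cnj (rep_character \<Lambda> k) * e s (left_translate \<rho> k f) \<partial>\<mu>)"
    have proj: "isotypic_proj \<mu> \<rho> \<Lambda> f = (\<lambda>x. \<Sum>s\<in>B. ?a s * s x)"
      using isotypic_proj_expand[OF finB _ invB e \<Lambda>(1), of f] orbB B(2) f spanB \<Lambda>(2) by auto
    show "f - isotypic_proj \<mu> \<rho> \<Lambda> f \<in> fn.span S"
      unfolding proj using B(2) by (intro fn.span_diff f fn_span_sumI) auto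
    fix i assume i: "i < d"
    have "e (b i) (isotypic_proj \<mu> \<rho> \<Lambda> f) = (\<Sum>s\<in>B. ?a s * e (b i) s)"
      unfolding proj by (rule pointwise_functional_sum[OF e(1)[OF bB[OF i]] finB])
    also have "\<dots> = (\<Sum>s\<in>B. if s = b i then ?a (b i) else 0)"
      using i by (intro sum.cong refl) (auto simp: e(2) bB)
    also have "\<dots> = ?a (b i)" using bB[OF i] finB by simp
    also have "\<dots> = of_nat d * (\<integral>k. (\<Sum>j<d. cnj (rep_trace d R k) * R k $$ (i, j) * e (b j) f) \<partial>\<mu>)"
      using f i by (intro arg_cong[where f="\<lambda>x. _ * x"] Bochner_Integration.integral_cong refl)
        (simp add: \<Lambda>(3) coord sum_distrib_left mult.assoc)
    also have "\<dots> = of_nat d * (\<Sum>j<d. (\<integral>k. cnj (rep_trace d R k) * R k $$ (i, j) \<partial>\<mu>) * e (b j) f)"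
      using i by (subst Bochner_Integration.integral_sum)
        (auto intro!: integrable_continuous continuous_intros continuous_rep_trace[OF rep] is_repD(4)[OF rep])
    also have "\<dots> = (\<Sum>j<d. of_nat d * (\<integral>k. cnj (rep_trace d R k) * R k $$ (i, j) \<partial>\<mu>) * e (b j) f)"
      by (simp add: sum_distrib_left mult.assoc)
    also have "\<dots> = (\<Sum>j<d. if j = i then e (b i) f else 0)"
      using i by (intro sum.cong refl) (auto simp: character_orthogonality[OF \<open>(d, R) \<in> irreps K\<close>])
    finally have "e (b i) (isotypic_proj \<mu> \<rho> \<Lambda> f) = e (b i) f" using i by simp
    moreover have "f - isotypic_proj \<mu> \<rho> \<Lambda> f = (\<lambda>x. f x + (- 1) * isotypic_proj \<mu> \<rho> \<Lambda> f x)"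
      by (simp add: fun_eq_iff)
    then have "e (b i) (f - isotypic_proj \<mu> \<rho> \<Lambda> f) =
        e (b i) f + (- 1) * e (b i) (isotypic_proj \<mu> \<rho> \<Lambda> f)"
      by (simp only: pointwise_functionalD(1,2)[OF e(1)[OF bB[OF i]]])
    ultimately show "e (b i) (f - isotypic_proj \<mu> \<rho> \<Lambda> f) = 0" by simp
  qed
  then show ?thesis by (rule that[OF T'(5,1,2,6,3) \<Lambda>(1)])
qed

text \<open>One type can occur at several stages of the induction. Its contributions are merged by
  \<open>algebraic_sum_add\<close>, which is why each image under a projection is shown to be closed
  under addition.\<close>

lemma isotypic_decomposition:
  assumes "finite S" "fn.independent S" "\<forall>s\<in>S. orbit_continuous s"
    "translation_invariant (fn.span S)" "f \<in> fn.span S"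
  shows "f \<in> algebraic_sum (dual K) (\<lambda>\<Lambda>. isotypic_proj \<mu> \<rho> \<Lambda> ` fn.span S)"
  using assms
proof (induction "card S" arbitrary: S f rule: less_induct)
  case less
  note orb = orbit_continuous_span[OF less.prems(1,3)]
  show ?case
  proof (cases "S = {}")
    case True
    then have "f = (\<lambda>_. 0)" using less.prems(5) by (simp add: zero_fun_def)
    then show ?thesis unfolding algebraic_sum_def by (intro CollectI exI[of _ "{}"]) simp
  next
    case False
    obtain T \<Lambda> where T: "finite T" "fn.independent T" "T \<subseteq> fn.span S" "card T < card S"
      "translation_invariant (fn.span T)" "\<Lambda> \<in> dual K" "\<And>f. f \<in> fn.span S \<Longrightarrow> f - isotypic_proj \<mu> \<rho> \<Lambda> f \<in> fn.span T"
      by (rule isotypic_decomposition_step[OF less.prems(1,2) False less.prems(3,4)]) (rule that)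
    let ?V = "\<lambda>\<Lambda>. isotypic_proj \<mu> \<rho> \<Lambda> ` fn.span S"
    have zero: "(\<lambda>_. 0) \<in> ?V \<Lambda>'" if "\<Lambda>' \<in> dual K" for \<Lambda>'
    proof -
      have "isotypic_proj \<mu> \<rho> \<Lambda>' 0 = (\<lambda>_. 0)" by (simp add: isotypic_proj_def left_translate_def)
      then show ?thesis using fn.span_zero[of S] by (metis image_eqI)
    qed
    have add: "(\<lambda>x. g x + h x) \<in> ?V \<Lambda>'"
      if \<Lambda>': "\<Lambda>' \<in> dual K" and "g \<in> ?V \<Lambda>'" "h \<in> ?V \<Lambda>'" for \<Lambda>' g h
    proof -
      from that obtain g' h' where gh: "g' \<in> fn.span S" "h' \<in> fn.span S" "g = isotypic_proj \<mu> \<rho> \<Lambda>' g'"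
        "h = isotypic_proj \<mu> \<rho> \<Lambda>' h'" by (elim imageE)
      have "g' + h' \<in> fn.span S" using gh by (intro fn.span_add)
      then have "(\<lambda>x. g' x + h' x) \<in> fn.span S" by (simp only: plus_fun_def)
      then have "isotypic_proj \<mu> \<rho> \<Lambda>' (\<lambda>x. g' x + h' x) \<in> ?V \<Lambda>'" by (rule imageI)
      then show ?thesis
        by (simp only: gh(3,4) isotypic_proj_add[OF \<Lambda>' orb[OF gh(1)] orb[OF gh(2)]])
    qed
    have "f - isotypic_proj \<mu> \<rho> \<Lambda> f \<in> algebraic_sum (dual K) (\<lambda>\<Lambda>. isotypic_proj \<mu> \<rho> \<Lambda> ` fn.span T)"
      by (rule less.hyps[OF T(4,1,2) _ T(5) T(7)[OF less.prems(5)]]) (use T(3) orb in blast)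
    moreover have "fn.span T \<subseteq> fn.span S" using T(3) by (simp add: fn.span_minimal)
    then have "algebraic_sum (dual K) (\<lambda>\<Lambda>. isotypic_proj \<mu> \<rho> \<Lambda> ` fn.span T) \<subseteq> algebraic_sum (dual K) ?V"
      by (intro algebraic_sum_mono image_mono)
    ultimately have 1: "f - isotypic_proj \<mu> \<rho> \<Lambda> f \<in> algebraic_sum (dual K) ?V" by blast
    have 2: "isotypic_proj \<mu> \<rho> \<Lambda> f \<in> algebraic_sum (dual K) ?V"
      using T(6) less.prems(5) by (intro algebraic_sum_single) auto
    have "(\<lambda>x. (f - isotypic_proj \<mu> \<rho> \<Lambda> f) x + isotypic_proj \<mu> \<rho> \<Lambda> f x) \<in> algebraic_sum (dual K) ?V"
      by (rule algebraic_sum_add[OF zero add 1 2])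
    then show ?thesis by simp
  qed
qed

end

section \<open>Density of polynomials times a Gaussian\<close>

lemma complex_polynomial_function_iff:
  fixes p :: "'a::real_normed_vector \<Rightarrow> complex"
  shows "polynomial_function p \<longleftrightarrow>
    real_polynomial_function (\<lambda>x. Re (p x)) \<and> real_polynomial_function (\<lambda>x. Im (p x))"
  by (simp add: polynomial_function_iff_Basis_inner Basis_complex_def)

lemma polynomial_function_complex_mult:
  fixes p q :: "'a::real_normed_vector \<Rightarrow> complex"
  assumes "polynomial_function p" "polynomial_function q"
  shows "polynomial_function (\<lambda>x. p x * q x)"
  using assms unfolding complex_polynomial_function_iff
  by (auto intro!: real_polynomial_function_diff real_polynomial_function.intros(3) real_polynomial_function.intros(4))

lemma polynomial_function_of_real:
  "real_polynomial_function p \<Longrightarrow> polynomial_function (\<lambda>x. complex_of_real (p x))"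
  by (simp add: complex_polynomial_function_iff real_polynomial_function.intros(2))

lemma real_polynomial_function_norm_power2:
  "real_polynomial_function (\<lambda>x::'a::euclidean_space. (norm x)\<^sup>2)"
proof -
  have "real_polynomial_function (\<lambda>x::'a. \<Sum>b\<in>Basis. (inner x b)\<^sup>2)"
    by (intro real_polynomial_function_sum real_polynomial_function_power real_polynomial_function.intros(1)
        bounded_linear_inner_left) simp
  moreover have "(norm x)\<^sup>2 = (\<Sum>b\<in>Basis. (inner x b)\<^sup>2)" for x :: 'a
    unfolding power2_norm_eq_inner by (subst euclidean_inner) (simp only: power2_eq_square)
  ultimately show ?thesis by (simp only:)
qed

text \<open>The rate \<open>e\<close> varies in the induction because a product splits it into two
  halves. A linear function is controlled through
  \<open>norm x \<le> 1 + (norm x)\<^sup>2\<close>.\<close>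

lemma real_polynomial_function_le_exp:
  fixes q :: "'a::real_normed_vector \<Rightarrow> real"
  assumes "real_polynomial_function q" "e > 0"
  shows "\<exists>C\<ge>0. \<forall>x. \<bar>q x\<bar> \<le> C * exp (e * (norm x)\<^sup>2)"
  using assms
proof (induction q arbitrary: e)
  case (linear f)
  then obtain B where B: "B \<ge> 0" "\<And>x. norm (f x) \<le> norm x * B"
    using bounded_linear.nonneg_bounded by blast
  have "\<bar>f x\<bar> \<le> (B * (1 + 1 / e)) * exp (e * (norm x)\<^sup>2)" for x
  proof -
    have "e * (norm x)\<^sup>2 \<le> exp (e * (norm x)\<^sup>2)"
      using exp_ge_add_one_self[of "e * (norm x)\<^sup>2"] by linarith
    then have 1: "(norm x)\<^sup>2 \<le> 1 / e * exp (e * (norm x)\<^sup>2)"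
      using linear.prems by (simp add: pos_le_divide_eq mult.commute)
    have "norm x \<le> 1 + (norm x)\<^sup>2"
      using zero_le_power2[of "norm x - 1"] norm_ge_zero[of x] unfolding power2_diff power_one by linarith
    also have "\<dots> \<le> exp (e * (norm x)\<^sup>2) + 1 / e * exp (e * (norm x)\<^sup>2)"
      using 1 linear.prems by (intro add_mono) auto
    finally have "norm x \<le> (1 + 1 / e) * exp (e * (norm x)\<^sup>2)" by (simp add: ring_distribs)
    then have "norm x * B \<le> ((1 + 1 / e) * exp (e * (norm x)\<^sup>2)) * B"
      using B(1) by (intro mult_right_mono)
    then show ?thesis using B(2)[of x] by (simp add: mult_ac)
  qed
  then show ?case using B(1) linear.prems by (intro exI[of _ "B * (1 + 1 / e)"]) auto
next
  case (const c)
  have "\<bar>c\<bar> \<le> \<bar>c\<bar> * exp (e * (norm x)\<^sup>2)" for x :: 'a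
    using const mult_left_mono[of 1 "exp (e * (norm x)\<^sup>2)" "\<bar>c\<bar>"] by simp
  then show ?case by (intro exI[of _ "\<bar>c\<bar>"]) auto
next
  case (add f g)
  obtain C where C: "C \<ge> 0" "\<And>x. \<bar>f x\<bar> \<le> C * exp (e * (norm x)\<^sup>2)" using add by blast
  obtain D where D: "D \<ge> 0" "\<And>x. \<bar>g x\<bar> \<le> D * exp (e * (norm x)\<^sup>2)" using add by blast
  have "\<bar>f x + g x\<bar> \<le> (C + D) * exp (e * (norm x)\<^sup>2)" for x
    using abs_triangle_ineq[of "f x" "g x"] C(2)[of x] D(2)[of x] by (simp add: ring_distribs)
  then show ?case using C(1) D(1) by (intro exI[of _ "C + D"]) auto
next
  case (mult f g)
  have e2: "e / 2 > 0" using mult.prems by simp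
  obtain C where C: "C \<ge> 0" "\<And>x. \<bar>f x\<bar> \<le> C * exp (e / 2 * (norm x)\<^sup>2)" using mult.IH(1)[OF e2] by blast
  obtain D where D: "D \<ge> 0" "\<And>x. \<bar>g x\<bar> \<le> D * exp (e / 2 * (norm x)\<^sup>2)" using mult.IH(2)[OF e2] by blast
  have "\<bar>f x * g x\<bar> \<le> (C * D) * exp (e * (norm x)\<^sup>2)" for x
  proof -
    have "\<bar>f x * g x\<bar> \<le> (C * exp (e / 2 * (norm x)\<^sup>2)) * (D * exp (e / 2 * (norm x)\<^sup>2))"
      unfolding abs_mult using C D by (intro mult_mono) auto
    also have "\<dots> = (C * D) * (exp (e / 2 * (norm x)\<^sup>2) * exp (e / 2 * (norm x)\<^sup>2))"
      by (simp add: mult_ac)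
    also have "exp (e / 2 * (norm x)\<^sup>2) * exp (e / 2 * (norm x)\<^sup>2) = exp (e * (norm x)\<^sup>2)"
      by (simp flip: exp_add)
    finally show ?thesis .
  qed
  then show ?case using C(1) D(1) by (intro exI[of _ "C * D"]) auto
qed

lemma power_over_fact_le_exp:
  fixes x :: real
  assumes "x \<ge> 0"
  shows "x ^ n / fact n \<le> exp x"
proof -
  obtain t where "exp x = (\<Sum>m<Suc n. x ^ m / fact m) + exp t / fact (Suc n) * x ^ Suc n"
    using Maclaurin_exp_le[of x "Suc n"] by blast
  moreover have "exp t / fact (Suc n) * x ^ Suc n \<ge> 0" using assms by simp
  moreover have "(\<Sum>m<n. x ^ m / fact m) \<ge> 0" using assms by (intro sum_nonneg) simp
  ultimately show ?thesis by simp
qed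

section \<open>Lowering the exponent of a Gaussian weight to one\<close>

definition gauss_approximable :: "('a::euclidean_space \<Rightarrow> real) \<Rightarrow> bool" where
  "gauss_approximable f \<longleftrightarrow>
     (\<forall>\<epsilon>>0. \<exists>q. real_polynomial_function q \<and> (\<forall>x. \<bar>f x - q x * exp (- (norm x)\<^sup>2)\<bar> < \<epsilon>))"

text \<open>The factor \<open>exp (- u / 4)\<close> is replaced by its Taylor polynomial in \<open>u\<close>; the remainder is at most
  \<open>exp (u / 4) * (u / 4) ^ J / fact J\<close>, which the remaining Gaussian factor absorbs up to \<open>2 ^ - J\<close>.\<close>

lemma gauss_factor_step:
  fixes q :: "'a::euclidean_space \<Rightarrow> real"
  assumes q: "real_polynomial_function q" and t: "t \<ge> 1" and \<epsilon>: "\<epsilon> > 0"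
  obtains q' where "real_polynomial_function q'"
    "\<And>x. \<bar>q x * exp (- ((t + 1 / 4) * (norm x)\<^sup>2)) - q' x * exp (- (t * (norm x)\<^sup>2))\<bar> < \<epsilon>"
proof -
  obtain C where C: "C \<ge> 0" "\<And>x. \<bar>q x\<bar> \<le> C * exp (1 / 4 * (norm x)\<^sup>2)"
    using real_polynomial_function_le_exp[OF q, of "1 / 4"] by auto
  have "(\<lambda>J. C * (1 / 2) ^ J) \<longlonglongrightarrow> C * 0"
    by (intro tendsto_mult tendsto_const LIMSEQ_power_zero) simp
  then have "\<forall>\<^sub>F J in sequentially. C * (1 / 2) ^ J < \<epsilon>" using \<epsilon> by (simp add: order_tendsto_iff)
  then obtain J where J: "C * (1 / 2) ^ J < \<epsilon>" by (auto simp: eventually_sequentially)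
  define T where "T x = (\<Sum>i<J. (- (norm x)\<^sup>2 / 4) ^ i / fact i)" for x :: 'a
  show ?thesis
  proof (rule that[of "\<lambda>x. q x * T x"])
    have h: "real_polynomial_function (\<lambda>x::'a. - (norm x)\<^sup>2 / 4)"
      by (intro real_polynomial_function_divide real_polynomial_function_minus real_polynomial_function_norm_power2)
    show "real_polynomial_function (\<lambda>x. q x * T x)"
      unfolding T_def
      by (intro real_polynomial_function.intros(4) q real_polynomial_function_sum real_polynomial_function_divide
          real_polynomial_function_power[OF h]) auto
    fix x :: 'a
    define u where "u = (norm x)\<^sup>2"
    have u: "u \<ge> 0" by (simp add: u_def)
    obtain s where s: "\<bar>s\<bar> \<le> \<bar>- u / 4\<bar>" "exp (- u / 4) = T x + exp s / fact J * (- u / 4) ^ J"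
      using Maclaurin_exp_le[of "- u / 4" J] by (auto simp: T_def u_def)
    have "\<bar>exp (- u / 4) - T x\<bar> = exp s * ((u / 4) ^ J / fact J)"
      using s(2) u by (simp add: abs_mult power_abs)
    also have "\<dots> \<le> exp (u / 4) * ((u / 4) ^ J / fact J)"
      using s(1) u by (intro mult_right_mono) auto
    \<comment> \<open>A factor 1/2 per power is set aside for the decay in \<open>J\<close>; what is
      left is one term of the series of \<open>exp (u / 2)\<close>.\<close>
    also have "(u / 4) ^ J / fact J = (1 / 2) ^ J * ((u / 2) ^ J / fact J)"
      by (simp add: power_divide flip: power_mult_distrib)
    also have "exp (u / 4) * \<dots> \<le> exp (u / 4) * ((1 / 2) ^ J * exp (u / 2))"
      using u by (intro mult_left_mono power_over_fact_le_exp) auto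
    finally have T: "\<bar>exp (- u / 4) - T x\<bar> \<le> exp (u / 4) * ((1 / 2) ^ J * exp (u / 2))" .
    have "\<bar>q x * exp (- ((t + 1 / 4) * u)) - q x * T x * exp (- (t * u))\<bar>
      = \<bar>q x\<bar> * \<bar>exp (- u / 4) - T x\<bar> * exp (- (t * u))"
    proof -
      have "exp (- ((t + 1 / 4) * u)) = exp (- u / 4) * exp (- (t * u))"
        by (simp add: ring_distribs flip: exp_add)
      then have "q x * exp (- ((t + 1 / 4) * u)) - q x * T x * exp (- (t * u))
        = q x * (exp (- u / 4) - T x) * exp (- (t * u))"
        by (simp add: ring_distribs)
      then show ?thesis by (simp add: abs_mult)
    qed
    also have "\<dots> \<le> (C * exp (1 / 4 * u)) * (exp (u / 4) * ((1 / 2) ^ J * exp (u / 2))) * exp (- (1 * u))"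
    proof -
      have "\<bar>q x\<bar> \<le> C * exp (1 / 4 * u)" using C(2)[of x] by (simp add: u_def)
      moreover have "1 * u \<le> t * u" using t u by (rule mult_right_mono)
      ultimately show ?thesis using C(1) T by (intro mult_mono) auto
    qed
    \<comment> \<open>The exponents balance: 1/4 for the growth of \<open>q\<close>, 1/4 for
      \<open>exp s\<close> and 1/2 for the power of \<open>u\<close> use up exactly the weight
      \<open>exp (- u)\<close> that \<open>t \<ge> 1\<close> guarantees.\<close>
    also have "\<dots> = C * (1 / 2) ^ J * exp (1 / 4 * u + u / 4 + u / 2 + - (1 * u))"
      by (simp only: exp_add mult_ac)
    also have "\<dots> = C * (1 / 2) ^ J" by simp
    finally show "\<bar>q x * exp (- ((t + 1 / 4) * (norm x)\<^sup>2)) - q x * T x * exp (- (t * (norm x)\<^sup>2))\<bar> < \<epsilon>"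
      using J unfolding u_def by simp
  qed
qed

text \<open>Each application of \<open>gauss_factor_step\<close> removes one quarter from the
  exponent and changes the polynomial, so the induction on \<open>k\<close> runs over all
  \<open>q\<close>, with half of the error left to the later steps.\<close>

lemma gauss_approximable_quarter:
  fixes q :: "'a::euclidean_space \<Rightarrow> real"
  assumes "real_polynomial_function q"
  shows "gauss_approximable (\<lambda>x. q x * exp (- ((1 + real k / 4) * (norm x)\<^sup>2)))"
  using assms
proof (induction k arbitrary: q)
  case 0
  then show ?case by (auto simp: gauss_approximable_def intro!: exI[of _ q])
next
  case (Suc k)
  show ?case
    unfolding gauss_approximable_def
  proof (intro allI impI)
    fix \<epsilon> :: real assume "\<epsilon> > 0"
    then have e: "\<epsilon> / 2 > 0" by simp
    have k: "1 + real k / 4 \<ge> 1" by simp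
    obtain q' where q': "real_polynomial_function q'"
      "\<And>x. \<bar>q x * exp (- ((1 + real k / 4 + 1 / 4) * (norm x)\<^sup>2)) -
          q' x * exp (- ((1 + real k / 4) * (norm x)\<^sup>2))\<bar> < \<epsilon> / 2"
      using gauss_factor_step[OF Suc.prems k e] by blast
    obtain q'' where q'': "real_polynomial_function q''"
      "\<And>x. \<bar>q' x * exp (- ((1 + real k / 4) * (norm x)\<^sup>2)) - q'' x * exp (- (norm x)\<^sup>2)\<bar> < \<epsilon> / 2"
      using Suc.IH[OF q'(1)] e unfolding gauss_approximable_def by blast
    have "1 + real (Suc k) / 4 = 1 + real k / 4 + 1 / 4" by (simp add: field_simps)
    then have "\<bar>q x * exp (- ((1 + real (Suc k) / 4) * (norm x)\<^sup>2)) - q'' x * exp (- (norm x)\<^sup>2)\<bar> < \<epsilon>" for x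
      using q'(2)[of x] q''(2)[of x] by (simp only:)
    then show "\<exists>q'. real_polynomial_function q' \<and>
        (\<forall>x. \<bar>q x * exp (- ((1 + real (Suc k) / 4) * (norm x)\<^sup>2)) - q' x * exp (- (norm x)\<^sup>2)\<bar> < \<epsilon>)"
      using q''(1) by blast
  qed
qed

text \<open>The algebra without unit spanned by polynomials times positive integer powers of the
  Gaussian. The exponent \<open>Suc j\<close> excludes bare polynomials, which need not vanish at
  infinity.\<close>

inductive gauss_polynomial :: "('a::euclidean_space \<Rightarrow> real) \<Rightarrow> bool" where
  base: "real_polynomial_function q \<Longrightarrow> gauss_polynomial (\<lambda>x. q x * exp (- (real (Suc j) * (norm x)\<^sup>2)))"
| add: "gauss_polynomial f \<Longrightarrow> gauss_polynomial g \<Longrightarrow> gauss_polynomial (\<lambda>x. f x + g x)"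

lemma gauss_polynomial_approximable:
  "gauss_polynomial f \<Longrightarrow> gauss_approximable f"
proof (induction rule: gauss_polynomial.induct)
  case (base q j)
  \<comment> \<open>The exponent \<open>Suc j\<close> is 1 plus \<open>4 * j\<close>
    quarters.\<close>
  then show ?case using gauss_approximable_quarter[OF base, of "4 * j"] by simp
next
  case (add f g)
  show ?case
    unfolding gauss_approximable_def
  proof (intro allI impI)
    fix \<epsilon> :: real assume "\<epsilon> > 0"
    then have e: "\<epsilon> / 2 > 0" by simp
    obtain p where p: "real_polynomial_function p" "\<And>x. \<bar>f x - p x * exp (- (norm x)\<^sup>2)\<bar> < \<epsilon> / 2"
      using add.IH(1) e unfolding gauss_approximable_def by blast
    obtain q where q: "real_polynomial_function q" "\<And>x. \<bar>g x - q x * exp (- (norm x)\<^sup>2)\<bar> < \<epsilon> / 2"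
      using add.IH(2) e unfolding gauss_approximable_def by blast
    have "\<bar>f x + g x - (p x + q x) * exp (- (norm x)\<^sup>2)\<bar> < \<epsilon>" for x
      using p(2)[of x] q(2)[of x] by (simp only: ring_distribs)
    then show "\<exists>q. real_polynomial_function q \<and> (\<forall>x. \<bar>f x + g x - q x * exp (- (norm x)\<^sup>2)\<bar> < \<epsilon>)"
      using p(1) q(1) by (intro exI[of _ "\<lambda>x. p x + q x"]) (simp add: real_polynomial_function.intros(3))
  qed
qed

lemma gauss_polynomial_mult:
  assumes "gauss_polynomial f" "gauss_polynomial g"
  shows "gauss_polynomial (\<lambda>x. f x * g x)"
  using assms
proof (induction f rule: gauss_polynomial.induct)
  case (base p i)
  from base(2) show ?case
  proof (induction g rule: gauss_polynomial.induct)
    case (base q j)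
    have eq: "p x * exp (- (real (Suc i) * (norm x)\<^sup>2)) * (q x * exp (- (real (Suc j) * (norm x)\<^sup>2)))
      = (p x * q x) * exp (- (real (Suc (i + Suc j)) * (norm x)\<^sup>2))" for x
    proof -
      have "exp (- (real (Suc (i + Suc j)) * (norm x)\<^sup>2)) =
          exp (- (real (Suc i) * (norm x)\<^sup>2)) * exp (- (real (Suc j) * (norm x)\<^sup>2))"
        by (simp add: ring_distribs flip: exp_add)
      then show ?thesis by simp
    qed
    show ?case
      unfolding eq by (intro gauss_polynomial.base real_polynomial_function.intros(4) base \<open>real_polynomial_function p\<close>)
  next
    case (add f g)
    then show ?case by (simp only: ring_distribs) (rule gauss_polynomial.add)
  qed
next
  case (add f h)
  then have "gauss_polynomial (\<lambda>x. f x * g x + h x * g x)" by (intro gauss_polynomial.add) auto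
  then show ?case by (simp only: ring_distribs)
qed

lemma gauss_polynomial_cmult:
  "gauss_polynomial f \<Longrightarrow> gauss_polynomial (\<lambda>x. c * f x)"
proof (induction rule: gauss_polynomial.induct)
  case (base q j)
  then have "gauss_polynomial (\<lambda>x. (c * q x) * exp (- (real (Suc j) * (norm x)\<^sup>2)))"
    by (intro gauss_polynomial.base real_polynomial_function.intros(4) real_polynomial_function.intros(2))
  then show ?case by (simp only: mult.assoc)
next
  case (add f g)
  then show ?case by (simp only: ring_distribs) (rule gauss_polynomial.add)
qed

text \<open>The second component allows \<open>x\<close> to be recovered by division, and
  polynomials in the two components are again polynomials in \<open>x\<close> combined with powers
  of the Gaussian. Both components tend to 0 as \<open>x\<close> goes to infinity.\<close>

definition gauss_embed :: "'a::euclidean_space \<Rightarrow> 'a \<times> real" where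
  "gauss_embed x = (exp (- (norm x)\<^sup>2) *\<^sub>R x, exp (- (norm x)\<^sup>2))"

lemma gauss_embed_inverse: "fst (gauss_embed x) /\<^sub>R snd (gauss_embed x) = x"
  by (simp add: gauss_embed_def)

lemma snd_gauss_embed: "snd (gauss_embed x) = exp (- (norm x)\<^sup>2)"
  by (simp add: gauss_embed_def)

text \<open>Subtracting \<open>Q 0\<close> removes the constant term; every remaining monomial
  contains at least one component of \<open>gauss_embed x\<close> and with it a Gaussian
  factor.\<close>

lemma gauss_polynomial_embed:
  fixes Q :: "'a::euclidean_space \<times> real \<Rightarrow> real"
  assumes "real_polynomial_function Q"
  shows "gauss_polynomial (\<lambda>x. Q (gauss_embed x) - Q 0)"
  using assms
proof induction
  case (linear f)
  interpret bounded_linear f by fact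
  have "real_polynomial_function (\<lambda>x::'a. f (x, 0) + f (0, 1))"
    by (intro real_polynomial_function.intros(3) real_polynomial_function.intros(2) real_polynomial_function.intros(1)
        bounded_linear_compose[OF \<open>bounded_linear f\<close>] bounded_linear_Pair bounded_linear_ident bounded_linear_zero)
  from gauss_polynomial.base[OF this, of 0]
  have "gauss_polynomial (\<lambda>x. (f (x, 0) + f (0, 1)) * exp (- (norm x)\<^sup>2))" by simp
  moreover have "f (gauss_embed x) - f 0 = (f (x, 0) + f (0, 1)) * exp (- (norm x)\<^sup>2)" for x
  proof -
    have "gauss_embed x = exp (- (norm x)\<^sup>2) *\<^sub>R ((x, 0) + (0, 1))"
      by (simp add: gauss_embed_def)
    then show ?thesis by (simp only: scaleR add zero) (simp add: mult.commute)
  qed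
  ultimately show ?case by simp
next
  case (const c)
  then show ?case using gauss_polynomial.base[OF real_polynomial_function.intros(2)[of 0], of 0] by simp
next
  case (add f g)
  from gauss_polynomial.add[OF add.IH] show ?case by (simp add: algebra_simps)
next
  case (mult f g)
  \<comment> \<open>The values at 0 need not vanish, so the product is expanded in the differences
    covered by the induction hypotheses.\<close>
  have "f (gauss_embed x) * g (gauss_embed x) - f 0 * g 0 =
    ((f (gauss_embed x) - f 0) * (g (gauss_embed x) - g 0) + f 0 * (g (gauss_embed x) - g 0))
      + g 0 * (f (gauss_embed x) - f 0)" for x
    by (simp add: algebra_simps)
  then show ?case
    by (simp only:) (intro gauss_polynomial.add gauss_polynomial_mult gauss_polynomial_cmult mult.IH)
qed

text \<open>\<open>gauss_embed\<close> realises the one-point compactification of \<open>M\<close>, with \<open>0\<close> as the point at infinity.\<close>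

lemma compact_gauss_embed:
  fixes M :: "'a::euclidean_space set"
  assumes "closed M"
  shows "compact (insert 0 (gauss_embed ` M))"
proof -
  let ?X = "insert 0 (gauss_embed ` M)"
  \<comment> \<open>The last inequality settles the behaviour at infinity: when the second component
    tends to 0, so does the first, and the only limit point outside the image of \<open>M\<close> is
    \<open>0\<close>.\<close>
  have box: "0 \<le> snd y \<and> snd y \<le> 1 \<and> (norm (fst y))\<^sup>2 \<le> snd y" if "y \<in> ?X" for y
  proof (cases "y = 0")
    case False
    then obtain m where y: "y = gauss_embed m" using \<open>y \<in> ?X\<close> by blast
    define u where "u = (norm m)\<^sup>2"
    have u: "u \<ge> 0" by (simp add: u_def)
    have "u * exp (- u) \<le> 1"
    proof -
      have "u \<le> exp u" using exp_ge_add_one_self[of u] by linarith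
      then show ?thesis by (simp add: exp_minus field_simps)
    qed
    then have "(u * exp (- u)) * exp (- u) \<le> 1 * exp (- u)" by (intro mult_right_mono) auto
    moreover have "(norm (fst y))\<^sup>2 = (u * exp (- u)) * exp (- u)"
      by (simp add: y gauss_embed_def u_def power2_eq_square)
    ultimately show ?thesis using u by (simp add: y gauss_embed_def u_def)
  qed simp
  have "norm y \<le> 2" if "y \<in> ?X" for y
  proof -
    have "(norm (fst y))\<^sup>2 \<le> 1\<^sup>2" using box[OF that] by simp
    then have "norm (fst y) \<le> 1" by (rule power2_le_imp_le) simp
    moreover have "norm y \<le> norm (fst y) + norm (snd y)"
      using norm_Pair_le[of "fst y" "snd y"] by simp
    ultimately show ?thesis using box[OF that] by simp
  qed
  then have "bounded ?X" unfolding bounded_iff by blast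
  moreover have "closed ?X"
    unfolding closed_sequential_limits
  proof (intro allI impI)
    fix s y assume "(\<forall>n. s n \<in> ?X) \<and> s \<longlonglongrightarrow> y"
    then have s: "\<And>n. s n \<in> ?X" and lim: "s \<longlonglongrightarrow> y" by auto
    note lim1 = tendsto_fst[OF lim] and lim2 = tendsto_snd[OF lim]
    have y: "0 \<le> snd y" "(norm (fst y))\<^sup>2 \<le> snd y"
      using box[OF s] by (auto intro: LIMSEQ_le_const[OF lim2] LIMSEQ_le[OF tendsto_power[OF tendsto_norm[OF lim1]] lim2])
    show "y \<in> ?X"
    proof (cases "snd y = 0")
      case True
      then have "y = 0" using y by (simp add: prod_eq_iff)
      then show ?thesis by simp
    next
      case False
      then have pos: "snd y > 0" using y by simp
      let ?b = "\<lambda>y. fst y /\<^sub>R snd y"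
      have preim: "?b z \<in> M \<and> z = gauss_embed (?b z)" if "z \<in> ?X" "snd z > 0" for z
        using that by (auto simp: gauss_embed_inverse)
      have ev: "\<forall>\<^sub>F n in sequentially. snd (s n) > 0" using order_tendstoD(1)[OF lim2 pos] .
      have limb: "(\<lambda>n. ?b (s n)) \<longlonglongrightarrow> ?b y"
        using False by (intro tendsto_scaleR tendsto_inverse lim1 lim2)
      have "?b y \<in> M"
      proof (rule Lim_in_closed_set[OF assms _ _ limb])
        show "\<forall>\<^sub>F n in sequentially. ?b (s n) \<in> M"
          using ev by (rule eventually_mono) (use preim s in blast)
      qed simp
      moreover have "(\<lambda>n. gauss_embed (?b (s n))) \<longlonglongrightarrow> gauss_embed (?b y)"
        unfolding gauss_embed_def by (intro tendsto_intros limb)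
      then have "s \<longlonglongrightarrow> gauss_embed (?b y)"
        by (rule Lim_transform_eventually)
          (use ev in \<open>rule eventually_mono, use preim s in metis\<close>)
      then have "y = gauss_embed (?b y)" using LIMSEQ_unique lim by blast
      ultimately show ?thesis by blast
    qed
  qed
  ultimately show ?thesis by (simp add: compact_eq_bounded_closed)
qed

text \<open>Vanishing at infinity becomes continuity at the added point \<open>0\<close>; elsewhere
  the second component is positive and the division that recovers the original point is
  continuous.\<close>

lemma continuous_on_gauss_embed:
  fixes M :: "'a::euclidean_space set" and \<phi> :: "'a \<Rightarrow> complex"
  assumes cont: "continuous_on M \<phi>"
    and van: "\<And>\<epsilon>. \<epsilon> > 0 \<Longrightarrow> \<exists>C. compact C \<and> (\<forall>m\<in>M - C. cmod (\<phi> m) < \<epsilon>)"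
  shows "continuous_on (insert 0 (gauss_embed ` M)) (\<lambda>y. if snd y > 0 then \<phi> (fst y /\<^sub>R snd y) else 0)"
    (is "continuous_on ?X ?\<Phi>")
  unfolding continuous_on_sequentially
proof (intro allI ballI impI)
  fix s y assume y: "y \<in> ?X" and "(\<forall>n. s n \<in> ?X) \<and> s \<longlonglongrightarrow> y"
  then have s: "\<And>n. s n \<in> ?X" and lim: "s \<longlonglongrightarrow> y" by auto
  note lim1 = tendsto_fst[OF lim] and lim2 = tendsto_snd[OF lim]
  let ?b = "\<lambda>y. fst y /\<^sub>R snd y"
  have preim: "?b z \<in> M \<and> snd z = exp (- (norm (?b z))\<^sup>2)" if "z \<in> ?X" "snd z > 0" for z
  proof -
    from that obtain m where m: "m \<in> M" "z = gauss_embed m" by auto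
    show ?thesis unfolding m(2) gauss_embed_inverse using m(1) by (simp add: snd_gauss_embed)
  qed
  show "(?\<Phi> \<circ> s) \<longlonglongrightarrow> ?\<Phi> y"
  proof (cases "snd y > 0")
    case True
    have ev: "\<forall>\<^sub>F n in sequentially. snd (s n) > 0" using order_tendstoD(1)[OF lim2 True] .
    have limb: "(\<lambda>n. ?b (s n)) \<longlonglongrightarrow> ?b y"
      using True by (intro tendsto_scaleR tendsto_inverse lim1 lim2) simp
    have "(\<lambda>n. \<phi> (?b (s n))) \<longlonglongrightarrow> \<phi> (?b y)"
      by (rule continuous_on_tendsto_compose[OF cont limb])
        (use preim y True ev s in \<open>auto elim!: eventually_mono\<close>)
    then have "(\<lambda>n. \<phi> (?b (s n))) \<longlonglongrightarrow> ?\<Phi> y" using True by simp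
    then show ?thesis
      by (rule Lim_transform_eventually) (use ev in \<open>auto elim!: eventually_mono\<close>)
  next
    case False
    have "y = 0" using y False by (auto simp: gauss_embed_def)
    then have lim0: "(\<lambda>n. snd (s n)) \<longlonglongrightarrow> 0" using lim2 by simp
    have "(?\<Phi> \<circ> s) \<longlonglongrightarrow> 0"
    proof (rule tendstoI)
      fix \<epsilon> :: real assume "\<epsilon> > 0"
      then obtain C where C: "compact C" "\<forall>m\<in>M - C. cmod (\<phi> m) < \<epsilon>" using van by blast
      obtain b where b: "\<And>m. m \<in> C \<Longrightarrow> norm m \<le> b" using compact_imp_bounded[OF C(1)] by (auto simp: bounded_iff)
      \<comment> \<open>Points of \<open>C\<close> have Gaussian weight at least
        \<open>exp (- b\<^sup>2)\<close>, so a smaller second component forces the point out of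
        \<open>C\<close>.\<close>
      have "\<forall>\<^sub>F n in sequentially. snd (s n) < exp (- b\<^sup>2)" using order_tendstoD(2)[OF lim0] by simp
      then show "\<forall>\<^sub>F n in sequentially. dist ((?\<Phi> \<circ> s) n) 0 < \<epsilon>"
      proof (rule eventually_mono)
        fix n assume n: "snd (s n) < exp (- b\<^sup>2)"
        show "dist ((?\<Phi> \<circ> s) n) 0 < \<epsilon>"
        proof (cases "snd (s n) > 0")
          case True
          from preim[OF s True] have m: "?b (s n) \<in> M" "snd (s n) = exp (- (norm (?b (s n)))\<^sup>2)" by auto
          have "?b (s n) \<notin> C"
          proof
            assume "?b (s n) \<in> C"
            then have "norm (?b (s n)) \<le> b" by (rule b)
            then have "(norm (?b (s n)))\<^sup>2 \<le> b\<^sup>2" by (rule power_mono) (rule norm_ge_zero)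
            then have "exp (- b\<^sup>2) \<le> exp (- (norm (?b (s n)))\<^sup>2)"
              by (simp only: exp_le_cancel_iff neg_le_iff_le)
            then show False using n m(2) by linarith
          qed
          then show ?thesis using C(2) m(1) True by (simp add: dist_norm)
        qed (use \<open>\<epsilon> > 0\<close> in simp)
      qed
    qed
    then show ?thesis using False by simp
  qed
qed

text \<open>The transported function is 0 at the point \<open>0\<close>, so its approximant
  \<open>g\<close> is small there and \<open>g 0\<close> can be subtracted. The four quarters of
  \<open>\<epsilon>\<close> pay for Stone-Weierstrass, for \<open>g 0\<close>, and for lowering the
  exponents in the real and in the imaginary part.\<close>

lemma gauss_polynomials_dense:
  fixes M :: "'a::euclidean_space set" and \<phi> :: "'a \<Rightarrow> complex"
  assumes "closed M" and cont: "continuous_on M \<phi>"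
    and van: "\<And>\<epsilon>. \<epsilon> > 0 \<Longrightarrow> \<exists>C. compact C \<and> (\<forall>m\<in>M - C. cmod (\<phi> m) < \<epsilon>)"
    and \<epsilon>: "\<epsilon> > 0"
  obtains p where "polynomial_function p"
    "\<And>m. m \<in> M \<Longrightarrow> cmod (\<phi> m - p m * of_real (exp (- (norm m)\<^sup>2))) < \<epsilon>"
proof -
  let ?\<Phi> = "\<lambda>y. if snd y > 0 then \<phi> (fst y /\<^sub>R snd y) else 0"
  have e4: "\<epsilon> / 4 > 0" using \<epsilon> by simp
  obtain g where g: "polynomial_function g" "\<And>y. y \<in> insert 0 (gauss_embed ` M) \<Longrightarrow> cmod (?\<Phi> y - g y) < \<epsilon> / 4"
    using Stone_Weierstrass_polynomial_function[OF compact_gauss_embed[OF assms(1)]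
        continuous_on_gauss_embed[OF cont van] e4] by blast
  have g0: "cmod (g 0) < \<epsilon> / 4" using g(2)[of 0] by simp
  have gm: "cmod (\<phi> m - g (gauss_embed m)) < \<epsilon> / 4" if "m \<in> M" for m
    using g(2)[of "gauss_embed m"] that by (simp add: gauss_embed_def)
  from g(1) have "real_polynomial_function (\<lambda>x. Re (g x))" "real_polynomial_function (\<lambda>x. Im (g x))"
    by (simp_all add: complex_polynomial_function_iff)
  then have "gauss_approximable (\<lambda>x. Re (g (gauss_embed x)) - Re (g 0))"
      "gauss_approximable (\<lambda>x. Im (g (gauss_embed x)) - Im (g 0))"
    using gauss_polynomial_approximable gauss_polynomial_embed by blast+
  then obtain a b where a: "real_polynomial_function a"
      "\<And>x. \<bar>Re (g (gauss_embed x)) - Re (g 0) - a x * exp (- (norm x)\<^sup>2)\<bar> < \<epsilon> / 4"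
    and b: "real_polynomial_function b"
      "\<And>x. \<bar>Im (g (gauss_embed x)) - Im (g 0) - b x * exp (- (norm x)\<^sup>2)\<bar> < \<epsilon> / 4"
    unfolding gauss_approximable_def using e4 by meson
  show ?thesis
  proof (rule that[of "\<lambda>x. Complex (a x) (b x)"])
    show "polynomial_function (\<lambda>x. Complex (a x) (b x))"
      using a(1) b(1) by (simp add: complex_polynomial_function_iff)
    fix m assume m: "m \<in> M"
    let ?p = "Complex (a m) (b m) * of_real (exp (- (norm m)\<^sup>2))"
    have "cmod (g (gauss_embed m) - g 0 - ?p) \<le>
        \<bar>Re (g (gauss_embed m) - g 0 - ?p)\<bar> + \<bar>Im (g (gauss_embed m) - g 0 - ?p)\<bar>"
      by (rule cmod_le)
    also have "\<dots> < \<epsilon> / 4 + \<epsilon> / 4"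
      using a(2)[of m] b(2)[of m] by (intro add_strict_mono) simp_all
    finally have 1: "cmod (g (gauss_embed m) - g 0 - ?p) < \<epsilon> / 2" by simp
    have "\<phi> m - ?p = (\<phi> m - g (gauss_embed m)) + g 0 + (g (gauss_embed m) - g 0 - ?p)" by simp
    then have "cmod (\<phi> m - ?p) \<le> cmod (\<phi> m - g (gauss_embed m)) + cmod (g 0) + cmod (g (gauss_embed m) - g 0 - ?p)"
      by (metis norm_add_rule_thm order_refl norm_triangle_mono)
    then show "cmod (\<phi> m - ?p) < \<epsilon>" using 1 gm[OF m] g0 by simp
  qed
qed

section \<open>Isotypic decomposition of polynomials\<close>

lemma fn_span_times:
  assumes "finite S" "finite T" "f \<in> fn.span S" "g \<in> fn.span T"
  shows "(\<lambda>x. f x * g x) \<in> fn.span ((\<lambda>(s, t) x. s x * t x) ` (S \<times> T))"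
proof -
  obtain u where u: "f = (\<lambda>x. \<Sum>s\<in>S. u s * s x)" using assms by (auto simp: fn_span_finite)
  obtain v where v: "g = (\<lambda>x. \<Sum>t\<in>T. v t * t x)" using assms by (auto simp: fn_span_finite)
  have "(\<lambda>x. f x * g x) = (\<lambda>x. \<Sum>s\<in>S. u s * (\<Sum>t\<in>T. v t * (s x * t x)))"
    unfolding u v sum_product by (simp add: sum_distrib_left mult_ac)
  moreover have "(\<lambda>x. \<Sum>s\<in>S. u s * (\<Sum>t\<in>T. v t * (s x * t x))) \<in>
      fn.span ((\<lambda>(s, t) x. s x * t x) ` (S \<times> T))"
    by (intro fn_span_sumI fn.span_base) auto
  ultimately show ?thesis by simp
qed

lemma polynomial_function_span:
  assumes "finite S" "\<forall>s\<in>S. polynomial_function s" "f \<in> fn.span S"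
  shows "polynomial_function (f :: 'a::real_normed_vector \<Rightarrow> complex)"
proof -
  obtain u where "f = (\<lambda>x. \<Sum>s\<in>S. u s * s x)" using assms by (auto simp: fn_span_finite)
  then show ?thesis
    using assms(1,2) by (auto intro!: polynomial_function_sum polynomial_function_complex_mult)
qed

context compact_group_action
begin

text \<open>The induction follows the construction of \<open>p\<close>. The coordinate functions
  span an invariant space because \<open>\<rho> (ginv k)\<close> acts linearly; for sums the
  generating sets are united, for products they are multiplied pairwise.\<close>

lemma translation_invariant_polynomials:
  assumes "real_polynomial_function p"
  shows "\<exists>S. finite S \<and> (\<forall>s\<in>S. polynomial_function s) \<and> translation_invariant (fn.span S) \<and>
    (\<lambda>x. complex_of_real (p x)) \<in> fn.span S"
  using assms
proof induction
  case (linear f)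
  interpret bounded_linear f by fact
  define e :: "'n \<Rightarrow> real^'n \<Rightarrow> complex" where "e i m = of_real (m $ i)" for i m
  have "polynomial_function (e i)" for i
    unfolding e_def by (intro polynomial_function_of_real real_polynomial_function.intros(1) bounded_linear_vec_nth)
  moreover have "translation_invariant (fn.span (range e))"
  proof (rule translation_invariant_span)
    fix k s assume "k \<in> K" "s \<in> range e"
    then obtain i where "s = e i" by blast
    then have "left_translate \<rho> k s = (\<lambda>m. \<Sum>j\<in>UNIV. of_real (\<rho> (ginv k) $ i $ j) * e j m)"
      by (simp add: fun_eq_iff left_translate_def e_def matrix_vector_mult_def)
    then show "left_translate \<rho> k s \<in> fn.span (range e)" by (simp add: fn_span_sumI fn.span_base)
  qed simp
  moreover have "(\<lambda>x. complex_of_real (f x)) \<in> fn.span (range e)"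
  proof -
    have expand: "f x = (\<Sum>i\<in>UNIV. f (axis i 1) * x $ i)" for x
    proof -
      have "f x = f (\<Sum>i\<in>UNIV. x $ i *\<^sub>R axis i 1)"
        using basis_expansion[of x] by (simp add: scalar_mult_eq_scaleR)
      then show ?thesis by (simp add: sum scaleR mult.commute)
    qed
    have "(\<lambda>x. complex_of_real (f x)) = (\<lambda>x. \<Sum>i\<in>UNIV. of_real (f (axis i 1)) * e i x)"
      by (rule ext, subst expand) (simp add: e_def)
    then show ?thesis by (simp add: fn_span_sumI fn.span_base)
  qed
  ultimately show ?case by (intro exI[of _ "range e"]) auto
next
  case (const c)
  have "translation_invariant (fn.span {\<lambda>_. 1})"
    by (rule translation_invariant_span) (auto simp: left_translate_def intro: fn.span_base)
  moreover have "(\<lambda>_. complex_of_real c) \<in> fn.span {\<lambda>_. 1}"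
    using fn.span_scale[OF fn.span_base[of "\<lambda>_. 1" "{\<lambda>_. 1}"], of "of_real c"] by simp
  ultimately show ?case by (intro exI[of _ "{\<lambda>_. 1}"]) auto
next
  case (add f g)
  then obtain S T where S: "finite S" "\<forall>s\<in>S. polynomial_function s" "translation_invariant (fn.span S)"
      "(\<lambda>x. complex_of_real (f x)) \<in> fn.span S"
    and T: "finite T" "\<forall>s\<in>T. polynomial_function s" "translation_invariant (fn.span T)"
      "(\<lambda>x. complex_of_real (g x)) \<in> fn.span T" by blast
  have sub: "fn.span S \<subseteq> fn.span (S \<union> T)" "fn.span T \<subseteq> fn.span (S \<union> T)"
    by (simp_all add: fn.span_mono)
  have "translation_invariant (fn.span (S \<union> T))"
  proof (rule translation_invariant_span)
    fix k s assume "k \<in> K" "s \<in> S \<union> T"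
    then show "left_translate \<rho> k s \<in> fn.span (S \<union> T)"
      using S(3) T(3) sub fn.span_base unfolding translation_invariant_def by blast
  qed (use S T in simp)
  moreover have "(\<lambda>x. complex_of_real (f x)) + (\<lambda>x. complex_of_real (g x)) \<in> fn.span (S \<union> T)"
    using S(4) T(4) sub by (intro fn.span_add) auto
  then have "(\<lambda>x. complex_of_real (f x + g x)) \<in> fn.span (S \<union> T)"
    by (simp add: plus_fun_def)
  ultimately show ?case using S(1,2) T(1,2) by (intro exI[of _ "S \<union> T"]) auto
next
  case (mult f g)
  then obtain S T where S: "finite S" "\<forall>s\<in>S. polynomial_function s" "translation_invariant (fn.span S)"
      "(\<lambda>x. complex_of_real (f x)) \<in> fn.span S"
    and T: "finite T" "\<forall>s\<in>T. polynomial_function s" "translation_invariant (fn.span T)"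
      "(\<lambda>x. complex_of_real (g x)) \<in> fn.span T" by blast
  let ?U = "(\<lambda>(s, t) x. s x * t x) ` (S \<times> T)"
  have "translation_invariant (fn.span ?U)"
  proof (rule translation_invariant_span)
    fix k w assume k: "k \<in> K" and "w \<in> ?U"
    then obtain s t where st: "s \<in> S" "t \<in> T" "w = (\<lambda>x. s x * t x)" by auto
    have "left_translate \<rho> k s \<in> fn.span S" "left_translate \<rho> k t \<in> fn.span T"
      using S(3) T(3) k st fn.span_base unfolding translation_invariant_def by blast+
    from fn_span_times[OF S(1) T(1) this] show "left_translate \<rho> k w \<in> fn.span ?U"
      by (simp add: st(3) left_translate_def)
  qed (use S T in simp)
  moreover have "(\<lambda>x. complex_of_real (f x * g x)) \<in> fn.span ?U"
    using fn_span_times[OF S(1) T(1) S(4) T(4)] by simp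
  moreover have "\<forall>w\<in>?U. polynomial_function w"
    using S(2) T(2) by (auto intro!: polynomial_function_complex_mult)
  ultimately show ?case using S(1) T(1) by (intro exI[of _ ?U]) auto
qed

lemma polynomial_in_invariant_span:
  assumes "polynomial_function p"
  obtains S where "finite S" "fn.independent S" "\<forall>s\<in>S. polynomial_function s"
    "\<forall>s\<in>S. orbit_continuous s" "translation_invariant (fn.span S)" "p \<in> fn.span S"
proof -
  have "real_polynomial_function (\<lambda>x. Re (p x))" "real_polynomial_function (\<lambda>x. Im (p x))"
    using assms by (auto simp: complex_polynomial_function_iff)
  then obtain S T where S: "finite S" "\<forall>s\<in>S. polynomial_function s" "translation_invariant (fn.span S)"
      "(\<lambda>x. complex_of_real (Re (p x))) \<in> fn.span S"
    and T: "finite T" "\<forall>s\<in>T. polynomial_function s" "translation_invariant (fn.span T)"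
      "(\<lambda>x. complex_of_real (Im (p x))) \<in> fn.span T"
    using translation_invariant_polynomials by meson
  have sub: "fn.span S \<subseteq> fn.span (S \<union> T)" "fn.span T \<subseteq> fn.span (S \<union> T)"
    by (simp_all add: fn.span_mono)
  have inv: "translation_invariant (fn.span (S \<union> T))"
  proof (rule translation_invariant_span)
    fix k s assume "k \<in> K" "s \<in> S \<union> T"
    then show "left_translate \<rho> k s \<in> fn.span (S \<union> T)"
      using S(3) T(3) sub fn.span_base unfolding translation_invariant_def by blast
  qed (use S T in simp)
  have "(\<lambda>x. complex_of_real (Re (p x))) + (\<lambda>x. \<i> * complex_of_real (Im (p x))) \<in> fn.span (S \<union> T)"
    using S(4) T(4) sub by (intro fn.span_add fn.span_scale) auto
  moreover have "(\<lambda>x. complex_of_real (Re (p x))) + (\<lambda>x. \<i> * complex_of_real (Im (p x))) = p"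
    by (simp add: fun_eq_iff complex_eq[symmetric])
  ultimately have p: "p \<in> fn.span (S \<union> T)" by simp
  \<comment> \<open>The union of the two generating sets may be dependent, while the decomposition
    works with bases.\<close>
  obtain B where B: "B \<subseteq> S \<union> T" "fn.independent B" "S \<union> T \<subseteq> fn.span B"
    using fn.maximal_independent_subset[of "S \<union> T"] by blast
  then have span: "fn.span B = fn.span (S \<union> T)"
    by (simp add: fn.span_minimal fn.span_mono subset_antisym)
  show ?thesis
  proof (rule that)
    show "finite B" using B(1) S(1) T(1) by (meson finite_Un finite_subset)
    show "\<forall>s\<in>B. polynomial_function s" using B(1) S(2) T(2) by blast
    then show "\<forall>s\<in>B. orbit_continuous s"
      using continuous_on_polymonial_function orbit_continuous_UNIV by blast
  qed (use B inv p span in auto)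
qed

lemma isotypic_proj_polynomial:
  assumes "\<Lambda> \<in> dual K" "polynomial_function p"
  shows "polynomial_function (isotypic_proj \<mu> \<rho> \<Lambda> p)"
proof -
  obtain S where S: "finite S" "fn.independent S" "\<forall>s\<in>S. polynomial_function s"
    "\<forall>s\<in>S. orbit_continuous s" "translation_invariant (fn.span S)" "p \<in> fn.span S"
    by (rule polynomial_in_invariant_span[OF assms(2)])
  show ?thesis
    using isotypic_proj_in_span[OF S(1,2,4,5) assms(1) S(6)] by (rule polynomial_function_span[OF S(1,3)])
qed

lemma polynomial_isotypic_decomposition:
  assumes "polynomial_function p"
  shows "p \<in> algebraic_sum (dual K) (\<lambda>\<Lambda>. isotypic_proj \<mu> \<rho> \<Lambda> ` Collect polynomial_function)"
proof -
  obtain S where S: "finite S" "fn.independent S" "\<forall>s\<in>S. polynomial_function s"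
    "\<forall>s\<in>S. orbit_continuous s" "translation_invariant (fn.span S)" "p \<in> fn.span S"
    by (rule polynomial_in_invariant_span[OF assms(1)])
  have "fn.span S \<subseteq> Collect polynomial_function"
    using polynomial_function_span[OF S(1,3)] by blast
  then have "algebraic_sum (dual K) (\<lambda>\<Lambda>. isotypic_proj \<mu> \<rho> \<Lambda> ` fn.span S) \<subseteq>
      algebraic_sum (dual K) (\<lambda>\<Lambda>. isotypic_proj \<mu> \<rho> \<Lambda> ` Collect polynomial_function)"
    by (intro algebraic_sum_mono image_mono)
  then show ?thesis using isotypic_decomposition[OF S(1,2,4,5,6)] by blast
qed

end

section \<open>Functions vanishing at infinity\<close>

lemma r2_eq_norm: "r2 m = (norm m)\<^sup>2"
  by (simp add: r2_def norm_vec_def L2_set_def sum_nonneg)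

text \<open>Carries ambient polynomials onto \<open>poly_gauss M\<close>, so that decompositions can
  be made before restriction, where translations act on polynomials on the whole space.\<close>

definition gauss_restrict :: "(real^'n) set \<Rightarrow> (real^'n \<Rightarrow> complex) \<Rightarrow> real^'n \<Rightarrow> complex" where
  "gauss_restrict M p m = (if m \<in> M then p m * of_real (exp (- r2 m)) else 0)"

lemma poly_gauss_eq: "poly_gauss M = gauss_restrict M ` Collect polynomial_function"
proof (intro equalityI subsetI)
  fix \<phi> assume "\<phi> \<in> poly_gauss M"
  then obtain p where "polynomial_function p" "\<phi> = (\<lambda>m. (if m \<in> M then p m else 0) * of_real (exp (- r2 m)))"
    by (auto simp: poly_gauss_def coord_ring_def)
  then show "\<phi> \<in> gauss_restrict M ` Collect polynomial_function"
    by (intro image_eqI[of _ _ p]) (auto simp: gauss_restrict_def fun_eq_iff)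
next
  fix \<phi> assume "\<phi> \<in> gauss_restrict M ` Collect polynomial_function"
  then obtain p where p: "polynomial_function p" "\<phi> = gauss_restrict M p" by blast
  then have "\<phi> = (\<lambda>m. (if m \<in> M then p m else 0) * of_real (exp (- r2 m)))"
    by (auto simp: gauss_restrict_def fun_eq_iff)
  with p(1) show "\<phi> \<in> poly_gauss M" by (auto simp: poly_gauss_def coord_ring_def)
qed

text \<open>In a closed \<open>M\<close> the intersections with closed balls are compact, so
  vanishing at infinity can be tested by a radius.\<close>

lemma C0I:
  assumes "continuous_on M \<phi>" "\<And>x. x \<notin> M \<Longrightarrow> \<phi> x = 0" "closed M"
    and van: "\<And>\<epsilon>. \<epsilon> > 0 \<Longrightarrow> \<exists>R. \<forall>m\<in>M. norm m > R \<longrightarrow> cmod (\<phi> m) < \<epsilon>"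
  shows "\<phi> \<in> C0 M"
  unfolding C0_def
proof (intro CollectI conjI allI impI)
  fix \<epsilon> :: real assume "\<epsilon> > 0"
  then obtain R where R: "\<forall>m\<in>M. norm m > R \<longrightarrow> cmod (\<phi> m) < \<epsilon>" using van by blast
  show "\<exists>C. compact C \<and> C \<subseteq> M \<and> (\<forall>m\<in>M - C. cmod (\<phi> m) < \<epsilon>)"
    using R assms(3) by (intro exI[of _ "M \<inter> cball 0 R"]) (auto intro: closed_Int_compact)
qed (use assms in auto)

lemma C0D:
  assumes "\<phi> \<in> C0 M"
  shows "continuous_on M \<phi>" "x \<notin> M \<Longrightarrow> \<phi> x = 0"
    "\<epsilon> > 0 \<Longrightarrow> \<exists>R. \<forall>m\<in>M. norm m > R \<longrightarrow> cmod (\<phi> m) < \<epsilon>"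
proof -
  assume "\<epsilon> > 0"
  then obtain C where C: "compact C" "\<forall>m\<in>M - C. cmod (\<phi> m) < \<epsilon>" using assms unfolding C0_def by blast
  obtain R where "\<And>m. m \<in> C \<Longrightarrow> norm m \<le> R" using compact_imp_bounded[OF C(1)] by (auto simp: bounded_iff)
  then show "\<exists>R. \<forall>m\<in>M. norm m > R \<longrightarrow> cmod (\<phi> m) < \<epsilon>"
    using C(2) by (intro exI[of _ R]) (metis DiffI not_less)
qed (use assms in \<open>auto simp: C0_def\<close>)

lemma poly_gauss_subset_C0:
  assumes "closed M"
  shows "poly_gauss M \<subseteq> C0 M"
  unfolding poly_gauss_eq
proof (intro subsetI, elim imageE)
  fix \<phi> p assume \<phi>: "\<phi> = gauss_restrict M p" and "p \<in> Collect polynomial_function"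
  then have p: "polynomial_function p" by simp
  show "\<phi> \<in> C0 M"
  proof (rule C0I)
    have "continuous_on M (\<lambda>m. p m * of_real (exp (- (norm m)\<^sup>2)))"
      using continuous_on_polymonial_function[OF p] by (intro continuous_intros)
    then show "continuous_on M \<phi>"
      by (rule continuous_on_cong[THEN iffD1, rotated -1]) (auto simp: \<phi> gauss_restrict_def r2_eq_norm)
    fix \<epsilon> :: real assume \<epsilon>: "\<epsilon> > 0"
    obtain A where A: "A \<ge> 0" "\<And>x. \<bar>Re (p x)\<bar> \<le> A * exp (1 / 2 * (norm x)\<^sup>2)"
      using real_polynomial_function_le_exp[of "\<lambda>x. Re (p x)" "1 / 2"] p by (auto simp: complex_polynomial_function_iff)
    obtain B where B: "B \<ge> 0" "\<And>x. \<bar>Im (p x)\<bar> \<le> B * exp (1 / 2 * (norm x)\<^sup>2)"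
      using real_polynomial_function_le_exp[of "\<lambda>x. Im (p x)" "1 / 2"] p by (auto simp: complex_polynomial_function_iff)
    \<comment> \<open>Half of the Gaussian absorbs the polynomial. The other half beats
      \<open>(A + B) / \<epsilon>\<close> because \<open>norm m\<close> is at most
      \<open>exp (1 / 2 * (norm m)\<^sup>2)\<close>, hence this radius.\<close>
    have "cmod (\<phi> m) < \<epsilon>" if m: "m \<in> M" "norm m > (A + B) / \<epsilon>" for m
    proof -
      let ?u = "(norm m)\<^sup>2"
      have "0 \<le> (norm m - 1)\<^sup>2" by simp
      then have "norm m \<le> 1 + 1 / 2 * ?u" unfolding power2_diff power_one by linarith
      also have "\<dots> \<le> exp (1 / 2 * ?u)" by (rule exp_ge_add_one_self)
      finally have "(A + B) / \<epsilon> < exp (1 / 2 * ?u)" using m(2) by linarith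
      then have lt: "A + B < \<epsilon> * exp (1 / 2 * ?u)" using \<epsilon> by (simp add: pos_divide_less_eq mult.commute)
      have "cmod (p m) \<le> (A + B) * exp (1 / 2 * ?u)"
        using cmod_le[of "p m"] A(2)[of m] B(2)[of m] by (simp add: ring_distribs)
      then have "cmod (p m) * exp (- ?u) \<le> (A + B) * exp (1 / 2 * ?u) * exp (- ?u)"
        by (intro mult_right_mono) auto
      also have "\<dots> = (A + B) * exp (- (1 / 2 * ?u))"
        by (simp add: mult.assoc flip: exp_add)
      also have "\<dots> < \<epsilon> * exp (1 / 2 * ?u) * exp (- (1 / 2 * ?u))"
        using lt by (intro mult_strict_right_mono) auto
      also have "\<dots> = \<epsilon>" by (simp add: mult.assoc flip: exp_add)
      finally show ?thesis using m(1) by (simp add: \<phi> gauss_restrict_def r2_eq_norm norm_mult)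
    qed
    then show "\<exists>R. \<forall>m\<in>M. norm m > R \<longrightarrow> cmod (\<phi> m) < \<epsilon>" by blast
  qed (use assms in \<open>auto simp: \<phi> gauss_restrict_def\<close>)
qed

lemma poly_gauss_dense:
  assumes "closed M" "\<phi> \<in> C0 M" "\<epsilon> > 0"
  obtains \<psi> where "\<psi> \<in> poly_gauss M" "\<And>x. cmod (\<phi> x - \<psi> x) < \<epsilon>"
proof -
  have van: "\<exists>C. compact C \<and> (\<forall>m\<in>M - C. cmod (\<phi> m) < \<delta>)" if "\<delta> > 0" for \<delta>
    using assms(2) that unfolding C0_def by blast
  obtain p where p: "polynomial_function p"
      "\<And>m. m \<in> M \<Longrightarrow> cmod (\<phi> m - p m * of_real (exp (- (norm m)\<^sup>2))) < \<epsilon>"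
    using gauss_polynomials_dense[OF assms(1) C0D(1)[OF assms(2)] van assms(3)] by blast
  show ?thesis
  proof (rule that)
    show "gauss_restrict M p \<in> poly_gauss M" using p(1) by (simp add: poly_gauss_eq)
    show "cmod (\<phi> x - gauss_restrict M p x) < \<epsilon>" for x
      using p(2)[of x] C0D(2)[OF assms(2), of x] assms(3) by (auto simp: gauss_restrict_def r2_eq_norm)
  qed
qed

section \<open>Closures in the supremum metric\<close>

lemma C0_dist_upper:
  assumes "\<phi> \<in> C0 M" "\<psi> \<in> C0 M"
  shows "cmod (\<phi> x - \<psi> x) \<le> C0_dist M \<phi> \<psi>"
  using cSUP_upper[OF _ C0_dist_bdd_above[OF assms], of x] assms by (simp add: C0_dist_def)

lemma C0_dist_least:
  assumes "\<phi> \<in> C0 M" "\<psi> \<in> C0 M" "\<And>x. cmod (\<phi> x - \<psi> x) \<le> r"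
  shows "C0_dist M \<phi> \<psi> \<le> r"
  using assms cSUP_least[of UNIV "\<lambda>x. cmod (\<phi> x - \<psi> x)" r] by (simp add: C0_dist_def)

lemma C0_closure_of_iff:
  assumes "S \<subseteq> C0 M"
  shows "\<phi> \<in> C0_topology M closure_of S \<longleftrightarrow>
    \<phi> \<in> C0 M \<and> (\<forall>r>0. \<exists>\<psi>\<in>S. \<forall>x. cmod (\<phi> x - \<psi> x) < r)"
proof -
  interpret Metric_space "C0 M" "C0_dist M" by (rule Metric_space_C0)
  have "\<phi> \<in> mtopology closure_of S \<longleftrightarrow> \<phi> \<in> C0 M \<and> (\<forall>r>0. \<exists>\<psi>\<in>S. C0_dist M \<phi> \<psi> < r)"
    unfolding metric_closure_of in_mball mem_Collect_eq using assms by blast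
  also have "\<dots> \<longleftrightarrow> \<phi> \<in> C0 M \<and> (\<forall>r>0. \<exists>\<psi>\<in>S. \<forall>x. cmod (\<phi> x - \<psi> x) < r)"
  proof (intro conj_cong refl iffI allI impI)
    fix r :: real assume \<phi>: "\<phi> \<in> C0 M" and "\<forall>r>0. \<exists>\<psi>\<in>S. C0_dist M \<phi> \<psi> < r" "r > 0"
    then obtain \<psi> where "\<psi> \<in> S" "C0_dist M \<phi> \<psi> < r" by blast
    then show "\<exists>\<psi>\<in>S. \<forall>x. cmod (\<phi> x - \<psi> x) < r"
      using C0_dist_upper[OF \<phi>, of \<psi>] assms by (meson le_less_trans subsetD)
  next
    fix r :: real assume \<phi>: "\<phi> \<in> C0 M" and H: "\<forall>r>0. \<exists>\<psi>\<in>S. \<forall>x. cmod (\<phi> x - \<psi> x) < r" and "r > 0"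
    \<comment> \<open>Strict pointwise bounds give only a weak bound on the supremum, hence half of
      \<open>r\<close>.\<close>
    then have "r / 2 > 0" by simp
    then obtain \<psi> where \<psi>: "\<psi> \<in> S" "\<forall>x. cmod (\<phi> x - \<psi> x) < r / 2" using H by blast
    then have "C0_dist M \<phi> \<psi> \<le> r / 2"
      using assms by (intro C0_dist_least \<phi>) (auto intro: less_imp_le)
    then show "\<exists>\<psi>\<in>S. C0_dist M \<phi> \<psi> < r" using \<psi>(1) \<open>r > 0\<close> by (intro bexI[of _ \<psi>]) auto
  qed
  finally show ?thesis by (simp add: C0_topology_def)
qed

section \<open>Projections on functions vanishing at infinity\<close>

locale isometric_group_action = compact_group_action K \<mu> \<rho>
  for K :: "(real^'n^'n) set" and \<mu> and \<rho> +
  fixes M :: "(real^'n) set"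
  assumes closed_M: "closed M"
    and M_invariant: "\<And>k m. k \<in> K \<Longrightarrow> m \<in> M \<Longrightarrow> \<rho> k *v m \<in> M"
    and r2_invariant: "\<And>k m. k \<in> K \<Longrightarrow> m \<in> M \<Longrightarrow> r2 (\<rho> k *v m) = r2 m"
begin

text \<open>Moving back by \<open>\<rho> k\<close> gives the converse direction. The complement of
  \<open>M\<close> is thus invariant too, which makes translation compatible with extension by
  zero.\<close>

lemma orbit_in_M_iff: "k \<in> K \<Longrightarrow> \<rho> (ginv k) *v m \<in> M \<longleftrightarrow> m \<in> M"
proof
  assume k: "k \<in> K" and m: "\<rho> (ginv k) *v m \<in> M"
  have "\<rho> k *v (\<rho> (ginv k) *v m) \<in> M" by (rule M_invariant[OF k m])
  moreover have "\<rho> k ** \<rho> (ginv k) = Finite_Cartesian_Product.mat 1"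
    using k rho_mult[of k "ginv k"] rho_one by simp
  ultimately show "m \<in> M" by (simp add: matrix_vector_mul_assoc)
qed (simp add: M_invariant)

lemma orbit_norm: "k \<in> K \<Longrightarrow> m \<in> M \<Longrightarrow> norm (\<rho> (ginv k) *v m) = norm m"
  using r2_invariant[of "ginv k" m] by (simp add: r2_eq_norm)

text \<open>An orbit lies either in \<open>M\<close>, where the function is continuous, or in the
  complement, where it is zero.\<close>

lemma orbit_continuous_C0:
  assumes "\<phi> \<in> C0 M"
  shows "orbit_continuous \<phi>"
  unfolding orbit_continuous_def left_translate_def
proof
  fix m
  show "continuous_on K (\<lambda>k. \<phi> (\<rho> (ginv k) *v m))"
  proof (cases "m \<in> M")
    case True
    then show ?thesis
      by (intro continuous_on_compose2[OF C0D(1)[OF assms] continuous_orbit]) (auto simp: orbit_in_M_iff)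
  next
    case False
    have "continuous_on K (\<lambda>k. 0 :: complex)" by (rule continuous_on_const)
    then show ?thesis
      by (rule continuous_on_cong[THEN iffD1, rotated -1])
        (use False in \<open>auto simp: C0D(2)[OF assms] orbit_in_M_iff\<close>)
  qed
qed

text \<open>On \<open>M\<close> the Gaussian is constant along each orbit and comes out of the
  integral; outside \<open>M\<close> both sides are zero.\<close>

lemma isotypic_proj_gauss_restrict:
  "isotypic_proj \<mu> \<rho> \<Lambda> (gauss_restrict M p) = gauss_restrict M (isotypic_proj \<mu> \<rho> \<Lambda> p)"
proof
  fix m
  show "isotypic_proj \<mu> \<rho> \<Lambda> (gauss_restrict M p) m = gauss_restrict M (isotypic_proj \<mu> \<rho> \<Lambda> p) m"
  proof (cases "m \<in> M")
    case True
    have "(\<integral>k. cnj (rep_character \<Lambda> k) * left_translate \<rho> k (gauss_restrict M p) m \<partial>\<mu>) =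
      (\<integral>k. cnj (rep_character \<Lambda> k) * left_translate \<rho> k p m * of_real (exp (- r2 m)) \<partial>\<mu>)"
      using True by (intro Bochner_Integration.integral_cong refl)
        (simp add: left_translate_def gauss_restrict_def orbit_in_M_iff r2_eq_norm orbit_norm)
    then show ?thesis using True by (simp add: isotypic_proj_def gauss_restrict_def)
  next
    case False
    have "(\<integral>k. cnj (rep_character \<Lambda> k) * left_translate \<rho> k (gauss_restrict M p) m \<partial>\<mu>) = (\<integral>k. 0 \<partial>\<mu>)"
      using False by (intro Bochner_Integration.integral_cong refl)
        (simp add: left_translate_def gauss_restrict_def orbit_in_M_iff)
    then show ?thesis using False by (simp add: isotypic_proj_def gauss_restrict_def)
  qed
qed

lemma isotypic_proj_poly_gauss:
  "\<Lambda> \<in> dual K \<Longrightarrow> \<phi> \<in> poly_gauss M \<Longrightarrow> isotypic_proj \<mu> \<rho> \<Lambda> \<phi> \<in> poly_gauss M"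
  by (auto simp: poly_gauss_eq isotypic_proj_gauss_restrict isotypic_proj_polynomial)

text \<open>Continuity is dominated convergence along sequences, with a constant majorant from the
  bounds on the character and on \<open>\<phi>\<close>. Decay at infinity holds because the orbit of
  a point of \<open>M\<close> stays in \<open>M\<close> at constant norm, so
  \<open>isotypic_proj_bound\<close> compares points at the same distance.\<close>

lemma isotypic_proj_C0:
  assumes \<Lambda>: "\<Lambda> \<in> dual K" and \<phi>: "\<phi> \<in> C0 M"
  shows "isotypic_proj \<mu> \<rho> \<Lambda> \<phi> \<in> C0 M"
proof (rule C0I[OF _ _ closed_M])
  note oc = orbit_continuous_C0[OF \<phi>]
  show "continuous_on M (isotypic_proj \<mu> \<rho> \<Lambda> \<phi>)"
    unfolding continuous_on_sequentially
  proof (intro allI ballI impI)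
    fix s m assume m: "m \<in> M" and "(\<forall>n. s n \<in> M) \<and> s \<longlonglongrightarrow> m"
    then have s: "\<And>n. s n \<in> M" "s \<longlonglongrightarrow> m" by auto
    obtain B where B: "\<And>x. cmod (\<phi> x) \<le> B" using C0_bounded[OF \<phi>] by blast
    obtain D where D: "D > 0" "\<And>k. k \<in> K \<Longrightarrow> cmod (rep_character \<Lambda> k) \<le> D"
      using bounded_continuous[OF continuous_rep_character[OF \<Lambda>]] by blast
    have "(\<lambda>n. \<integral>k. cnj (rep_character \<Lambda> k) * left_translate \<rho> k \<phi> (s n) \<partial>\<mu>) \<longlonglongrightarrow>
      (\<integral>k. cnj (rep_character \<Lambda> k) * left_translate \<rho> k \<phi> m \<partial>\<mu>)"
    proof (rule integral_dominated_convergence[where w="\<lambda>_. D * B"])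
      show "AE k in \<mu>. (\<lambda>n. cnj (rep_character \<Lambda> k) * left_translate \<rho> k \<phi> (s n)) \<longlonglongrightarrow>
          cnj (rep_character \<Lambda> k) * left_translate \<rho> k \<phi> m"
      proof (intro AE_I2 tendsto_mult tendsto_const)
        fix k assume "k \<in> space \<mu>"
        then have k: "k \<in> K" by simp
        have "(\<lambda>n. \<rho> (ginv k) *v s n) \<longlonglongrightarrow> \<rho> (ginv k) *v m"
          by (intro bounded_linear.tendsto[OF matrix_vector_mul_bounded_linear] s)
        then show "(\<lambda>n. left_translate \<rho> k \<phi> (s n)) \<longlonglongrightarrow> left_translate \<rho> k \<phi> m"
          unfolding left_translate_def
          by (rule continuous_on_tendsto_compose[OF C0D(1)[OF \<phi>]]) (auto simp: orbit_in_M_iff k m s)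
      qed
      show "AE k in \<mu>. cmod (cnj (rep_character \<Lambda> k) * left_translate \<rho> k \<phi> (s n)) \<le> D * B" for n
        using B D(2) by (intro AE_I2) (auto simp: norm_mult left_translate_def intro!: mult_mono order_trans[OF norm_ge_zero D(2)])
    qed (use integrable_isotypic[OF \<Lambda> oc] in auto)
    then show "(isotypic_proj \<mu> \<rho> \<Lambda> \<phi> \<circ> s) \<longlonglongrightarrow> isotypic_proj \<mu> \<rho> \<Lambda> \<phi> m"
      unfolding isotypic_proj_def comp_def by (intro tendsto_mult tendsto_const)
  qed
  obtain C where C: "C > 0" "\<And>f B m. orbit_continuous f \<Longrightarrow>
    (\<And>k. k \<in> K \<Longrightarrow> cmod (left_translate \<rho> k f m) \<le> B) \<Longrightarrow> cmod (isotypic_proj \<mu> \<rho> \<Lambda> f m) \<le> C * B"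
    using isotypic_proj_bound[OF \<Lambda>] by blast
  \<comment> \<open>The orbit of a point outside \<open>M\<close> stays outside, so the orbit bound
    applies with \<open>B = 0\<close>.\<close>
  show "isotypic_proj \<mu> \<rho> \<Lambda> \<phi> x = 0" if "x \<notin> M" for x
    using C(2)[OF oc, of x 0] that by (simp add: left_translate_def C0D(2)[OF \<phi>] orbit_in_M_iff)
  fix \<epsilon> :: real assume \<epsilon>: "\<epsilon> > 0"
  then have "\<epsilon> / (2 * C) > 0" using C(1) by simp
  then obtain R where R: "\<forall>m\<in>M. norm m > R \<longrightarrow> cmod (\<phi> m) < \<epsilon> / (2 * C)" using C0D(3)[OF \<phi>] by blast
  have "cmod (isotypic_proj \<mu> \<rho> \<Lambda> \<phi> m) < \<epsilon>" if m: "m \<in> M" "norm m > R" for m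
  proof -
    have "cmod (isotypic_proj \<mu> \<rho> \<Lambda> \<phi> m) \<le> C * (\<epsilon> / (2 * C))"
      using R m by (intro C(2) oc) (auto simp: left_translate_def orbit_in_M_iff orbit_norm intro: less_imp_le)
    also have "\<dots> < \<epsilon>" using C(1) \<epsilon> by simp
    finally show ?thesis .
  qed
  then show "\<exists>R. \<forall>m\<in>M. norm m > R \<longrightarrow> cmod (isotypic_proj \<mu> \<rho> \<Lambda> \<phi> m) < \<epsilon>" by blast
qed

text \<open>By idempotence an element of the range is its own projection, so the preimage in
  \<open>C0 M\<close> can be replaced by the element itself, which lies in
  \<open>poly_gauss M\<close>. The reverse inclusion holds because projections preserve
  \<open>poly_gauss M\<close>.\<close>

lemma poly_gauss_isotypic_eq:
  assumes "\<Lambda> \<in> dual K"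
  shows "poly_gauss_isotypic M \<mu> \<rho> \<Lambda> = isotypic_proj \<mu> \<rho> \<Lambda> ` poly_gauss M"
proof (intro equalityI subsetI)
  fix \<phi> assume "\<phi> \<in> poly_gauss_isotypic M \<mu> \<rho> \<Lambda>"
  then obtain \<psi> where \<phi>: "\<phi> \<in> poly_gauss M" "\<psi> \<in> C0 M" "\<phi> = isotypic_proj \<mu> \<rho> \<Lambda> \<psi>"
    by (auto simp: poly_gauss_isotypic_def C0_isotypic_def)
  then have "\<phi> = isotypic_proj \<mu> \<rho> \<Lambda> \<phi>"
    using isotypic_proj_idem[OF assms orbit_continuous_C0] by simp
  then show "\<phi> \<in> isotypic_proj \<mu> \<rho> \<Lambda> ` poly_gauss M" using \<phi>(1) by blast
next
  fix \<phi> assume "\<phi> \<in> isotypic_proj \<mu> \<rho> \<Lambda> ` poly_gauss M"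
  then show "\<phi> \<in> poly_gauss_isotypic M \<mu> \<rho> \<Lambda>"
    using poly_gauss_subset_C0[OF closed_M] isotypic_proj_poly_gauss[OF assms]
    by (auto simp: poly_gauss_isotypic_def C0_isotypic_def)
qed

lemma poly_gauss_algebraic_sum:
  "poly_gauss M = algebraic_sum (dual K) (poly_gauss_isotypic M \<mu> \<rho>)"
proof (intro equalityI subsetI)
  fix \<phi> assume "\<phi> \<in> poly_gauss M"
  then obtain p where p: "polynomial_function p" "\<phi> = gauss_restrict M p" by (auto simp: poly_gauss_eq)
  from polynomial_isotypic_decomposition[OF p(1)] obtain F f where F: "finite F" "F \<subseteq> dual K"
      "\<forall>\<Lambda>\<in>F. f \<Lambda> \<in> isotypic_proj \<mu> \<rho> \<Lambda> ` Collect polynomial_function" "p = (\<lambda>x. \<Sum>\<Lambda>\<in>F. f \<Lambda> x)"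
    by (rule algebraic_sumE)
  have "\<phi> = (\<lambda>x. \<Sum>\<Lambda>\<in>F. gauss_restrict M (f \<Lambda>) x)"
    by (simp add: p(2) F(4) gauss_restrict_def fun_eq_iff sum_distrib_right)
  moreover have "gauss_restrict M (f \<Lambda>) \<in> poly_gauss_isotypic M \<mu> \<rho> \<Lambda>" if "\<Lambda> \<in> F" for \<Lambda>
  proof -
    have \<Lambda>: "\<Lambda> \<in> dual K" using F(2) that by blast
    have "f \<Lambda> \<in> isotypic_proj \<mu> \<rho> \<Lambda> ` Collect polynomial_function"
      using F(3) that by (rule bspec)
    then obtain g where g: "polynomial_function g" "f \<Lambda> = isotypic_proj \<mu> \<rho> \<Lambda> g"
      by (elim imageE) simp
    have "gauss_restrict M (f \<Lambda>) = isotypic_proj \<mu> \<rho> \<Lambda> (gauss_restrict M g)"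
      by (simp only: g(2) isotypic_proj_gauss_restrict)
    moreover have "gauss_restrict M g \<in> poly_gauss M" using g(1) by (simp add: poly_gauss_eq)
    ultimately show ?thesis unfolding poly_gauss_isotypic_eq[OF \<Lambda>] by (simp only: imageI)
  qed
  ultimately show "\<phi> \<in> algebraic_sum (dual K) (poly_gauss_isotypic M \<mu> \<rho>)"
    unfolding algebraic_sum_def using F(1,2) by (intro CollectI exI[of _ F] exI[of _ "\<lambda>\<Lambda>. gauss_restrict M (f \<Lambda>)"]) simp
next
  fix \<phi> assume "\<phi> \<in> algebraic_sum (dual K) (poly_gauss_isotypic M \<mu> \<rho>)"
  then obtain F f where F: "finite F" "F \<subseteq> dual K" "\<forall>\<Lambda>\<in>F. f \<Lambda> \<in> poly_gauss_isotypic M \<mu> \<rho> \<Lambda>"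
      "\<phi> = (\<lambda>x. \<Sum>\<Lambda>\<in>F. f \<Lambda> x)"
    by (rule algebraic_sumE)
  have "\<exists>p. polynomial_function p \<and> f \<Lambda> = gauss_restrict M p" if "\<Lambda> \<in> F" for \<Lambda>
    using bspec[OF F(3) that] by (auto simp: poly_gauss_isotypic_def poly_gauss_eq)
  then obtain p where p: "\<And>\<Lambda>. \<Lambda> \<in> F \<Longrightarrow> polynomial_function (p \<Lambda>)" "\<And>\<Lambda>. \<Lambda> \<in> F \<Longrightarrow> f \<Lambda> = gauss_restrict M (p \<Lambda>)"
    by metis
  have "\<phi> = gauss_restrict M (\<lambda>x. \<Sum>\<Lambda>\<in>F. p \<Lambda> x)"
    by (simp add: F(4) p(2) gauss_restrict_def fun_eq_iff sum_distrib_right)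
  moreover have "polynomial_function (\<lambda>x. \<Sum>\<Lambda>\<in>F. p \<Lambda> x)" using F(1) p(1) by (intro polynomial_function_sum)
  ultimately show "\<phi> \<in> poly_gauss M" by (simp add: poly_gauss_eq)
qed

text \<open>The range of the projection is its set of fixed points in \<open>C0 M\<close>, which is
  closed by boundedness. Conversely, projecting an approximation of a preimage approximates the
  image, at the cost of the factor \<open>C\<close>.\<close>

lemma closure_poly_gauss_isotypic:
  assumes \<Lambda>: "\<Lambda> \<in> dual K"
  shows "C0_topology M closure_of poly_gauss_isotypic M \<mu> \<rho> \<Lambda> = C0_isotypic M \<mu> \<rho> \<Lambda>"
proof -
  note sub = poly_gauss_subset_C0[OF closed_M]
  have sub': "poly_gauss_isotypic M \<mu> \<rho> \<Lambda> \<subseteq> C0 M" using sub by (auto simp: poly_gauss_isotypic_def)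
  obtain C where C: "C > 0" "\<And>f B m. orbit_continuous f \<Longrightarrow>
    (\<And>k. k \<in> K \<Longrightarrow> cmod (left_translate \<rho> k f m) \<le> B) \<Longrightarrow> cmod (isotypic_proj \<mu> \<rho> \<Lambda> f m) \<le> C * B"
    using isotypic_proj_bound[OF \<Lambda>] by blast
  have diff: "cmod (isotypic_proj \<mu> \<rho> \<Lambda> \<phi> m - isotypic_proj \<mu> \<rho> \<Lambda> \<psi> m) \<le> C * B"
    if "\<phi> \<in> C0 M" "\<psi> \<in> C0 M" "\<And>x. cmod (\<phi> x - \<psi> x) < B" for \<phi> \<psi> B m
  proof -
    note oc = orbit_continuous_C0[OF that(1)] orbit_continuous_C0[OF that(2)]
    have "orbit_continuous (\<lambda>x. \<phi> x - \<psi> x)"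
      using oc by (auto simp: orbit_continuous_def left_translate_def intro: continuous_on_diff)
    from C(2)[OF this, of m B] show ?thesis
      using that(3) by (simp add: isotypic_proj_diff[OF \<Lambda> oc] left_translate_def less_imp_le)
  qed
  show ?thesis
  proof (intro equalityI subsetI)
    fix \<phi> assume "\<phi> \<in> C0_topology M closure_of poly_gauss_isotypic M \<mu> \<rho> \<Lambda>"
    then have \<phi>: "\<phi> \<in> C0 M" and
      approx: "\<And>r. r > 0 \<Longrightarrow> \<exists>\<psi>\<in>poly_gauss_isotypic M \<mu> \<rho> \<Lambda>. \<forall>x. cmod (\<phi> x - \<psi> x) < r"
      unfolding C0_closure_of_iff[OF sub'] by blast+
    have "isotypic_proj \<mu> \<rho> \<Lambda> \<phi> m = \<phi> m" for m
    proof -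
      have "cmod (isotypic_proj \<mu> \<rho> \<Lambda> \<phi> m - \<phi> m) \<le> 0 + e" if "e > 0" for e
      proof -
        \<comment> \<open>The error is counted once directly and \<open>C\<close> times through the
          projection, so a share of \<open>e / (C + 1)\<close> suffices.\<close>
        have "e / (C + 1) > 0" using that C(1) by simp
        then obtain \<psi> where \<psi>: "\<psi> \<in> poly_gauss_isotypic M \<mu> \<rho> \<Lambda>" "\<And>x. cmod (\<phi> x - \<psi> x) < e / (C + 1)"
          using approx by blast
        have fixed: "isotypic_proj \<mu> \<rho> \<Lambda> \<psi> = \<psi>"
          using \<psi>(1) isotypic_proj_idem[OF \<Lambda> orbit_continuous_C0]
          by (auto simp: poly_gauss_isotypic_def C0_isotypic_def)
        have "cmod (isotypic_proj \<mu> \<rho> \<Lambda> \<phi> m - \<phi> m) \<le>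
            cmod (isotypic_proj \<mu> \<rho> \<Lambda> \<phi> m - isotypic_proj \<mu> \<rho> \<Lambda> \<psi> m) + cmod (\<phi> m - \<psi> m)"
          using norm_triangle_ineq4[of "isotypic_proj \<mu> \<rho> \<Lambda> \<phi> m - isotypic_proj \<mu> \<rho> \<Lambda> \<psi> m" "\<phi> m - \<psi> m"]
          by (simp add: fixed)
        also have "\<dots> \<le> C * (e / (C + 1)) + e / (C + 1)"
          using diff[OF \<phi> _ \<psi>(2)] \<psi> sub' by (intro add_mono) (auto intro: less_imp_le)
        also have "\<dots> = (C + 1) * (e / (C + 1))" by (simp only: ring_distribs mult_1_left)
        also have "\<dots> = e" using C(1) by simp
        finally show ?thesis by simp
      qed
      then have "cmod (isotypic_proj \<mu> \<rho> \<Lambda> \<phi> m - \<phi> m) \<le> 0" by (rule field_le_epsilon)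
      then show ?thesis by simp
    qed
    then have "\<phi> = isotypic_proj \<mu> \<rho> \<Lambda> \<phi>" by (simp add: fun_eq_iff)
    then show "\<phi> \<in> C0_isotypic M \<mu> \<rho> \<Lambda>" using \<phi> unfolding C0_isotypic_def by blast
  next
    fix \<phi> assume "\<phi> \<in> C0_isotypic M \<mu> \<rho> \<Lambda>"
    then obtain \<psi> where \<psi>: "\<psi> \<in> C0 M" "\<phi> = isotypic_proj \<mu> \<rho> \<Lambda> \<psi>" by (auto simp: C0_isotypic_def)
    show "\<phi> \<in> C0_topology M closure_of poly_gauss_isotypic M \<mu> \<rho> \<Lambda>"
      unfolding C0_closure_of_iff[OF sub']
    proof (intro conjI allI impI)
      show "\<phi> \<in> C0 M" using isotypic_proj_C0[OF \<Lambda>] \<psi> by simp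
      fix r :: real assume r: "r > 0"
      then have "r / (2 * C) > 0" using C(1) by simp
      then obtain \<theta> where \<theta>: "\<theta> \<in> poly_gauss M" "\<And>x. cmod (\<psi> x - \<theta> x) < r / (2 * C)"
        using poly_gauss_dense[OF closed_M \<psi>(1)] by blast
      have "cmod (\<phi> x - isotypic_proj \<mu> \<rho> \<Lambda> \<theta> x) < r" for x
      proof -
        have "cmod (\<phi> x - isotypic_proj \<mu> \<rho> \<Lambda> \<theta> x) \<le> C * (r / (2 * C))"
          unfolding \<psi>(2) using \<theta> sub by (intro diff \<psi>(1)) auto
        also have "\<dots> < r" using C(1) r by simp
        finally show ?thesis .
      qed
      then show "\<exists>\<psi>\<in>poly_gauss_isotypic M \<mu> \<rho> \<Lambda>. \<forall>x. cmod (\<phi> x - \<psi> x) < r"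
        using \<theta>(1) unfolding poly_gauss_isotypic_eq[OF \<Lambda>] by blast
    qed
  qed
qed

end

section \<open>From algebraic hypotheses to the topological setting\<close>

lemma algebraic_set_closed:
  assumes "algebraic_set M"
  shows "closed M"
proof -
  from assms obtain S where S: "\<forall>p\<in>S. real_polynomial_function p" "M = {x. \<forall>p\<in>S. p x = 0}"
    by (auto simp: algebraic_set_def)
  have "closed {x. p x = 0}" if "p \<in> S" for p
    using that S(1) continuous_real_polymonial_function
    by (intro closed_Collect_eq continuous_intros) (auto intro!: continuous_at_imp_continuous_on)
  then have "closed (\<Inter>p\<in>S. {x. p x = 0})" by (intro closed_INT) blast
  moreover have "M = (\<Inter>p\<in>S. {x. p x = 0})" using S(2) by blast
  ultimately show ?thesis by simp
qed

lemma continuous_on_det: "continuous_on S (Determinants.det :: real^'n^'n \<Rightarrow> real)"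
  unfolding Determinants.det_def[abs_def]
  by (intro continuous_intros continuous_on_component continuous_on_id)

text \<open>The entries are polynomials divided by powers of the determinant, which is nonzero on
  \<open>G\<close>.\<close>

lemma regular_rep_continuous:
  assumes "linear_algebraic_group G" "regular_rep G \<rho>"
  shows "continuous_on G \<rho>"
proof -
  have G: "Determinants.det g \<noteq> 0" if "g \<in> G" for g
    using assms(1) that subgroup.subset[of G GL]
    by (auto simp: linear_algebraic_group_def invertible_det_nz)
  have "continuous_on G (\<lambda>g. \<rho> g $ i $ j)" for i j
  proof -
    obtain p N where p: "real_polynomial_function p" "\<And>g. g \<in> G \<Longrightarrow> \<rho> g $ i $ j = p g / Determinants.det g ^ N"
      using assms(2) unfolding regular_rep_def by blast
    have "continuous_on G (\<lambda>g. p g / Determinants.det g ^ N)"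
      using G continuous_real_polymonial_function[OF p(1)]
      by (intro continuous_intros continuous_on_det) (auto intro: continuous_at_imp_continuous_on)
    then show ?thesis by (rule continuous_on_cong[THEN iffD1, rotated -1]) (auto simp: p(2))
  qed
  then have "continuous_on G (\<lambda>g. \<chi> i j. \<rho> g $ i $ j)" by (intro continuous_on_vec_lambda)
  then show ?thesis by (simp add: vec_lambda_eta)
qed

theorem lemma3:
  fixes G K :: "(real^'n^'n) set"
    and M :: "(real^'n) set"
    and \<rho> :: "real^'n^'n \<Rightarrow> real^'n^'n"
    and \<mu> :: "(real^'n^'n) measure"
  assumes G: "linear_algebraic_group G"
    and G_transpose: "\<forall>g\<in>G. transpose g \<in> G"
    and K: "maximal_compact_subgroup K G"
    and M: "smooth_affine_variety M"
    and action: "regular_rep G \<rho>" "\<forall>g\<in>G. \<forall>m\<in>M. \<rho> g *v m \<in> M"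
    and r2_invariant: "\<forall>k\<in>K. \<forall>m\<in>M. r2 (\<rho> k *v m) = r2 m"
    and haar: "normalized_haar K \<mu>"
  shows "poly_gauss M = algebraic_sum (dual K) (poly_gauss_isotypic M \<mu> \<rho>) \<and>
    (\<forall>\<Lambda>\<in>dual K. C0_topology M closure_of poly_gauss_isotypic M \<mu> \<rho> \<Lambda> = C0_isotypic M \<mu> \<rho> \<Lambda>)"
proof -
  have KG: "K \<subseteq> G" "subgroup K GL" "compact K" using K by (auto simp: maximal_compact_subgroup_def)
  interpret compact_matrix_group K \<mu> by (intro compact_matrix_group.intro KG(2,3) haar)
  have hom: "\<rho> g \<in> carrier GL" "\<rho> (g ** h) = \<rho> g ** \<rho> h" if "g \<in> G" "h \<in> G" for g h
    using action(1) that by (auto simp: regular_rep_def hom_def)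
  \<comment> \<open>\<open>hom\<close> supplies multiplicativity and invertibility of the values;
    the image of the identity is then an invertible idempotent, hence the identity.\<close>
  have one: "\<rho> (Finite_Cartesian_Product.mat 1) = Finite_Cartesian_Product.mat 1"
  proof -
    let ?e = "Finite_Cartesian_Product.mat 1 :: real^'n^'n"
    have e: "?e \<in> G" using one_K KG(1) by blast
    have "\<rho> ?e ** \<rho> ?e = \<rho> ?e" using hom(2)[OF e e] by simp
    moreover obtain B where "B ** \<rho> ?e = ?e"
      using hom(1)[OF e e] by (auto simp: invertible_def)
    ultimately show ?thesis by (metis matrix_mul_assoc matrix_mul_lid)
  qed
  interpret isometric_group_action K \<mu> \<rho> M
  proof unfold_locales
    show "continuous_on K \<rho>" using regular_rep_continuous[OF G action(1)] KG(1) by (rule continuous_on_subset)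
    show "closed M" using M by (simp add: smooth_affine_variety_def algebraic_set_closed)
    show "\<rho> (k ** l) = \<rho> k ** \<rho> l" if "k \<in> K" "l \<in> K" for k l
      using that KG(1) by (intro hom(2)) auto
    show "\<rho> k *v m \<in> M" if "k \<in> K" "m \<in> M" for k m
      using that KG(1) action(2) by blast
    show "r2 (\<rho> k *v m) = r2 m" if "k \<in> K" "m \<in> M" for k m
      using that r2_invariant by blast
  qed (rule one)
  show ?thesis using poly_gauss_algebraic_sum closure_poly_gauss_isotypic by blast
qed

end
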